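(* Let $A$ be an artin algebra. Then $A$ is of representation bound two if and only if $A$ is a Nakayama algebra of Loewy length two.
   Context: $A$ is an artin $R$-algebra, where $R$ is a commutative artinian ring; $\mathrm{mod}\,A$ is the category of finitely generated left $A$-modules. The representation bound of $A$ is the supremum of the composition lengths of the indecomposable left $A$-modules of finite length. A module is uniserial if any two of its submodules are comparable under inclusion. $A$ is a Nakayama algebra if all indecomposable projective and injective modules in $\mathrm{mod}\,A$ are uniserial. The Loewy length of $A$ is the least $n$ with $J^n=0$, where $J$ is the Jacobson radical of $A$. *)

theory Defs
  imports "HOL-Algebra.Algebra" "HOL-Library.Extended_Nat"
begin

section \<open>Left modules over a ring that need not be commutative\<close>

text \<open>The locale \<^locale>\<open>module\<close> requires a commutative ring of scalars; the record type
  and the locale \<^locale>\<open>submodule\<close> do not, and are reused here.  As in the library, the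
  fields \<open>mult\<close> and \<open>one\<close> of the record \<open>M\<close> are not used.\<close>

locale left_module = A?: ring A + M?: abelian_group M
  for A :: "('a, 'b) ring_scheme" (structure) and M :: "('a, 'm, 'x) module_scheme" (structure) +
  assumes smult_closed [simp, intro]:
      "\<lbrakk> a \<in> carrier A; x \<in> carrier M \<rbrakk> \<Longrightarrow> a \<odot>\<^bsub>M\<^esub> x \<in> carrier M"
    and smult_l_distr:
      "\<lbrakk> a \<in> carrier A; b \<in> carrier A; x \<in> carrier M \<rbrakk> \<Longrightarrow>
        (a \<oplus>\<^bsub>A\<^esub> b) \<odot>\<^bsub>M\<^esub> x = a \<odot>\<^bsub>M\<^esub> x \<oplus>\<^bsub>M\<^esub> b \<odot>\<^bsub>M\<^esub> x"
    and smult_r_distr: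
      "\<lbrakk> a \<in> carrier A; x \<in> carrier M; y \<in> carrier M \<rbrakk> \<Longrightarrow>
        a \<odot>\<^bsub>M\<^esub> (x \<oplus>\<^bsub>M\<^esub> y) = a \<odot>\<^bsub>M\<^esub> x \<oplus>\<^bsub>M\<^esub> a \<odot>\<^bsub>M\<^esub> y"
    and smult_assoc:
      "\<lbrakk> a \<in> carrier A; b \<in> carrier A; x \<in> carrier M \<rbrakk> \<Longrightarrow>
        (a \<otimes>\<^bsub>A\<^esub> b) \<odot>\<^bsub>M\<^esub> x = a \<odot>\<^bsub>M\<^esub> (b \<odot>\<^bsub>M\<^esub> x)"
    and smult_one [simp]:
      "x \<in> carrier M \<Longrightarrow> \<one>\<^bsub>A\<^esub> \<odot>\<^bsub>M\<^esub> x = x"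

definition finitely_generated ::
  "('a, 'b) ring_scheme \<Rightarrow> ('a, 'm, 'x) module_scheme \<Rightarrow> bool" where
  "finitely_generated A M \<longleftrightarrow>
    (\<exists>S. finite S \<and> S \<subseteq> carrier M \<and> (\<forall>N. submodule N A M \<and> S \<subseteq> N \<longrightarrow> N = carrier M))"

definition left_module_hom ::
  "('a, 'b) ring_scheme \<Rightarrow> ('a, 'm, 'x) module_scheme \<Rightarrow> ('a, 'n, 'y) module_scheme \<Rightarrow> ('m \<Rightarrow> 'n) set"
  where
  "left_module_hom A M N = {f \<in> carrier M \<rightarrow> carrier N.
    (\<forall>x \<in> carrier M. \<forall>y \<in> carrier M. f (x \<oplus>\<^bsub>M\<^esub> y) = f x \<oplus>\<^bsub>N\<^esub> f y) \<and>
    (\<forall>a \<in> carrier A. \<forall>x \<in> carrier M. f (a \<odot>\<^bsub>M\<^esub> x) = a \<odot>\<^bsub>N\<^esub> f x)}"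

definition indecomposable ::
  "('a, 'b) ring_scheme \<Rightarrow> ('a, 'm, 'x) module_scheme \<Rightarrow> bool" where
  "indecomposable A M \<longleftrightarrow> carrier M \<noteq> {\<zero>\<^bsub>M\<^esub>} \<and>
    (\<forall>N K. submodule N A M \<and> submodule K A M \<and>
       N <+>\<^bsub>M\<^esub> K = carrier M \<and> N \<inter> K = {\<zero>\<^bsub>M\<^esub>} \<longrightarrow> N = {\<zero>\<^bsub>M\<^esub>} \<or> K = {\<zero>\<^bsub>M\<^esub>})"

definition uniserial ::
  "('a, 'b) ring_scheme \<Rightarrow> ('a, 'm, 'x) module_scheme \<Rightarrow> bool" where
  "uniserial A M \<longleftrightarrow> (\<forall>N K. submodule N A M \<and> submodule K A M \<longrightarrow> N \<subseteq> K \<or> K \<subseteq> N)"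

definition composition_series ::
  "('a, 'b) ring_scheme \<Rightarrow> ('a, 'm, 'x) module_scheme \<Rightarrow> nat \<Rightarrow> (nat \<Rightarrow> 'm set) \<Rightarrow> bool" where
  "composition_series A M n N \<longleftrightarrow>
    N 0 = {\<zero>\<^bsub>M\<^esub>} \<and> N n = carrier M \<and> (\<forall>i \<le> n. submodule (N i) A M) \<and>
    (\<forall>i < n. N i \<subset> N (Suc i) \<and>
       \<not> (\<exists>K. submodule K A M \<and> N i \<subset> K \<and> K \<subset> N (Suc i)))"

definition finite_length ::
  "('a, 'b) ring_scheme \<Rightarrow> ('a, 'm, 'x) module_scheme \<Rightarrow> bool" where
  "finite_length A M \<longleftrightarrow> (\<exists>n N. composition_series A M n N)"

text \<open>All composition series of a module have the same length, so that \<open>LEAST\<close> only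
  selects this common value.\<close>

definition composition_length ::
  "('a, 'b) ring_scheme \<Rightarrow> ('a, 'm, 'x) module_scheme \<Rightarrow> nat" where
  "composition_length A M = (LEAST n. \<exists>N. composition_series A M n N)"


section \<open>The category of finitely generated left modules\<close>

text \<open>HOL cannot quantify over the modules of all types.  A module generated by \<open>n\<close> elements has
  at most as many elements as there are lists of length \<open>n\<close> over the ring, hence it is isomorphic
  to a module whose elements are lists over the ring (lemma \<open>fg_left_module_iso_list_module\<close>).
  So the modules of the following type represent all isomorphism classes of finitely generated
  modules, in particular all those of modules of finite length.\<close>

type_synonym 'a list_module = "('a, 'a list) module"

lemma (in left_module) finite_subset_in_submodule_of_list_image:
  assumes "finite S" "S \<subseteq> carrier M"
  shows "\<exists>N (f :: 'a list \<Rightarrow> 'm). submodule N A M \<and> S \<subseteq> N \<and> N \<subseteq> range f"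
  using assms
proof (induction S)
  case empty
  have "a \<odot>\<^bsub>M\<^esub> \<zero>\<^bsub>M\<^esub> = \<zero>\<^bsub>M\<^esub>" if "a \<in> carrier A" for a
    using smult_r_distr[OF that M.zero_closed M.zero_closed]
      smult_closed[OF that M.zero_closed]
    by (metis M.add.l_cancel_one' M.l_zero M.zero_closed)
  then have "submodule {\<zero>\<^bsub>M\<^esub>} A M"
    by (intro submodule.intro M.add.triv_subgroup[simplified] submodule_axioms.intro) auto
  then show ?case by (intro exI[of _ "{\<zero>\<^bsub>M\<^esub>}"] exI[of _ "\<lambda>_. \<zero>\<^bsub>M\<^esub>"]) auto
next
  case (insert x S)
  then obtain N and f :: "'a list \<Rightarrow> 'm"
    where N: "submodule N A M" and S: "S \<subseteq> N" and f: "N \<subseteq> range f" by auto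
  have x: "x \<in> carrier M" using insert by auto
  interpret N: submodule N A M by (fact N)
  have Nc: "n \<in> carrier M" if "n \<in> N" for n using N.subset that by auto
  have N0: "\<zero>\<^bsub>M\<^esub> \<in> N" using N.one_closed by simp
  have Nadd: "m \<oplus>\<^bsub>M\<^esub> n \<in> N" if "m \<in> N" "n \<in> N" for m n using N.m_closed that by simp
  have Ninv: "\<ominus>\<^bsub>M\<^esub> n \<in> N" if "n \<in> N" for n using N.m_inv_closed that by (simp add: a_inv_def)
  have z: "\<zero>\<^bsub>A\<^esub> \<odot>\<^bsub>M\<^esub> x = \<zero>\<^bsub>M\<^esub>"
    using smult_l_distr[OF A.zero_closed A.zero_closed x] smult_closed[OF A.zero_closed x]
    by (metis A.l_zero A.zero_closed M.add.l_cancel_one')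
  have neg: "\<ominus>\<^bsub>M\<^esub> (a \<odot>\<^bsub>M\<^esub> x) = (\<ominus>\<^bsub>A\<^esub> a) \<odot>\<^bsub>M\<^esub> x" if a: "a \<in> carrier A" for a
    using smult_l_distr[of "\<ominus>\<^bsub>A\<^esub> a" a x] a x z
    by (simp add: A.l_neg M.minus_equality)
  let ?N = "{a \<odot>\<^bsub>M\<^esub> x \<oplus>\<^bsub>M\<^esub> n | a n. a \<in> carrier A \<and> n \<in> N}"
  let ?f = "\<lambda>l. hd l \<odot>\<^bsub>M\<^esub> x \<oplus>\<^bsub>M\<^esub> f (tl l)"
  have "submodule ?N A M"
  proof (intro submodule.intro submodule_axioms.intro M.add.subgroupI)
    show "?N \<subseteq> carrier M" using x Nc by auto
    show "?N \<noteq> {}" using N0 by auto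
    show "\<ominus>\<^bsub>M\<^esub> u \<in> ?N" if "u \<in> ?N" for u
    proof -
      from that obtain a n where u: "u = a \<odot>\<^bsub>M\<^esub> x \<oplus>\<^bsub>M\<^esub> n" "a \<in> carrier A" "n \<in> N" by auto
      then have "\<ominus>\<^bsub>M\<^esub> u = (\<ominus>\<^bsub>A\<^esub> a) \<odot>\<^bsub>M\<^esub> x \<oplus>\<^bsub>M\<^esub> \<ominus>\<^bsub>M\<^esub> n"
        using x Nc by (simp add: M.minus_add neg)
      then show ?thesis using u Ninv by auto
    qed
    show "u \<oplus>\<^bsub>M\<^esub> v \<in> ?N" if uv: "u \<in> ?N" "v \<in> ?N" for u v
    proof -
      from uv(1) obtain a n where u: "u = a \<odot>\<^bsub>M\<^esub> x \<oplus>\<^bsub>M\<^esub> n" "a \<in> carrier A" "n \<in> N" by auto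
      from uv(2) obtain b m where v: "v = b \<odot>\<^bsub>M\<^esub> x \<oplus>\<^bsub>M\<^esub> m" "b \<in> carrier A" "m \<in> N" by auto
      have "u \<oplus>\<^bsub>M\<^esub> v = (a \<oplus>\<^bsub>A\<^esub> b) \<odot>\<^bsub>M\<^esub> x \<oplus>\<^bsub>M\<^esub> (n \<oplus>\<^bsub>M\<^esub> m)"
        using u v x Nc by (simp add: smult_l_distr M.a_ac)
      then show ?thesis using u v Nadd by auto
    qed
    show "a \<odot>\<^bsub>M\<^esub> u \<in> ?N" if a: "a \<in> carrier A" and "u \<in> ?N" for a u
    proof -
      from that obtain b n where u: "u = b \<odot>\<^bsub>M\<^esub> x \<oplus>\<^bsub>M\<^esub> n" "b \<in> carrier A" "n \<in> N" by auto
      have "a \<odot>\<^bsub>M\<^esub> u = (a \<otimes>\<^bsub>A\<^esub> b) \<odot>\<^bsub>M\<^esub> x \<oplus>\<^bsub>M\<^esub> a \<odot>\<^bsub>M\<^esub> n"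
        using u a x Nc by (simp add: smult_r_distr smult_assoc)
      then show ?thesis using u a by auto
    qed
  qed
  moreover have "insert x S \<subseteq> ?N"
  proof -
    have "x = \<one>\<^bsub>A\<^esub> \<odot>\<^bsub>M\<^esub> x \<oplus>\<^bsub>M\<^esub> \<zero>\<^bsub>M\<^esub>" using x by simp
    then have "x \<in> ?N" using N0 A.one_closed by blast
    moreover have "s \<in> ?N" if "s \<in> S" for s
    proof -
      have "s = \<zero>\<^bsub>A\<^esub> \<odot>\<^bsub>M\<^esub> x \<oplus>\<^bsub>M\<^esub> s" using z Nc S that by auto
      then show ?thesis using S that A.zero_closed by blast
    qed
    ultimately show ?thesis by auto
  qed
  moreover have "?N \<subseteq> range ?f"
  proof
    fix u assume "u \<in> ?N"
    then obtain a n where u: "u = a \<odot>\<^bsub>M\<^esub> x \<oplus>\<^bsub>M\<^esub> n" "n \<in> N" by auto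
    then obtain l where "n = f l" using f by auto
    then have "u = ?f (a # l)" using u by simp
    then show "u \<in> range ?f" by (rule range_eqI)
  qed
  ultimately show ?case by blast
qed

lemma (in left_module) fg_left_module_iso_list_module:
  assumes "finitely_generated A M"
  shows "\<exists>(N :: 'a list_module) h.
    left_module A N \<and> h \<in> left_module_hom A M N \<and> bij_betw h (carrier M) (carrier N)"
proof -
  obtain f :: "'a list \<Rightarrow> 'm" where f: "carrier M \<subseteq> range f"
    using assms finite_subset_in_submodule_of_list_image
    unfolding finitely_generated_def by metis
  define g where "g = inv_into UNIV f"
  have fg [simp]: "f (g x) = x" if "x \<in> carrier M" for x
    using that f unfolding g_def by (auto intro: f_inv_into_f)
  define N :: "'a list_module" where
    "N = \<lparr> carrier = g ` carrier M, monoid.mult = (\<lambda>_ _. []), one = [], ring.zero = g \<zero>\<^bsub>M\<^esub>,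
           ring.add = (\<lambda>u v. g (f u \<oplus>\<^bsub>M\<^esub> f v)), smult = (\<lambda>a u. g (a \<odot>\<^bsub>M\<^esub> f u)) \<rparr>"
  have "abelian_group N"
  proof (rule abelian_groupI)
    show "\<exists>y \<in> carrier N. y \<oplus>\<^bsub>N\<^esub> u = \<zero>\<^bsub>N\<^esub>" if u: "u \<in> carrier N" for u
    proof -
      from u obtain x where x: "x \<in> carrier M" "u = g x" by (auto simp: N_def)
      then show ?thesis by (intro bexI[of _ "g (\<ominus>\<^bsub>M\<^esub> x)"]) (auto simp: N_def M.l_neg)
    qed
  qed (auto simp: N_def M.a_ac)
  then have "left_module A N"
    by (intro left_module.intro left_module_axioms.intro A.ring_axioms)
      (auto simp: N_def smult_l_distr smult_r_distr smult_assoc)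
  moreover have "g \<in> left_module_hom A M N"
    by (auto simp: left_module_hom_def N_def)
  moreover have "bij_betw g (carrier M) (carrier N)"
    unfolding bij_betw_def inj_on_def by (auto simp: N_def dest: arg_cong[where f = f])
  ultimately show ?thesis by blast
qed

definition in_mod :: "('a, 'b) ring_scheme \<Rightarrow> ('a, 'm, 'x) module_scheme \<Rightarrow> bool" where
  "in_mod A M \<longleftrightarrow> left_module A M \<and> finitely_generated A M"

definition projective_in_mod ::
  "('a, 'b) ring_scheme \<Rightarrow> ('a, 'm, 'x) module_scheme \<Rightarrow> bool" where
  "projective_in_mod A P \<longleftrightarrow> in_mod A P \<and>
    (\<forall>(U :: 'a list_module) (V :: 'a list_module) g f.
       in_mod A U \<and> in_mod A V \<and> g \<in> left_module_hom A U V \<and> g ` carrier U = carrier V \<and>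
       f \<in> left_module_hom A P V \<longrightarrow>
       (\<exists>h \<in> left_module_hom A P U. \<forall>p \<in> carrier P. g (h p) = f p))"

definition injective_in_mod ::
  "('a, 'b) ring_scheme \<Rightarrow> ('a, 'm, 'x) module_scheme \<Rightarrow> bool" where
  "injective_in_mod A I \<longleftrightarrow> in_mod A I \<and>
    (\<forall>(U :: 'a list_module) (V :: 'a list_module) g f.
       in_mod A U \<and> in_mod A V \<and> g \<in> left_module_hom A U V \<and> inj_on g (carrier U) \<and>
       f \<in> left_module_hom A U I \<longrightarrow>
       (\<exists>h \<in> left_module_hom A V I. \<forall>x \<in> carrier U. h (g x) = f x))"

definition nakayama_algebra :: "('a, 'b) ring_scheme \<Rightarrow> bool" where
  "nakayama_algebra A \<longleftrightarrow>
    (\<forall>M :: 'a list_module. indecomposable A M \<and> (projective_in_mod A M \<or> injective_in_mod A M)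
       \<longrightarrow> uniserial A M)"

definition representation_bound :: "('a, 'b) ring_scheme \<Rightarrow> enat" where
  "representation_bound A =
    (SUP M \<in> {M :: 'a list_module. left_module A M \<and> finite_length A M \<and> indecomposable A M}.
       enat (composition_length A M))"


section \<open>Jacobson radical and Loewy length\<close>

definition left_ideal :: "'a set \<Rightarrow> ('a, 'b) ring_scheme \<Rightarrow> bool" where
  "left_ideal I A \<longleftrightarrow>
    additive_subgroup I A \<and> (\<forall>a \<in> carrier A. \<forall>x \<in> I. a \<otimes>\<^bsub>A\<^esub> x \<in> I)"

definition maximal_left_ideal :: "'a set \<Rightarrow> ('a, 'b) ring_scheme \<Rightarrow> bool" where
  "maximal_left_ideal I A \<longleftrightarrow> left_ideal I A \<and> I \<noteq> carrier A \<and>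
    (\<forall>K. left_ideal K A \<and> I \<subseteq> K \<longrightarrow> K = I \<or> K = carrier A)"

definition jacobson_radical :: "('a, 'b) ring_scheme \<Rightarrow> 'a set" where
  "jacobson_radical A = {x \<in> carrier A. \<forall>I. maximal_left_ideal I A \<longrightarrow> x \<in> I}"

primrec ideal_power :: "('a, 'b) ring_scheme \<Rightarrow> 'a set \<Rightarrow> nat \<Rightarrow> 'a set" where
  "ideal_power A I 0 = carrier A"
| "ideal_power A I (Suc n) = I \<cdot>\<^bsub>A\<^esub> ideal_power A I n"

text \<open>Only meaningful if the Jacobson radical is nilpotent, as it is for an artin algebra.\<close>

definition loewy_length :: "('a, 'b) ring_scheme \<Rightarrow> nat" where
  "loewy_length A = (LEAST n. ideal_power A (jacobson_radical A) n = {\<zero>\<^bsub>A\<^esub>})"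


section \<open>Artin algebras\<close>

locale artinian_cring = cring R for R (structure) +
  assumes descending_chain_condition:
    "\<lbrakk> \<And>n. ideal (I n) R; \<And>n :: nat. I (Suc n) \<subseteq> I n \<rbrakk> \<Longrightarrow> \<exists>m. \<forall>n \<ge> m. I n = I m"

text \<open>The library locale \<^locale>\<open>algebra\<close> requires the algebra itself to be commutative.\<close>

locale artin_algebra =
  R?: artinian_cring R + module R A + A?: ring A
  for R :: "('r, 'b) ring_scheme" (structure) and A :: "('r, 'a, 'x) module_scheme" (structure) +
  assumes smult_mult_left:
      "\<lbrakk> r \<in> carrier R; x \<in> carrier A; y \<in> carrier A \<rbrakk> \<Longrightarrow>
        (r \<odot>\<^bsub>A\<^esub> x) \<otimes>\<^bsub>A\<^esub> y = r \<odot>\<^bsub>A\<^esub> (x \<otimes>\<^bsub>A\<^esub> y)"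
    and smult_mult_right:
      "\<lbrakk> r \<in> carrier R; x \<in> carrier A; y \<in> carrier A \<rbrakk> \<Longrightarrow>
        x \<otimes>\<^bsub>A\<^esub> (r \<odot>\<^bsub>A\<^esub> y) = r \<odot>\<^bsub>A\<^esub> (x \<otimes>\<^bsub>A\<^esub> y)"
    and finitely_generated_over_scalars: "finitely_generated R A"

end

theory Submission
  imports Defs
begin

text \<open>Let \<open>J\<close> be the Jacobson radical of the artin algebra \<open>A\<close> over \<open>R\<close>.

  Suppose that \<open>A\<close> has representation bound two.  An indecomposable module of length two has only
  one submodule besides zero and itself, because two of them would be simple and complementary; so
  the indecomposable modules of finite length are uniserial.  Every finitely generated module has
  finite length (\<open>fg_finite_height\<close>), so this covers the indecomposable projective and injective
  modules.  Since \<open>J\<close> maps each member of a composition series into the preceding one, a product of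
  two elements of \<open>J\<close> annihilates all indecomposable modules, and an element with this property is
  zero (\<open>eq_zero_if_annihilates_indecomposables\<close>).  Finally \<open>J \<noteq> 0\<close>, because over a semisimple
  algebra the indecomposable modules are simple.

  Conversely let \<open>A\<close> be a Nakayama algebra with \<open>J\<^sup>2 = 0\<close>, and let \<open>M\<close> be indecomposable.  If
  \<open>J M = 0\<close>, then \<open>M\<close> is simple.  Otherwise \<open>J P x \<noteq> 0\<close> for some \<open>x \<in> M\<close> and some indecomposable
  direct summand \<open>P\<close> of \<open>A\<close>.  As \<open>P\<close> is projective, it is uniserial, and so is the submodule
  \<open>L = P x\<close> of \<open>M\<close>.  The point is that \<open>L\<close> is injective; then it is a direct summand of \<open>M\<close>, so
  that \<open>M = L\<close>, and the only submodule of \<open>L\<close> besides zero and \<open>L\<close> is the part annihilated by \<open>J\<close>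
  (\<open>uniserial_length_at_most_two\<close>).  To see that \<open>L\<close> is injective, take an essential extension \<open>I\<close>
  of \<open>L\<close> that is as long as possible.  A pushout shows that \<open>I\<close> is injective
  (\<open>largest_essential_extension_injective\<close>), it is indecomposable since \<open>L\<close> is uniserial, and hence
  it is uniserial.  But a submodule of a uniserial module annihilated by \<open>J\<^sup>2\<close> is the whole module
  as soon as it is not annihilated by \<open>J\<close> (\<open>uniserial_submodule_full\<close>); so \<open>I = L\<close>.

  That the lengths of the essential extensions of \<open>L\<close> are bounded depends on the base ring \<open>R\<close>:
  over artinian rings in general, injective envelopes need not be finitely generated.  Let \<open>g\<^sub>1, \<dots>, g\<^sub>k\<close> generate \<open>J\<close>.  Multiplication by \<open>g\<^sub>i\<close> maps an essential extension
  \<open>I\<close> into the part annihilated by \<open>J\<close>, which lies in \<open>L\<close>, and the common kernel of these maps also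
  lies in \<open>L\<close>.  The maps are \<open>R\<close>-linear, so the length of \<open>I\<close> over \<open>R\<close> is at most \<open>k + 1\<close> times
  the length of \<open>L\<close> over \<open>R\<close> (\<open>essential_extensions_bounded\<close>).

  Finiteness of length is handled through bounded rank functions that are strictly monotone on
  submodules: they can be added along submodules and quotients, and the existence of one provides
  maximal and minimal members in every family of submodules.\<close>

section \<open>Families of sets of bounded height\<close>

text \<open>For the family of all submodules of a module this says that the module has length at most \<open>n\<close>:
  the rank of a submodule may be its length, and a rank function bounds the length of chains.\<close>

definition bounded_height :: "'s set set \<Rightarrow> nat \<Rightarrow> bool" where
  "bounded_height F n \<longleftrightarrow>
    (\<exists>\<rho>. (\<forall>N \<in> F. \<rho> N \<le> n) \<and> (\<forall>N \<in> F. \<forall>K \<in> F. N \<subset> K \<longrightarrow> \<rho> N < \<rho> K))"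

lemma bounded_height_mono:
  assumes "bounded_height F n" "G \<subseteq> F" "n \<le> m"
  shows "bounded_height G m"
proof -
  obtain \<rho> where "\<forall>N \<in> F. \<rho> N \<le> n" "\<forall>N \<in> F. \<forall>K \<in> F. N \<subset> K \<longrightarrow> \<rho> N < \<rho> K"
    using assms(1) unfolding bounded_height_def by blast
  then show ?thesis
    using assms(2,3) unfolding bounded_height_def by (intro exI[of _ \<rho>]) (meson order_trans subsetD)
qed

text \<open>The model is a submodule \<open>Y\<close> of a module, with \<open>\<sigma> N = N \<inter> Y\<close> and \<open>\<tau> N\<close> the image of \<open>N\<close> in the
  quotient by \<open>Y\<close>.  Letting \<open>\<tau>\<close> take values in any family of sets saves the construction of that
  quotient.\<close>

lemma bounded_height_combine:
  assumes "bounded_height F a" "bounded_height G b"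
    and "\<And>N. N \<in> H \<Longrightarrow> \<sigma> N \<in> F" "\<And>N. N \<in> H \<Longrightarrow> \<tau> N \<in> G"
    and "\<And>N K. N \<in> H \<Longrightarrow> K \<in> H \<Longrightarrow> N \<subseteq> K \<Longrightarrow> \<sigma> N \<subseteq> \<sigma> K"
    and "\<And>N K. N \<in> H \<Longrightarrow> K \<in> H \<Longrightarrow> N \<subseteq> K \<Longrightarrow> \<tau> N \<subseteq> \<tau> K"
    and "\<And>N K. N \<in> H \<Longrightarrow> K \<in> H \<Longrightarrow> N \<subseteq> K \<Longrightarrow> \<sigma> N = \<sigma> K \<Longrightarrow> \<tau> N = \<tau> K \<Longrightarrow> N = K"
  shows "bounded_height H (a + b)"
proof -
  obtain f where f: "\<forall>N \<in> F. f N \<le> a" "\<forall>N \<in> F. \<forall>K \<in> F. N \<subset> K \<longrightarrow> f N < f K"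
    using assms(1) unfolding bounded_height_def by blast
  obtain g where g: "\<forall>N \<in> G. g N \<le> b" "\<forall>N \<in> G. \<forall>K \<in> G. N \<subset> K \<longrightarrow> g N < g K"
    using assms(2) unfolding bounded_height_def by blast
  have "f (\<sigma> N) + g (\<tau> N) < f (\<sigma> K) + g (\<tau> K)" if NK: "N \<in> H" "K \<in> H" "N \<subset> K" for N K
  proof -
    have le: "\<sigma> N \<subseteq> \<sigma> K" "\<tau> N \<subseteq> \<tau> K" using assms(5,6) NK by auto
    have "f (\<sigma> N) \<le> f (\<sigma> K)"
      using f(2)[rule_format, of "\<sigma> N" "\<sigma> K"] le(1) assms(3) NK(1,2)
      by (cases "\<sigma> N = \<sigma> K") (simp_all add: psubset_eq less_imp_le)
    moreover have "g (\<tau> N) \<le> g (\<tau> K)"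
      using g(2)[rule_format, of "\<tau> N" "\<tau> K"] le(2) assms(4) NK(1,2)
      by (cases "\<tau> N = \<tau> K") (simp_all add: psubset_eq less_imp_le)
    moreover have "\<sigma> N \<subset> \<sigma> K \<or> \<tau> N \<subset> \<tau> K" using assms(7) NK le by blast
    then have "f (\<sigma> N) < f (\<sigma> K) \<or> g (\<tau> N) < g (\<tau> K)"
      using f(2)[rule_format, OF assms(3)[OF NK(1)] assms(3)[OF NK(2)]]
        g(2)[rule_format, OF assms(4)[OF NK(1)] assms(4)[OF NK(2)]] by blast
    ultimately show ?thesis by auto
  qed
  then show ?thesis
    unfolding bounded_height_def using f(1) g(1) assms(3,4)
    by (intro exI[of _ "\<lambda>N. f (\<sigma> N) + g (\<tau> N)"]) (auto intro: add_mono)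
qed

lemma bounded_height_strict_map:
  assumes "bounded_height F a" "\<And>N. N \<in> H \<Longrightarrow> \<sigma> N \<in> F"
    and "\<And>N K. N \<in> H \<Longrightarrow> K \<in> H \<Longrightarrow> N \<subset> K \<Longrightarrow> \<sigma> N \<subset> \<sigma> K"
  shows "bounded_height H a"
proof -
  obtain f where f: "\<forall>N \<in> F. f N \<le> a" "\<forall>N \<in> F. \<forall>K \<in> F. N \<subset> K \<longrightarrow> f N < f K"
    using assms(1) unfolding bounded_height_def by blast
  show ?thesis unfolding bounded_height_def using assms(2,3) f
    by (intro exI[of _ "\<lambda>N. f (\<sigma> N)"]) simp
qed

lemma bounded_height_maximal:
  assumes "bounded_height F n" "N \<in> F"
  obtains M where "M \<in> F" "N \<subseteq> M" "\<And>K. K \<in> F \<Longrightarrow> M \<subseteq> K \<Longrightarrow> K = M"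
proof -
  obtain f where f: "\<forall>N \<in> F. f N \<le> n" "\<forall>N \<in> F. \<forall>K \<in> F. N \<subset> K \<longrightarrow> f N < f K"
    using assms(1) unfolding bounded_height_def by blast
  have "\<exists>M. (M \<in> F \<and> N \<subseteq> M) \<and> (\<forall>K. K \<in> F \<and> N \<subseteq> K \<longrightarrow> f K \<le> f M)"
    (* the bound in ex_has_greatest_nat is strict *)
    using assms(2) f(1) by (intro ex_has_greatest_nat[where b = "Suc n" and k = N]) (auto simp: less_Suc_eq_le)
  then obtain M where M: "M \<in> F" "N \<subseteq> M" "\<And>K. K \<in> F \<Longrightarrow> N \<subseteq> K \<Longrightarrow> f K \<le> f M" by auto
  show ?thesis
  proof (rule that[OF M(1,2)])
    fix K assume "K \<in> F" "M \<subseteq> K"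
    then show "K = M" using f(2) M by (metis leD order_trans psubsetI)
  qed
qed

lemma bounded_height_minimal:
  assumes "bounded_height F n" "N \<in> F"
  obtains M where "M \<in> F" "M \<subseteq> N" "\<And>K. K \<in> F \<Longrightarrow> K \<subseteq> M \<Longrightarrow> K = M"
proof -
  obtain f where f: "\<forall>N \<in> F. \<forall>K \<in> F. N \<subset> K \<longrightarrow> f N < (f K :: nat)"
    using assms(1) unfolding bounded_height_def by blast
  have "\<exists>M. (M \<in> F \<and> M \<subseteq> N) \<and> (\<forall>K. K \<in> F \<and> K \<subseteq> N \<longrightarrow> f M \<le> f K)"
    using assms(2) by (intro ex_has_least_nat[where k = N]) auto
  then obtain M where M: "M \<in> F" "M \<subseteq> N" "\<And>K. K \<in> F \<Longrightarrow> K \<subseteq> N \<Longrightarrow> f M \<le> f K" by auto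
  show ?thesis
  proof (rule that[OF M(1,2)])
    fix K assume "K \<in> F" "K \<subseteq> M"
    then show "K = M" using f M by (metis leD order_trans psubsetI)
  qed
qed

section \<open>Submodules\<close>

context left_module
begin

lemma smult_l_null [simp]: "x \<in> carrier M \<Longrightarrow> \<zero>\<^bsub>A\<^esub> \<odot>\<^bsub>M\<^esub> x = \<zero>\<^bsub>M\<^esub>"
  using smult_l_distr[OF A.zero_closed A.zero_closed] smult_closed[OF A.zero_closed]
  by (metis A.l_zero A.zero_closed M.add.l_cancel_one')

lemma smult_r_null [simp]: "a \<in> carrier A \<Longrightarrow> a \<odot>\<^bsub>M\<^esub> \<zero>\<^bsub>M\<^esub> = \<zero>\<^bsub>M\<^esub>"
  using smult_r_distr[OF _ M.zero_closed M.zero_closed] smult_closed[OF _ M.zero_closed]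
  by (metis M.add.l_cancel_one' M.l_zero M.zero_closed)

lemma smult_l_minus:
  "a \<in> carrier A \<Longrightarrow> x \<in> carrier M \<Longrightarrow> (\<ominus>\<^bsub>A\<^esub> a) \<odot>\<^bsub>M\<^esub> x = \<ominus>\<^bsub>M\<^esub> (a \<odot>\<^bsub>M\<^esub> x)"
  using smult_l_distr[of "\<ominus>\<^bsub>A\<^esub> a" a x] by (simp add: A.l_neg M.minus_equality)

lemma smult_r_minus:
  "a \<in> carrier A \<Longrightarrow> x \<in> carrier M \<Longrightarrow> a \<odot>\<^bsub>M\<^esub> (\<ominus>\<^bsub>M\<^esub> x) = \<ominus>\<^bsub>M\<^esub> (a \<odot>\<^bsub>M\<^esub> x)"
  using smult_r_distr[of a "\<ominus>\<^bsub>M\<^esub> x" x] by (simp add: M.l_neg M.minus_equality)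

lemma smult_minus_one: "x \<in> carrier M \<Longrightarrow> (\<ominus>\<^bsub>A\<^esub> \<one>\<^bsub>A\<^esub>) \<odot>\<^bsub>M\<^esub> x = \<ominus>\<^bsub>M\<^esub> x"
  by (simp add: smult_l_minus)

lemma submoduleI:
  assumes "N \<subseteq> carrier M" "\<zero>\<^bsub>M\<^esub> \<in> N"
    and "\<And>x y. x \<in> N \<Longrightarrow> y \<in> N \<Longrightarrow> x \<oplus>\<^bsub>M\<^esub> y \<in> N"
    and "\<And>a x. a \<in> carrier A \<Longrightarrow> x \<in> N \<Longrightarrow> a \<odot>\<^bsub>M\<^esub> x \<in> N"
  shows "submodule N A M"
proof (intro submodule.intro submodule_axioms.intro M.add.subgroupI)
  show "\<ominus>\<^bsub>M\<^esub> x \<in> N" if "x \<in> N" for x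
    using assms(1) assms(4)[of "\<ominus>\<^bsub>A\<^esub> \<one>\<^bsub>A\<^esub>" x] that by (auto simp: smult_minus_one subset_iff)
qed (use assms in auto)

lemma submoduleD:
  assumes "submodule N A M"
  shows submodule_subset: "N \<subseteq> carrier M"
    and submodule_carrier: "x \<in> N \<Longrightarrow> x \<in> carrier M"
    and submodule_zero: "\<zero>\<^bsub>M\<^esub> \<in> N"
    and submodule_add: "x \<in> N \<Longrightarrow> y \<in> N \<Longrightarrow> x \<oplus>\<^bsub>M\<^esub> y \<in> N"
    and submodule_smult: "a \<in> carrier A \<Longrightarrow> x \<in> N \<Longrightarrow> a \<odot>\<^bsub>M\<^esub> x \<in> N"
    and submodule_minus: "x \<in> N \<Longrightarrow> \<ominus>\<^bsub>M\<^esub> x \<in> N"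
    and submodule_diff: "x \<in> N \<Longrightarrow> y \<in> N \<Longrightarrow> x \<ominus>\<^bsub>M\<^esub> y \<in> N"
proof -
  interpret N: submodule N A M by fact
  show "N \<subseteq> carrier M" using N.subset by simp
  then show c: "x \<in> N \<Longrightarrow> x \<in> carrier M" by auto
  show "\<zero>\<^bsub>M\<^esub> \<in> N" using N.one_closed by simp
  show add: "x \<in> N \<Longrightarrow> y \<in> N \<Longrightarrow> x \<oplus>\<^bsub>M\<^esub> y \<in> N" for x y using N.m_closed by simp
  show "a \<in> carrier A \<Longrightarrow> x \<in> N \<Longrightarrow> a \<odot>\<^bsub>M\<^esub> x \<in> N" by (rule N.smult_closed)
  show minus: "x \<in> N \<Longrightarrow> \<ominus>\<^bsub>M\<^esub> x \<in> N" for x using N.m_inv_closed by (simp add: a_inv_def)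
  show "x \<in> N \<Longrightarrow> y \<in> N \<Longrightarrow> x \<ominus>\<^bsub>M\<^esub> y \<in> N"
    unfolding a_minus_def by (intro add minus)
qed

lemma diff_eq_zero_iff:
  assumes "x \<in> carrier M" "y \<in> carrier M"
  shows "x \<ominus>\<^bsub>M\<^esub> y = \<zero>\<^bsub>M\<^esub> \<longleftrightarrow> x = y"
  using assms M.minus_equality[of x "\<ominus>\<^bsub>M\<^esub> y"] by (auto simp: a_minus_def M.r_neg)

lemma submodule_add_cancel:
  assumes "submodule N A M" "x \<oplus>\<^bsub>M\<^esub> y \<in> N" "y \<in> N" "x \<in> carrier M"
  shows "x \<in> N"
proof -
  have "x = (x \<oplus>\<^bsub>M\<^esub> y) \<ominus>\<^bsub>M\<^esub> y"
    using assms submodule_carrier[OF assms(1)] by (simp add: a_minus_def M.a_assoc M.r_neg)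
  then show ?thesis using submodule_diff[OF assms(1,2,3)] by simp
qed

lemma submodule_add_cancel':
  assumes "submodule N A M" "x \<oplus>\<^bsub>M\<^esub> y \<in> N" "x \<in> N" "y \<in> carrier M"
  shows "y \<in> N"
  using submodule_add_cancel[of N y x] assms submodule_carrier[OF assms(1)] by (simp add: M.a_comm)

lemma submodule_full: "submodule (carrier M) A M"
  by (rule submoduleI) auto

lemma submodule_trivial: "submodule {\<zero>\<^bsub>M\<^esub>} A M"
  by (rule submoduleI) auto

lemma bounded_height_trivial: "bounded_height {N. submodule N A M \<and> N \<subseteq> {\<zero>\<^bsub>M\<^esub>}} 0"
proof -
  have "N = {\<zero>\<^bsub>M\<^esub>}" if "submodule N A M" "N \<subseteq> {\<zero>\<^bsub>M\<^esub>}" for N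
    using that submodule_zero[OF that(1)] by blast
  then show ?thesis unfolding bounded_height_def by (intro exI[of _ "\<lambda>_. 0"]) blast
qed

lemma submodule_Int:
  "submodule N A M \<Longrightarrow> submodule K A M \<Longrightarrow> submodule (N \<inter> K) A M"
  by (rule submoduleI) (auto dest: submodule_carrier submodule_zero submodule_add submodule_smult)

lemma mem_set_add: "z \<in> N <+>\<^bsub>M\<^esub> K \<longleftrightarrow> (\<exists>x \<in> N. \<exists>y \<in> K. z = x \<oplus>\<^bsub>M\<^esub> y)"
  by (auto simp: set_add_def')

lemma set_add_mono: "N \<subseteq> K \<Longrightarrow> N <+>\<^bsub>M\<^esub> Y \<subseteq> K <+>\<^bsub>M\<^esub> Y"
  unfolding mem_set_add subset_iff by blast

lemma submodule_set_add:
  assumes N: "submodule N A M" and K: "submodule K A M"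
  shows "submodule (N <+>\<^bsub>M\<^esub> K) A M"
proof (rule submoduleI)
  note c = submodule_carrier[OF N] submodule_carrier[OF K]
  show "N <+>\<^bsub>M\<^esub> K \<subseteq> carrier M" using c by (auto simp: mem_set_add)
  show "\<zero>\<^bsub>M\<^esub> \<in> N <+>\<^bsub>M\<^esub> K"
    unfolding mem_set_add using submodule_zero[OF N] submodule_zero[OF K]
    by (intro bexI[of _ "\<zero>\<^bsub>M\<^esub>"]) auto
  show "x \<oplus>\<^bsub>M\<^esub> y \<in> N <+>\<^bsub>M\<^esub> K" if "x \<in> N <+>\<^bsub>M\<^esub> K" "y \<in> N <+>\<^bsub>M\<^esub> K" for x y
  proof -
    from that obtain n k n' k' where *: "x = n \<oplus>\<^bsub>M\<^esub> k" "y = n' \<oplus>\<^bsub>M\<^esub> k'" "n \<in> N" "n' \<in> N" "k \<in> K" "k' \<in> K"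
      by (auto simp: mem_set_add)
    then have "x \<oplus>\<^bsub>M\<^esub> y = (n \<oplus>\<^bsub>M\<^esub> n') \<oplus>\<^bsub>M\<^esub> (k \<oplus>\<^bsub>M\<^esub> k')" using c by (simp add: M.a_ac)
    then show ?thesis unfolding mem_set_add using * submodule_add[OF N] submodule_add[OF K] by blast
  qed
  show "a \<odot>\<^bsub>M\<^esub> x \<in> N <+>\<^bsub>M\<^esub> K" if a: "a \<in> carrier A" and "x \<in> N <+>\<^bsub>M\<^esub> K" for a x
  proof -
    from that obtain n k where *: "x = n \<oplus>\<^bsub>M\<^esub> k" "n \<in> N" "k \<in> K" by (auto simp: mem_set_add)
    then have "a \<odot>\<^bsub>M\<^esub> x = a \<odot>\<^bsub>M\<^esub> n \<oplus>\<^bsub>M\<^esub> a \<odot>\<^bsub>M\<^esub> k" using a c by (simp add: smult_r_distr)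
    then show ?thesis unfolding mem_set_add
      using * submodule_smult[OF N a] submodule_smult[OF K a] by blast
  qed
qed

lemma subset_set_add:
  assumes N: "submodule N A M" and K: "submodule K A M"
  shows "N \<subseteq> N <+>\<^bsub>M\<^esub> K" "K \<subseteq> N <+>\<^bsub>M\<^esub> K"
proof -
  note c = submodule_carrier[OF N] submodule_carrier[OF K]
  show "N \<subseteq> N <+>\<^bsub>M\<^esub> K"
    using submodule_zero[OF K] c by (force simp: mem_set_add)
  show "K \<subseteq> N <+>\<^bsub>M\<^esub> K"
    using submodule_zero[OF N] c by (force simp: mem_set_add)
qed

lemma set_add_least:
  assumes "submodule Y A M" "N \<subseteq> Y" "K \<subseteq> Y"
  shows "N <+>\<^bsub>M\<^esub> K \<subseteq> Y"
  using submodule_add[OF assms(1)] assms(2,3) by (auto simp: mem_set_add subset_iff)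

lemma left_module_submodule:
  assumes N: "submodule N A M"
  shows "left_module A (M\<lparr>carrier := N\<rparr>)"
proof -
  note c = submodule_carrier[OF N]
  have "abelian_group (M\<lparr>carrier := N\<rparr>)"
  proof (rule abelian_groupI)
    show "\<exists>y \<in> carrier (M\<lparr>carrier := N\<rparr>). y \<oplus>\<^bsub>M\<lparr>carrier := N\<rparr>\<^esub> x = \<zero>\<^bsub>M\<lparr>carrier := N\<rparr>\<^esub>"
      if "x \<in> carrier (M\<lparr>carrier := N\<rparr>)" for x
      using that c submodule_minus[OF N]
      by (intro bexI[of _ "\<ominus>\<^bsub>M\<^esub> x"]) (auto simp: M.l_neg)
  qed (use c submodule_add[OF N] submodule_zero[OF N] in \<open>auto simp: M.a_ac\<close>)
  then show ?thesis
    by (intro left_module.intro left_module_axioms.intro A.ring_axioms)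
      (use c submodule_smult[OF N] in \<open>auto simp: smult_l_distr smult_r_distr smult_assoc\<close>)
qed

lemma submodule_submodule_iff:
  assumes N: "submodule N A M"
  shows "submodule K A (M\<lparr>carrier := N\<rparr>) \<longleftrightarrow> submodule K A M \<and> K \<subseteq> N"
proof -
  interpret N: left_module A "M\<lparr>carrier := N\<rparr>" by (rule left_module_submodule[OF N])
  show ?thesis
  proof
    assume K: "submodule K A (M\<lparr>carrier := N\<rparr>)"
    show "submodule K A M \<and> K \<subseteq> N"
      using N.submodule_subset[OF K] N.submodule_zero[OF K] N.submodule_add[OF K]
        N.submodule_smult[OF K] submodule_carrier[OF N]
      by (intro conjI submoduleI) auto
  next
    assume K: "submodule K A M \<and> K \<subseteq> N"
    then show "submodule K A (M\<lparr>carrier := N\<rparr>)"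
      using submodule_zero[of K] submodule_add[of K] submodule_smult[of K]
      by (intro N.submoduleI) auto
  qed
qed

end

text \<open>The left ideals of \<open>A\<close> are the submodules of this module, so the lemmas on submodules apply to
  them.\<close>

definition regular_module :: "('a, 'b) ring_scheme \<Rightarrow> ('a, 'a) module" where
  "regular_module A = \<lparr>carrier = carrier A, monoid.mult = monoid.mult A, one = \<one>\<^bsub>A\<^esub>,
     ring.zero = \<zero>\<^bsub>A\<^esub>, ring.add = ring.add A, smult = monoid.mult A\<rparr>"

lemma regular_module_simps [simp]:
  "carrier (regular_module A) = carrier A" "\<zero>\<^bsub>regular_module A\<^esub> = \<zero>\<^bsub>A\<^esub>"
  "x \<oplus>\<^bsub>regular_module A\<^esub> y = x \<oplus>\<^bsub>A\<^esub> y" "x \<odot>\<^bsub>regular_module A\<^esub> y = x \<otimes>\<^bsub>A\<^esub> y"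
  by (simp_all add: regular_module_def)

lemma (in ring) left_module_regular: "left_module R (regular_module R)"
proof -
  have "abelian_group (regular_module R)"
    by (rule abelian_groupI) (auto simp: a_ac intro!: bexI[of _ "\<ominus> _"] l_neg)
  then show ?thesis
    by (intro left_module.intro left_module_axioms.intro ring_axioms)
      (auto simp: l_distr r_distr m_assoc)
qed

lemma (in ring) left_ideal_iff_submodule: "left_ideal I R \<longleftrightarrow> submodule I R (regular_module R)"
  by (auto simp: left_ideal_def submodule_def submodule_axioms_def additive_subgroup_def
      subgroup_def m_inv_def)

section \<open>Finite height of finitely generated modules\<close>

lemma (in ring) left_idealI:
  assumes "I \<subseteq> carrier R" "\<zero> \<in> I" "\<And>x y. x \<in> I \<Longrightarrow> y \<in> I \<Longrightarrow> x \<oplus> y \<in> I"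
    and "\<And>a x. a \<in> carrier R \<Longrightarrow> x \<in> I \<Longrightarrow> a \<otimes> x \<in> I"
  shows "left_ideal I R"
  unfolding left_ideal_iff_submodule
  by (rule left_module.submoduleI[OF left_module_regular]) (use assms in auto)

lemma (in ring) left_idealD:
  assumes "left_ideal I R"
  shows left_ideal_carrier: "x \<in> I \<Longrightarrow> x \<in> carrier R"
    and left_ideal_zero: "\<zero> \<in> I"
    and left_ideal_add: "x \<in> I \<Longrightarrow> y \<in> I \<Longrightarrow> x \<oplus> y \<in> I"
    and left_ideal_mult: "a \<in> carrier R \<Longrightarrow> x \<in> I \<Longrightarrow> a \<otimes> x \<in> I"
  using left_module.submoduleD[OF left_module_regular assms[unfolded left_ideal_iff_submodule]]
  by auto

lemma (in cring) submodule_regular_ideal: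
  assumes "submodule I R (regular_module R)"
  shows "ideal I R"
proof -
  note I = left_ideal_iff_submodule[THEN iffD2, OF assms]
  show ?thesis
  proof (rule idealI[OF ring_axioms])
    show "subgroup I (add_monoid R)"
      using I by (simp add: left_ideal_def additive_subgroup_def)
    show l: "x \<otimes> a \<in> I" if "a \<in> I" "x \<in> carrier R" for a x
      using left_ideal_mult[OF I that(2,1)] .
    show "a \<otimes> x \<in> I" if "a \<in> I" "x \<in> carrier R" for a x
      using l[OF that] that(2) left_ideal_carrier[OF I that(1)] by (simp add: m_comm)
  qed
qed

definition finite_height ::
  "('a, 'b) ring_scheme \<Rightarrow> ('a, 'm, 'x) module_scheme \<Rightarrow> bool" where
  "finite_height A M \<longleftrightarrow> (\<exists>n. bounded_height {N. submodule N A M} n)"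

lemma (in left_module) submodule_orbit:
  assumes I: "left_ideal I A" and x: "x \<in> carrier M"
  shows "submodule ((\<lambda>a. a \<odot>\<^bsub>M\<^esub> x) ` I) A M"
proof (rule submoduleI)
  note c = A.left_ideal_carrier[OF I]
  show "(\<lambda>a. a \<odot>\<^bsub>M\<^esub> x) ` I \<subseteq> carrier M" using c x by auto
  show "\<zero>\<^bsub>M\<^esub> \<in> (\<lambda>a. a \<odot>\<^bsub>M\<^esub> x) ` I"
    using A.left_ideal_zero[OF I] x by (intro image_eqI[of _ _ "\<zero>\<^bsub>A\<^esub>"]) auto
  fix u assume "u \<in> (\<lambda>a. a \<odot>\<^bsub>M\<^esub> x) ` I"
  then obtain a where u: "a \<in> I" "u = a \<odot>\<^bsub>M\<^esub> x" by auto
  show "b \<odot>\<^bsub>M\<^esub> u \<in> (\<lambda>a. a \<odot>\<^bsub>M\<^esub> x) ` I" if "b \<in> carrier A" for b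
    using that u c x A.left_ideal_mult[OF I that]
    by (intro image_eqI[of _ _ "b \<otimes>\<^bsub>A\<^esub> a"]) (auto simp: smult_assoc)
  show "u \<oplus>\<^bsub>M\<^esub> v \<in> (\<lambda>a. a \<odot>\<^bsub>M\<^esub> x) ` I" if "v \<in> (\<lambda>a. a \<odot>\<^bsub>M\<^esub> x) ` I" for v
  proof -
    from that obtain b where v: "b \<in> I" "v = b \<odot>\<^bsub>M\<^esub> x" by auto
    then have "u \<oplus>\<^bsub>M\<^esub> v = (a \<oplus>\<^bsub>A\<^esub> b) \<odot>\<^bsub>M\<^esub> x" using u c x by (simp add: smult_l_distr)
    then show ?thesis using A.left_ideal_add[OF I u(1) v(1)] by auto
  qed
qed

lemma (in left_module) left_ideal_conductor:
  assumes N: "submodule N A M" and x: "x \<in> carrier M"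
  shows "left_ideal {a \<in> carrier A. a \<odot>\<^bsub>M\<^esub> x \<in> N} A"
  by (rule A.left_idealI)
    (use submodule_zero[OF N] submodule_add[OF N] submodule_smult[OF N] x in
      \<open>auto simp: smult_l_distr smult_assoc\<close>)

lemma (in ring) left_ideal_full: "left_ideal (carrier R) R"
  by (rule left_idealI) auto

lemma (in left_module) submodule_cyclic:
  assumes "x \<in> carrier M"
  shows "submodule ((\<lambda>a. a \<odot>\<^bsub>M\<^esub> x) ` carrier A) A M" "x \<in> (\<lambda>a. a \<odot>\<^bsub>M\<^esub> x) ` carrier A"
  using submodule_orbit[OF A.left_ideal_full assms] assms
  by (auto intro!: image_eqI[of _ _ "\<one>\<^bsub>A\<^esub>"])

text \<open>Together with \<open>bounded_height_combine\<close> this form of the modular law makes the heights below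
  and above \<open>Y\<close> add up.\<close>

lemma (in left_module) modular_cancel:
  assumes N: "submodule N A M" and K: "submodule K A M" and Y: "submodule Y A M"
    and le: "N \<subseteq> K" and "N \<inter> Y = K \<inter> Y" "N <+>\<^bsub>M\<^esub> Y = K <+>\<^bsub>M\<^esub> Y"
  shows "N = K"
proof
  show "K \<subseteq> N"
  proof
    fix k assume k: "k \<in> K"
    then have "k \<in> N <+>\<^bsub>M\<^esub> Y" using assms(6) subset_set_add(1)[OF K Y] by auto
    then obtain n y where *: "n \<in> N" "y \<in> Y" "k = n \<oplus>\<^bsub>M\<^esub> y" by (auto simp: mem_set_add)
    then have "y \<in> K"
      using submodule_add_cancel'[OF K, of n y] k le submodule_carrier[OF Y] by auto
    then have "y \<in> N" using * assms(5) by auto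
    then show "k \<in> N" using * submodule_add[OF N] by simp
  qed
qed (rule le)

text \<open>Adding one generator \<open>x\<close> to a submodule \<open>Y\<close> adds a cyclic factor, whose submodules
  correspond to left ideals: \<open>N\<close> is sent to the left ideal of all \<open>a\<close> with \<open>a x \<in> N + Y\<close>.\<close>

lemma (in left_module) fg_imp_finite_height:
  assumes "finite_height A (regular_module A)" "finitely_generated A M"
  shows "finite_height A M"
proof -
  obtain l where l: "bounded_height {I. left_ideal I A} l"
    using assms(1) unfolding finite_height_def A.left_ideal_iff_submodule by auto
  have "\<exists>Y n. submodule Y A M \<and> S \<subseteq> Y \<and> bounded_height {N. submodule N A M \<and> N \<subseteq> Y} n"
    if "finite S" "S \<subseteq> carrier M" for S
    using that
  proof (induction S)
    case empty
    show ?case using submodule_trivial bounded_height_trivial by blast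
  next
    case (insert x S)
    then obtain Y n where Y: "submodule Y A M" "S \<subseteq> Y"
      and n: "bounded_height {N. submodule N A M \<and> N \<subseteq> Y} n" by auto
    have x: "x \<in> carrier M" using insert by auto
    let ?C = "(\<lambda>a. a \<odot>\<^bsub>M\<^esub> x) ` carrier A"
    note C = submodule_cyclic[OF x]
    let ?H = "{N. submodule N A M \<and> N \<subseteq> ?C <+>\<^bsub>M\<^esub> Y}"
    let ?\<tau> = "\<lambda>N. {a \<in> carrier A. a \<odot>\<^bsub>M\<^esub> x \<in> N <+>\<^bsub>M\<^esub> Y}"
    have "bounded_height ?H (n + l)"
    proof (rule bounded_height_combine[OF n l, where \<sigma> = "\<lambda>N. N \<inter> Y" and \<tau> = ?\<tau>])
      fix N K
      assume "N \<in> ?H"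
        and "K \<in> ?H" and le: "N \<subseteq> K"
        and *: "N \<inter> Y = K \<inter> Y" "?\<tau> N = ?\<tau> K"
      then have N: "submodule N A M" and K: "submodule K A M" "K \<subseteq> ?C <+>\<^bsub>M\<^esub> Y" by auto
      have "K \<subseteq> N <+>\<^bsub>M\<^esub> Y"
      proof
        fix k assume k: "k \<in> K"
        then obtain a y where a: "a \<in> carrier A" "y \<in> Y" "k = a \<odot>\<^bsub>M\<^esub> x \<oplus>\<^bsub>M\<^esub> y"
          using K(2) by (auto simp: mem_set_add subset_iff)
        have "a \<odot>\<^bsub>M\<^esub> x \<in> K <+>\<^bsub>M\<^esub> Y"
          using submodule_add_cancel[OF submodule_set_add[OF K(1) Y(1)], of "a \<odot>\<^bsub>M\<^esub> x" y]
            a k x subset_set_add[OF K(1) Y(1)] by auto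
        then have "a \<odot>\<^bsub>M\<^esub> x \<in> N <+>\<^bsub>M\<^esub> Y" using *(2) a(1) by auto
        then show "k \<in> N <+>\<^bsub>M\<^esub> Y"
          using a submodule_add[OF submodule_set_add[OF N Y(1)]] subset_set_add[OF N Y(1)] by auto
      qed
      then have "N <+>\<^bsub>M\<^esub> Y = K <+>\<^bsub>M\<^esub> Y"
        using set_add_least[OF submodule_set_add[OF N Y(1)]] subset_set_add[OF N Y(1)]
          set_add_least[OF submodule_set_add[OF K(1) Y(1)]] subset_set_add[OF K(1) Y(1)] le
        by (intro equalityI) auto
      then show "N = K" using modular_cancel[OF N K(1) Y(1) le *(1)] by simp
    next
      fix N assume "N \<in> ?H"
      then show "?\<tau> N \<in> {I. left_ideal I A}"
        using left_ideal_conductor[OF submodule_set_add[OF _ Y(1)] x] by simp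
    qed (use submodule_Int Y(1) in \<open>auto simp: mem_set_add\<close>)
    moreover have "insert x S \<subseteq> ?C <+>\<^bsub>M\<^esub> Y"
      using subset_set_add[OF C(1) Y(1)] C(2) Y(2) by auto
    ultimately show ?case using submodule_set_add[OF C(1) Y(1)] by blast
  qed
  moreover obtain S where S: "finite S" "S \<subseteq> carrier M" "\<forall>N. submodule N A M \<and> S \<subseteq> N \<longrightarrow> N = carrier M"
    using assms(2) unfolding finitely_generated_def by blast
  ultimately obtain Y n where Y: "submodule Y A M" "S \<subseteq> Y"
    "bounded_height {N. submodule N A M \<and> N \<subseteq> Y} n" by meson
  then have "Y = carrier M" using S by auto
  then have "{N. submodule N A M \<and> N \<subseteq> Y} = {N. submodule N A M}"
    using submodule_subset by auto
  then show ?thesis unfolding finite_height_def using Y(3) by auto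
qed

lemma (in artinian_cring) minimal_ideal:
  assumes "I \<in> F" "\<And>I. I \<in> F \<Longrightarrow> ideal I R"
  obtains M where "M \<in> F" "\<And>K. K \<in> F \<Longrightarrow> K \<subseteq> M \<Longrightarrow> K = M"
proof (rule ccontr)
  note found = that
  assume "\<not> thesis"
  then have ex: "\<exists>K. K \<in> F \<and> K \<subset> M" if M: "M \<in> F" for M
    using found[OF M] by blast
  have "\<exists>f. \<forall>n. f n \<in> F \<and> f (Suc n) \<subset> f n"
    by (rule dependent_nat_choice[where P = "\<lambda>_ M. M \<in> F" and Q = "\<lambda>_ M K. K \<subset> M"])
      (use assms(1) ex in auto)
  then obtain f where f: "\<And>n. f n \<in> F" "\<And>n :: nat. f (Suc n) \<subset> f n" by blast
  then obtain m where "\<forall>n \<ge> m. f n = f m"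
    using descending_chain_condition[of f] assms(2) by blast
  then have "f (Suc m) = f m" using le_SucI[OF order_refl, of m] by blast
  then show False using f(2)[of m] by simp
qed

text \<open>A commutative artinian ring has finite length.  Otherwise there is a minimal ideal \<open>I\<close> that
  has not, and then each ring element acts on \<open>I\<close> either as zero or surjectively: else the kernel
  and the image would be smaller than \<open>I\<close>, of finite length, and \<open>I\<close> would have finite length too.
  The descending chain condition turns surjective actions into invertible ones, so \<open>I\<close> is a vector
  space over a field.  A hyperplane \<open>W\<close> of it has finite length by minimality, hence so has \<open>I\<close>.\<close>

lemma (in artinian_cring) finite_height_regular: "finite_height R (regular_module R)"
proof (rule ccontr)
  let ?M = "regular_module R"
  let ?b = "\<lambda>I. \<exists>n. bounded_height {K. submodule K R ?M \<and> K \<subseteq> I} n"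
  interpret M: left_module R ?M by (rule left_module_regular)
  assume "\<not> finite_height R ?M"
  moreover have "{K. submodule K R ?M \<and> K \<subseteq> carrier R} = {K. submodule K R ?M}"
    using M.submodule_subset by auto
  ultimately have "\<not> ?b (carrier R)" by (simp add: finite_height_def)
  then have "carrier R \<in> {I. submodule I R ?M \<and> \<not> ?b I}" using M.submodule_full by simp
  then obtain I where I: "submodule I R ?M" "\<not> ?b I"
    and min: "\<And>K. submodule K R ?M \<Longrightarrow> \<not> ?b K \<Longrightarrow> K \<subseteq> I \<Longrightarrow> K = I"
    using minimal_ideal[of "carrier R" "{I. submodule I R ?M \<and> \<not> ?b I}"] submodule_regular_ideal
    by (smt (verit, best) mem_Collect_eq)
  let ?H = "{K. submodule K R ?M \<and> K \<subseteq> I}"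
  note Ic = M.submodule_carrier[OF I(1), simplified]
  have "I \<noteq> {\<zero>}" using I(2) M.bounded_height_trivial by auto
  then obtain x where x: "x \<in> I" "x \<noteq> \<zero>" using M.submodule_zero[OF I(1)] by auto
  have onto: "(\<lambda>y. r \<otimes> y) ` I = I" if r: "r \<in> carrier R" and nz: "\<exists>y \<in> I. r \<otimes> y \<noteq> \<zero>" for r
  proof (rule ccontr)
    let ?K = "{y \<in> I. r \<otimes> y = \<zero>}"
    have im: "submodule ((\<lambda>y. r \<otimes> y) ` N) R ?M" if N: "submodule N R ?M" for N
    proof -
      note Nc = M.submodule_carrier[OF N, simplified]
      have "left_ideal N R" using N by (simp add: left_ideal_iff_submodule)
      then have "submodule ((\<lambda>y. y \<otimes> r) ` N) R ?M"
        using M.submodule_orbit[of N r] r by simp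
      moreover have "(\<lambda>y. y \<otimes> r) ` N = (\<lambda>y. r \<otimes> y) ` N"
        using Nc r by (intro image_cong) (auto simp: m_comm)
      ultimately show ?thesis by simp
    qed
    have K: "submodule ?K R ?M"
    proof (rule M.submoduleI)
      show "a \<odot>\<^bsub>?M\<^esub> y \<in> ?K" if "a \<in> carrier R" "y \<in> ?K" for a y
        using that Ic r M.submodule_smult[OF I(1)] by (simp add: m_lcomm)
    qed (use Ic r M.submodule_zero[OF I(1)] M.submodule_add[OF I(1)] in \<open>auto simp: r_distr\<close>)
    assume "(\<lambda>y. r \<otimes> y) ` I \<noteq> I"
    moreover have "(\<lambda>y. r \<otimes> y) ` I \<subseteq> I" using M.submodule_smult[OF I(1)] r by auto
    ultimately have "?b ((\<lambda>y. r \<otimes> y) ` I)" using min[OF im[OF I(1)]] by blast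
    then obtain b where b: "bounded_height {K. submodule K R ?M \<and> K \<subseteq> (\<lambda>y. r \<otimes> y) ` I} b" by blast
    have "?K \<noteq> I" using nz by auto
    then have "?b ?K" using min[OF K] by blast
    then obtain a where a: "bounded_height {N. submodule N R ?M \<and> N \<subseteq> ?K} a" by blast
    have "bounded_height ?H (a + b)"
    proof (rule bounded_height_combine[OF a b, where \<sigma> = "\<lambda>N. N \<inter> ?K" and \<tau> = "\<lambda>N. (\<lambda>y. r \<otimes> y) ` N"])
      fix N L
      assume "N \<in> ?H" "L \<in> ?H"
        and le: "N \<subseteq> L" and *: "N \<inter> ?K = L \<inter> ?K" "(\<lambda>y. r \<otimes> y) ` N = (\<lambda>y. r \<otimes> y) ` L"
      then have N: "submodule N R ?M" "N \<subseteq> I" and L: "submodule L R ?M" "L \<subseteq> I" by auto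
      have "y \<in> N" if y: "y \<in> L" for y
      proof -
        from y *(2) obtain n where n: "n \<in> N" "r \<otimes> y = r \<otimes> n" by (metis (mono_tags, lifting) imageE imageI)
        have c: "y \<in> carrier R" "n \<in> carrier R" using y n L(2) N(2) Ic by auto
        have "y \<ominus> n \<in> L"
          using M.submodule_add[OF L(1), of y "\<ominus> n"] y n le M.submodule_smult[OF L(1), of "\<ominus> \<one>" n] c
          by (auto simp: a_minus_def l_minus)
        moreover have "r \<otimes> (y \<ominus> n) = \<zero>"
          using c r n(2) by (simp add: a_minus_def r_distr r_minus r_neg)
        ultimately have "y \<ominus> n \<in> N" using *(1) L(2) by blast
        then show ?thesis
          using M.submodule_add[OF N(1), of "y \<ominus> n" n] n c by (simp add: a_minus_def a_assoc l_neg)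
      qed
      then show "N = L" using le by blast
    qed (use K im M.submodule_Int in auto)
    then show False using I(2) by blast
  qed
  have inv: "\<exists>s \<in> carrier R. \<forall>y \<in> I. s \<otimes> (r \<otimes> y) = y"
    if r: "r \<in> carrier R" and nz: "\<exists>y \<in> I. r \<otimes> y \<noteq> \<zero>" for r
  proof -
    (* T n consists of the ring elements that act on I like a multiple of the n-th power of r;
       where this chain of ideals stops, a power of r can be cancelled because r acts surjectively *)
    define T where "T n = {a \<in> carrier R. \<exists>s \<in> carrier R. \<forall>y \<in> I. a \<otimes> y = s \<otimes> (r [^] n \<otimes> y)}" for n :: nat
    have T: "ideal (T n) R" for n
    proof (rule submodule_regular_ideal, rule M.submoduleI)
      show "\<zero>\<^bsub>?M\<^esub> \<in> T n" using Ic r by (auto simp: T_def intro!: bexI[of _ "\<zero>"])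
      fix u assume "u \<in> T n"
      then obtain s where u: "u \<in> carrier R" "s \<in> carrier R" "\<forall>y \<in> I. u \<otimes> y = s \<otimes> (r [^] n \<otimes> y)"
        by (auto simp: T_def)
      show "a \<odot>\<^bsub>?M\<^esub> u \<in> T n" if "a \<in> carrier R" for a
        using that u Ic r by (auto simp: T_def m_assoc intro!: bexI[of _ "a \<otimes> s"])
      show "u \<oplus>\<^bsub>?M\<^esub> v \<in> T n" if "v \<in> T n" for v
      proof -
        from that obtain t where v: "v \<in> carrier R" "t \<in> carrier R" "\<forall>y \<in> I. v \<otimes> y = t \<otimes> (r [^] n \<otimes> y)"
          by (auto simp: T_def)
        show ?thesis using u v Ic r by (auto simp: T_def l_distr intro!: bexI[of _ "s \<oplus> t"])
      qed
    qed (auto simp: T_def)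
    have "T 0 \<in> range T" by simp
    then obtain n where n: "\<And>k. T k \<subseteq> T n \<Longrightarrow> T k = T n"
      using minimal_ideal[of "T 0" "range T"] T by (metis (no_types, lifting) rangeE rangeI)
    have "T (Suc n) \<subseteq> T n"
    proof
      fix u assume "u \<in> T (Suc n)"
      then obtain s where u: "u \<in> carrier R" "s \<in> carrier R" "\<forall>y \<in> I. u \<otimes> y = s \<otimes> (r [^] Suc n \<otimes> y)"
        by (auto simp: T_def)
      have "\<forall>y \<in> I. u \<otimes> y = (s \<otimes> r) \<otimes> (r [^] n \<otimes> y)"
        using u r Ic by (auto simp: m_ac)
      then show "u \<in> T n" unfolding T_def using u r by blast
    qed
    moreover have "r [^] n \<in> T n" using r Ic by (auto simp: T_def intro!: bexI[of _ \<one>])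
    ultimately have "r [^] n \<in> T (Suc n)" using n by blast
    then obtain s where s: "s \<in> carrier R" "\<forall>y \<in> I. r [^] n \<otimes> y = s \<otimes> (r [^] Suc n \<otimes> y)"
      by (auto simp: T_def)
    have pow: "\<exists>y \<in> I. z = r [^] k \<otimes> y" if "z \<in> I" for z and k :: nat
      using that
    proof (induction k arbitrary: z)
      case 0 then show ?case using Ic by (intro bexI[of _ z]) auto
    next
      case (Suc k)
      obtain y where y: "y \<in> I" "z = r [^] k \<otimes> y" using Suc by blast
      obtain w where w: "w \<in> I" "y = r \<otimes> w" using onto[OF r nz] y(1) by blast
      show ?case using y w r Ic by (intro bexI[of _ w]) (auto simp: m_assoc)
    qed
    have "s \<otimes> (r \<otimes> z) = z" if z: "z \<in> I" for z
    proof -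
      obtain y where y: "y \<in> I" "z = r [^] n \<otimes> y" using pow[OF z] by blast
      then have "z = s \<otimes> (r [^] Suc n \<otimes> y)" using s by auto
      also have "\<dots> = s \<otimes> (r \<otimes> (r [^] n \<otimes> y))" using Ic[OF y(1)] r by (simp add: m_ac)
      finally show ?thesis using y(2) by simp
    qed
    then show ?thesis using s(1) by blast
  qed
  (* a hyperplane is a submodule that is maximal among those that avoid a chosen x *)
  let ?Z = "{W. submodule W R ?M \<and> W \<subseteq> I \<and> x \<notin> W}"
  have "\<exists>W \<in> ?Z. \<forall>V \<in> ?Z. W \<subseteq> V \<longrightarrow> V = W"
  proof (rule subset_Zorn_nonempty)
    have "{\<zero>} \<in> ?Z" using M.submodule_trivial x M.submodule_zero[OF I(1)] by auto
    then show "?Z \<noteq> {}" by blast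
    fix C assume C: "C \<noteq> {}" "subset.chain ?Z C"
    then have CZ: "\<And>W. W \<in> C \<Longrightarrow> submodule W R ?M \<and> W \<subseteq> I \<and> x \<notin> W"
      and lin: "\<And>W V. W \<in> C \<Longrightarrow> V \<in> C \<Longrightarrow> W \<subseteq> V \<or> V \<subseteq> W"
      unfolding subset_chain_def by blast+
    have "submodule (\<Union>C) R ?M"
    proof (rule M.submoduleI)
      show "\<Union>C \<subseteq> carrier ?M" using CZ M.submodule_subset by blast
      show "\<zero>\<^bsub>?M\<^esub> \<in> \<Union>C" using C(1) CZ M.submodule_zero by blast
      show "u \<oplus>\<^bsub>?M\<^esub> v \<in> \<Union>C" if "u \<in> \<Union>C" "v \<in> \<Union>C" for u v
      proof -
        from that obtain U V where "U \<in> C" "V \<in> C" "u \<in> U" "v \<in> V" by blast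
        then obtain W where "W \<in> C" "u \<in> W" "v \<in> W" using lin by blast
        then show ?thesis using M.submodule_add CZ by blast
      qed
      show "a \<odot>\<^bsub>?M\<^esub> u \<in> \<Union>C" if "a \<in> carrier R" "u \<in> \<Union>C" for a u
        using that CZ M.submodule_smult by blast
    qed
    then show "\<Union>C \<in> ?Z" using CZ by blast
  qed
  then obtain W where WZ: "W \<in> ?Z" and Wmax': "\<forall>V \<in> ?Z. W \<subseteq> V \<longrightarrow> V = W" by (rule bexE)
  have W: "submodule W R ?M" "W \<subseteq> I" "x \<notin> W" using WZ by simp_all
  have Wmax: "V = W" if "submodule V R ?M" "V \<subseteq> I" "x \<notin> V" "W \<subseteq> V" for V
    using Wmax'[rule_format, of V] that by simp
  have top: "V = I" if V: "submodule V R ?M" "V \<subseteq> I" "W \<subseteq> V" "V \<noteq> W" for V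
  proof (rule equalityI[OF V(2)], rule)
    have xV: "x \<in> V" using Wmax V by blast
    fix y assume y: "y \<in> I"
    show "y \<in> V"
    proof (cases "y \<in> W")
      case False
      let ?C = "(\<lambda>a. a \<otimes> y) ` carrier R"
      have C: "submodule ?C R ?M" "y \<in> ?C" using M.submodule_cyclic[of y] Ic[OF y] by simp_all
      have "?C \<subseteq> I" using M.submodule_smult[OF I(1)] y by auto
      then have "W <+>\<^bsub>?M\<^esub> ?C \<subseteq> I" using M.set_add_least[OF I(1) W(2)] by blast
      moreover note le = M.subset_set_add[OF W(1) C(1)]
      moreover have "W <+>\<^bsub>?M\<^esub> ?C \<noteq> W" using le C(2) False by blast
      ultimately have "x \<in> W <+>\<^bsub>?M\<^esub> ?C" using Wmax[OF M.submodule_set_add[OF W(1) C(1)]] by blast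
      then obtain w r where wr: "w \<in> W" "r \<in> carrier R" "x = w \<oplus> r \<otimes> y"
        by (auto simp: M.mem_set_add)
      have wc: "w \<in> carrier R" using wr W(2) Ic by blast
      have "r \<otimes> y \<noteq> \<zero>" using wr W(3) wc by auto
      then obtain s where s: "s \<in> carrier R" "s \<otimes> (r \<otimes> y) = y" using inv[OF wr(2)] y by blast
      have "r \<otimes> y \<in> V"
        using M.submodule_add_cancel'[OF V(1), of w "r \<otimes> y"] xV wr V(3) Ic[OF y] by auto
      then show ?thesis using M.submodule_smult[OF V(1) s(1)] s(2) by fastforce
    qed (use V in blast)
  qed
  have "W \<noteq> I" using W(3) x(1) by auto
  then obtain n where n: "bounded_height {K. submodule K R ?M \<and> K \<subseteq> W} n" using min[OF W(1) _ W(2)] by blast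
  have two: "bounded_height {W, I} 1"
    unfolding bounded_height_def using W(2) \<open>W \<noteq> I\<close>
    by (intro exI[of _ "\<lambda>K. if K = W then 0 else 1"]) auto
  have "bounded_height ?H (n + 1)"
  proof (rule bounded_height_combine[OF n two, where \<sigma> = "\<lambda>N. N \<inter> W" and \<tau> = "\<lambda>N. N <+>\<^bsub>?M\<^esub> W"])
    fix N assume "N \<in> ?H"
    then have N: "submodule N R ?M" "N \<subseteq> I" by auto
    show "N <+>\<^bsub>?M\<^esub> W \<in> {W, I}"
      using top[OF M.submodule_set_add[OF N(1) W(1)] M.set_add_least[OF I(1) N(2) W(2)]
        M.subset_set_add(2)[OF N(1) W(1)]] by blast
  next
    fix N K assume "N \<in> ?H" "K \<in> ?H"
      "N \<subseteq> K" "N \<inter> W = K \<inter> W" "N <+>\<^bsub>?M\<^esub> W = K <+>\<^bsub>?M\<^esub> W"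
    then show "N = K" using M.modular_cancel[OF _ _ W(1)] by blast
  qed (use M.submodule_Int[OF _ W(1)] M.set_add_mono in auto)
  then show False using I(2) by blast
qed

section \<open>Homomorphisms, quotients and composition series\<close>

lemma indecomposableD:
  assumes "indecomposable A M" "submodule N A M" "submodule K A M"
    and "N <+>\<^bsub>M\<^esub> K = carrier M" "N \<inter> K = {\<zero>\<^bsub>M\<^esub>}"
  shows "N = {\<zero>\<^bsub>M\<^esub>} \<or> K = {\<zero>\<^bsub>M\<^esub>}"
  using assms(1) assms(2-5) unfolding indecomposable_def by simp

locale left_module_map = M: left_module A M + N: left_module A N
  for A :: "('a, 'b) ring_scheme" and M :: "('a, 'm, 'x) module_scheme"
    and N :: "('a, 'n, 'y) module_scheme" +
  fixes h :: "'m \<Rightarrow> 'n"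
  assumes hom: "h \<in> left_module_hom A M N"
begin

lemma hom_closed [simp]: "x \<in> carrier M \<Longrightarrow> h x \<in> carrier N"
  and hom_add: "x \<in> carrier M \<Longrightarrow> y \<in> carrier M \<Longrightarrow> h (x \<oplus>\<^bsub>M\<^esub> y) = h x \<oplus>\<^bsub>N\<^esub> h y"
  and hom_smult: "a \<in> carrier A \<Longrightarrow> x \<in> carrier M \<Longrightarrow> h (a \<odot>\<^bsub>M\<^esub> x) = a \<odot>\<^bsub>N\<^esub> h x"
  using hom unfolding left_module_hom_def by auto

lemma hom_zero: "h \<zero>\<^bsub>M\<^esub> = \<zero>\<^bsub>N\<^esub>"
  using hom_smult[OF M.A.zero_closed M.M.zero_closed] by simp

lemma hom_minus: "x \<in> carrier M \<Longrightarrow> h (\<ominus>\<^bsub>M\<^esub> x) = \<ominus>\<^bsub>N\<^esub> h x"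
  using hom_smult[of "\<ominus>\<^bsub>A\<^esub> \<one>\<^bsub>A\<^esub>" x] by (simp add: M.smult_minus_one N.smult_minus_one)

lemma hom_diff: "x \<in> carrier M \<Longrightarrow> y \<in> carrier M \<Longrightarrow> h (x \<ominus>\<^bsub>M\<^esub> y) = h x \<ominus>\<^bsub>N\<^esub> h y"
  by (simp add: a_minus_def hom_add hom_minus)

lemma submodule_image:
  assumes K: "submodule K A M"
  shows "submodule (h ` K) A N"
proof (rule N.submoduleI)
  note c = M.submodule_carrier[OF K]
  show "h ` K \<subseteq> carrier N" using c by auto
  show "\<zero>\<^bsub>N\<^esub> \<in> h ` K" using hom_zero M.submodule_zero[OF K] by (intro image_eqI) auto
  fix u assume "u \<in> h ` K"
  then obtain x where x: "x \<in> K" "u = h x" by auto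
  show "a \<odot>\<^bsub>N\<^esub> u \<in> h ` K" if "a \<in> carrier A" for a
    using that x c M.submodule_smult[OF K that] by (intro image_eqI[of _ _ "a \<odot>\<^bsub>M\<^esub> x"]) (auto simp: hom_smult)
  show "u \<oplus>\<^bsub>N\<^esub> v \<in> h ` K" if "v \<in> h ` K" for v
  proof -
    from that obtain y where "y \<in> K" "v = h y" by auto
    then show ?thesis
      using x c M.submodule_add[OF K] by (intro image_eqI[of _ _ "x \<oplus>\<^bsub>M\<^esub> y"]) (auto simp: hom_add)
  qed
qed

lemma submodule_preimage:
  assumes K: "submodule K A N"
  shows "submodule {x \<in> carrier M. h x \<in> K} A M"
  by (rule M.submoduleI)
    (use N.submodule_zero[OF K] N.submodule_add[OF K] N.submodule_smult[OF K] in
      \<open>auto simp: hom_zero hom_add hom_smult\<close>)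

lemma submodule_kernel: "submodule {x \<in> carrier M. h x = \<zero>\<^bsub>N\<^esub>} A M"
  using submodule_preimage[OF N.submodule_trivial] by simp

lemma inj_onI_kernel:
  assumes "\<And>x. x \<in> carrier M \<Longrightarrow> h x = \<zero>\<^bsub>N\<^esub> \<Longrightarrow> x = \<zero>\<^bsub>M\<^esub>"
  shows "inj_on h (carrier M)"
proof (rule inj_onI)
  fix x y assume xy: "x \<in> carrier M" "y \<in> carrier M" "h x = h y"
  then have "h (x \<ominus>\<^bsub>M\<^esub> y) = \<zero>\<^bsub>N\<^esub>" by (simp add: hom_diff N.diff_eq_zero_iff)
  then have "x \<ominus>\<^bsub>M\<^esub> y = \<zero>\<^bsub>M\<^esub>" using assms xy by simp
  then show "x = y" using xy by (simp add: M.diff_eq_zero_iff)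
qed

lemma inj_zero:
  "inj_on h (carrier M) \<Longrightarrow> x \<in> carrier M \<Longrightarrow> h x = \<zero>\<^bsub>N\<^esub> \<Longrightarrow> x = \<zero>\<^bsub>M\<^esub>"
  using hom_zero by (metis M.M.zero_closed inj_onD)

lemma bounded_height_inj:
  assumes inj: "inj_on h (carrier M)" and "bounded_height {K. submodule K A N} n"
  shows "bounded_height {K. submodule K A M} n"
  using assms(2)
proof (rule bounded_height_strict_map[where \<sigma> = "image h"])
  fix K L assume "K \<in> {K. submodule K A M}" "L \<in> {K. submodule K A M}" and lt: "K \<subset> L"
  then have "K \<subseteq> carrier M" "L \<subseteq> carrier M" using M.submodule_subset by auto
  then have "h ` K = h ` L \<Longrightarrow> K = L" using inj_on_image_eq_iff[OF inj] by blast
  then show "h ` K \<subset> h ` L" using lt by blast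
qed (use submodule_image in auto)

lemma finite_height_inj:
  "inj_on h (carrier M) \<Longrightarrow> finite_height A N \<Longrightarrow> finite_height A M"
  using bounded_height_inj unfolding finite_height_def by blast

lemma finitely_generated_image:
  assumes fg: "finitely_generated A M" and surj: "h ` carrier M = carrier N"
  shows "finitely_generated A N"
proof -
  obtain S where S: "finite S" "S \<subseteq> carrier M"
    "\<And>K. submodule K A M \<Longrightarrow> S \<subseteq> K \<Longrightarrow> K = carrier M"
    using fg unfolding finitely_generated_def by blast
  have "K = carrier N" if K: "submodule K A N" "h ` S \<subseteq> K" for K
  proof -
    have "S \<subseteq> {x \<in> carrier M. h x \<in> K}" using S(2) K(2) by auto
    then have "{x \<in> carrier M. h x \<in> K} = carrier M" using S(3)[OF submodule_preimage[OF K(1)]] by blast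
    then have "h ` carrier M \<subseteq> K" by blast
    then show ?thesis using surj N.submodule_subset[OF K(1)] by auto
  qed
  then show ?thesis
    unfolding finitely_generated_def using S(1,2) surj by (intro exI[of _ "h ` S"]) auto
qed

lemma image_preimage:
  assumes surj: "h ` carrier M = carrier N" and K: "submodule K A N"
  shows "h ` {x \<in> carrier M. h x \<in> K} = K"
proof -
  have "\<exists>x \<in> carrier M. y = h x" if "y \<in> K" for y
    using surj N.submodule_carrier[OF K that] by auto
  then show ?thesis by auto
qed

lemma uniserial_image:
  assumes "uniserial A M" and surj: "h ` carrier M = carrier N"
  shows "uniserial A N"
  unfolding uniserial_def
proof (intro allI impI)
  fix K L assume *: "submodule K A N \<and> submodule L A N"
  have eq: "h ` {x \<in> carrier M. h x \<in> K} = K" if "submodule K A N" for K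
    by (rule image_preimage[OF surj that])
  have "{x \<in> carrier M. h x \<in> K} \<subseteq> {x \<in> carrier M. h x \<in> L} \<or>
        {x \<in> carrier M. h x \<in> L} \<subseteq> {x \<in> carrier M. h x \<in> K}"
    using assms(1) submodule_preimage * unfolding uniserial_def by blast
  then show "K \<subseteq> L \<or> L \<subseteq> K" using eq * by (metis (no_types, lifting) image_mono)
qed

lemma indecomposable_iso:
  assumes "indecomposable A M" and bij: "bij_betw h (carrier M) (carrier N)"
  shows "indecomposable A N"
  unfolding indecomposable_def
proof (intro conjI allI impI)
  have inj: "inj_on h (carrier M)" and surj: "h ` carrier M = carrier N"
    using bij by (auto simp: bij_betw_def)
  have "\<exists>x \<in> carrier M. x \<noteq> \<zero>\<^bsub>M\<^esub>"
    using assms(1) M.M.zero_closed unfolding indecomposable_def by blast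
  then show "carrier N \<noteq> {\<zero>\<^bsub>N\<^esub>}" using inj_zero[OF inj] hom_closed by blast
  fix K L
  assume *: "submodule K A N \<and> submodule L A N \<and> K <+>\<^bsub>N\<^esub> L = carrier N \<and> K \<inter> L = {\<zero>\<^bsub>N\<^esub>}"
  let ?K = "{x \<in> carrier M. h x \<in> K}" and ?L = "{x \<in> carrier M. h x \<in> L}"
  have eq: "h ` {x \<in> carrier M. h x \<in> K} = K" if "submodule K A N" for K
    by (rule image_preimage[OF surj that])
  have sub: "submodule ?K A M" "submodule ?L A M" using submodule_preimage * by blast+
  moreover have "?K <+>\<^bsub>M\<^esub> ?L = carrier M"
  proof
    show "carrier M \<subseteq> ?K <+>\<^bsub>M\<^esub> ?L"
    proof
      fix x assume x: "x \<in> carrier M"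
      have "h x \<in> K <+>\<^bsub>N\<^esub> L" using * hom_closed[OF x] by simp
      then obtain u v where uv: "u \<in> K" "v \<in> L" "h x = u \<oplus>\<^bsub>N\<^esub> v"
        unfolding N.mem_set_add by blast
      have "u \<in> carrier N" "v \<in> carrier N" using uv * N.submodule_carrier by blast+
      then obtain k l where kl: "k \<in> carrier M" "l \<in> carrier M" "h k = u" "h l = v"
        unfolding surj[symmetric] by blast
      then have "h x = h (k \<oplus>\<^bsub>M\<^esub> l)" using uv by (simp add: hom_add)
      then have "x = k \<oplus>\<^bsub>M\<^esub> l" using inj_onD[OF inj] x kl by simp
      then show "x \<in> ?K <+>\<^bsub>M\<^esub> ?L" unfolding M.mem_set_add using kl uv by blast
    qed
  qed (use M.submodule_subset[OF M.submodule_set_add[OF sub]] in simp)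
  moreover have "?K \<inter> ?L = {\<zero>\<^bsub>M\<^esub>}"
  proof -
    have "x = \<zero>\<^bsub>M\<^esub>" if "x \<in> ?K \<inter> ?L" for x using that * inj_zero[OF inj, of x] by blast
    then show ?thesis using M.submodule_zero[OF sub(1)] M.submodule_zero[OF sub(2)] by blast
  qed
  ultimately have "?K = {\<zero>\<^bsub>M\<^esub>} \<or> ?L = {\<zero>\<^bsub>M\<^esub>}" by (rule indecomposableD[OF assms(1)])
  then have "h ` ?K = {\<zero>\<^bsub>N\<^esub>} \<or> h ` ?L = {\<zero>\<^bsub>N\<^esub>}" 
    by (elim disjE) (simp_all only: image_insert image_empty hom_zero simp_thms)
  then show "K = {\<zero>\<^bsub>N\<^esub>} \<or> L = {\<zero>\<^bsub>N\<^esub>}"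
    unfolding eq[OF *[THEN conjunct1]] eq[OF *[THEN conjunct2, THEN conjunct1]] .
qed

lemma inverse_map:
  assumes bij: "bij_betw h (carrier M) (carrier N)"
  shows "left_module_map A N M (inv_into (carrier M) h)"
proof -
  let ?g = "inv_into (carrier M) h"
  have inj: "inj_on h (carrier M)" and surj: "h ` carrier M = carrier N"
    using bij by (auto simp: bij_betw_def)
  have g: "?g y \<in> carrier M" "h (?g y) = y" if "y \<in> carrier N" for y
    using that surj by (auto intro: inv_into_into f_inv_into_f)
  have gh: "?g (h x) = x" if "x \<in> carrier M" for x using that inj by simp
  have add: "?g (x \<oplus>\<^bsub>N\<^esub> y) = ?g x \<oplus>\<^bsub>M\<^esub> ?g y" if "x \<in> carrier N" "y \<in> carrier N" for x y
  proof -
    have "h (?g x \<oplus>\<^bsub>M\<^esub> ?g y) = x \<oplus>\<^bsub>N\<^esub> y" using that g by (simp add: hom_add)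
    then show ?thesis using gh[of "?g x \<oplus>\<^bsub>M\<^esub> ?g y"] that g by simp
  qed
  have smult: "?g (a \<odot>\<^bsub>N\<^esub> y) = a \<odot>\<^bsub>M\<^esub> ?g y" if "a \<in> carrier A" "y \<in> carrier N" for a y
  proof -
    have "h (a \<odot>\<^bsub>M\<^esub> ?g y) = a \<odot>\<^bsub>N\<^esub> y" using that g by (simp add: hom_smult)
    then show ?thesis using gh[of "a \<odot>\<^bsub>M\<^esub> ?g y"] that g by simp
  qed
  have "?g \<in> left_module_hom A N M" unfolding left_module_hom_def using g add smult by auto
  then show ?thesis
    by (intro left_module_map.intro left_module_map_axioms.intro M.left_module_axioms N.left_module_axioms)
qed

end

lemma left_module_mapI:
  "left_module A M \<Longrightarrow> left_module A N \<Longrightarrow> h \<in> left_module_hom A M N \<Longrightarrow> left_module_map A M N h"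
  by (intro left_module_map.intro left_module_map_axioms.intro)

lemma left_module_map_comp:
  assumes "left_module_map A L M f" "left_module_map A M N g"
  shows "left_module_map A L N (g \<circ> f)"
proof -
  interpret f: left_module_map A L M f by fact
  interpret g: left_module_map A M N g by fact
  have "g \<circ> f \<in> left_module_hom A L N"
    unfolding left_module_hom_def
    by (auto simp: f.hom_add g.hom_add f.hom_smult g.hom_smult)
  then show ?thesis by (rule left_module_mapI[OF f.M.left_module_axioms g.N.left_module_axioms])
qed

text \<open>The quotient is realised on representatives of the cosets instead of on the cosets, so that
  its elements have the same type as those of \<open>M\<close>.\<close>

lemma (in left_module) quotient_exists:
  assumes K: "submodule K A M"
  obtains Q :: "('a, 'm) module" and q where "left_module_map A M Q q"
    and "q ` carrier M = carrier Q" and "\<And>x. x \<in> carrier M \<Longrightarrow> q x = \<zero>\<^bsub>Q\<^esub> \<longleftrightarrow> x \<in> K"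
proof -
  define rel where "rel x y \<longleftrightarrow> x \<in> carrier M \<and> y \<in> carrier M \<and> x \<ominus>\<^bsub>M\<^esub> y \<in> K" for x y
  define q where "q x = (SOME y. rel x y)" for x
  have refl: "rel x x" if "x \<in> carrier M" for x
    using that submodule_zero[OF K] by (simp add: rel_def a_minus_def M.r_neg)
  have sym: "rel y x" if "rel x y" for x y
    using that submodule_minus[OF K, of "x \<ominus>\<^bsub>M\<^esub> y"]
    by (simp add: rel_def a_minus_def M.minus_add M.minus_minus M.a_comm)
  have trans: "rel x z" if "rel x y" "rel y z" for x y z
  proof -
    have "x \<ominus>\<^bsub>M\<^esub> z = (x \<ominus>\<^bsub>M\<^esub> y) \<oplus>\<^bsub>M\<^esub> (y \<ominus>\<^bsub>M\<^esub> z)"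
      using that by (simp add: rel_def a_minus_def M.a_assoc M.r_neg1 M.r_neg2)
    then show ?thesis using that submodule_add[OF K] by (simp add: rel_def)
  qed
  have rq: "rel x (q x)" if "x \<in> carrier M" for x
    unfolding q_def using refl[OF that] by (rule someI)
  have qc: "q x \<in> carrier M" if "x \<in> carrier M" for x using rq[OF that] by (simp add: rel_def)
  have qeq: "q x = q y" if "rel x y" for x y
  proof -
    have "rel x = rel y" using that sym trans by blast
    then show ?thesis by (simp add: q_def)
  qed
  have qiff: "q x = q y \<longleftrightarrow> rel x y" if "x \<in> carrier M" "y \<in> carrier M" for x y
    using qeq rq that sym trans by metis
  have qadd: "q (q x \<oplus>\<^bsub>M\<^esub> q y) = q (x \<oplus>\<^bsub>M\<^esub> y)" if c: "x \<in> carrier M" "y \<in> carrier M" for x y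
  proof -
    have "(x \<oplus>\<^bsub>M\<^esub> y) \<ominus>\<^bsub>M\<^esub> (q x \<oplus>\<^bsub>M\<^esub> q y) = (x \<ominus>\<^bsub>M\<^esub> q x) \<oplus>\<^bsub>M\<^esub> (y \<ominus>\<^bsub>M\<^esub> q y)"
      using c qc by (simp add: a_minus_def M.minus_add M.a_ac)
    then have "rel (x \<oplus>\<^bsub>M\<^esub> y) (q x \<oplus>\<^bsub>M\<^esub> q y)"
      using c qc rq[OF c(1)] rq[OF c(2)] submodule_add[OF K] by (simp add: rel_def)
    then show ?thesis using qeq by simp
  qed
  have qsmult: "q (a \<odot>\<^bsub>M\<^esub> q x) = q (a \<odot>\<^bsub>M\<^esub> x)" if c: "a \<in> carrier A" "x \<in> carrier M" for a x
  proof -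
    have "a \<odot>\<^bsub>M\<^esub> x \<ominus>\<^bsub>M\<^esub> a \<odot>\<^bsub>M\<^esub> q x = a \<odot>\<^bsub>M\<^esub> (x \<ominus>\<^bsub>M\<^esub> q x)"
      using c qc by (simp add: a_minus_def smult_r_distr smult_r_minus)
    then have "rel (a \<odot>\<^bsub>M\<^esub> x) (a \<odot>\<^bsub>M\<^esub> q x)"
      using c qc rq[OF c(2)] submodule_smult[OF K c(1)] by (simp add: rel_def)
    then show ?thesis using qeq by simp
  qed
  define Q :: "('a, 'm) module" where
    "Q = \<lparr>carrier = q ` carrier M, monoid.mult = (\<lambda>_ _. \<zero>\<^bsub>M\<^esub>), one = \<zero>\<^bsub>M\<^esub>, ring.zero = q \<zero>\<^bsub>M\<^esub>,
          ring.add = (\<lambda>u v. q (u \<oplus>\<^bsub>M\<^esub> v)), smult = (\<lambda>a u. q (a \<odot>\<^bsub>M\<^esub> u))\<rparr>"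
  have qadd_l: "q (q x \<oplus>\<^bsub>M\<^esub> y) = q (x \<oplus>\<^bsub>M\<^esub> y)" and qadd_r: "q (x \<oplus>\<^bsub>M\<^esub> q y) = q (x \<oplus>\<^bsub>M\<^esub> y)"
    if c: "x \<in> carrier M" "y \<in> carrier M" for x y
    using qadd[OF c] qadd[OF qc[OF c(1)] c(2)] qadd[OF c(1) qc[OF c(2)]]
      qeq[OF sym[OF rq[OF c(1)]]] qeq[OF sym[OF rq[OF c(2)]]] by simp_all
  have qq: "q (q x) = q x" if "x \<in> carrier M" for x using qeq[OF sym[OF rq[OF that]]] .
  have "abelian_group Q"
  proof (rule abelian_groupI)
    show "\<exists>y \<in> carrier Q. y \<oplus>\<^bsub>Q\<^esub> u = \<zero>\<^bsub>Q\<^esub>" if "u \<in> carrier Q" for u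
    proof -
      from that obtain x where x: "x \<in> carrier M" "u = q x" by (auto simp: Q_def)
      then show ?thesis by (intro bexI[of _ "q (\<ominus>\<^bsub>M\<^esub> x)"]) (auto simp: Q_def qadd M.l_neg)
    qed
  qed (auto simp: Q_def qadd qadd_l qadd_r qq qc M.a_assoc, auto simp: M.a_comm)
  then have Q: "left_module A Q"
    by (intro left_module.intro left_module_axioms.intro A.ring_axioms)
      (auto simp: Q_def qadd qsmult qq qc smult_l_distr[symmetric] smult_r_distr
        smult_assoc[symmetric])
  have q: "q \<in> left_module_hom A M Q"
    by (auto simp: left_module_hom_def Q_def qadd qsmult)
  have surj: "q ` carrier M = carrier Q" by (simp add: Q_def)
  have "q x = \<zero>\<^bsub>Q\<^esub> \<longleftrightarrow> x \<in> K" if "x \<in> carrier M" for x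
    using that qiff[OF that M.zero_closed] M.minus_equality[of "\<zero>\<^bsub>M\<^esub>" "\<zero>\<^bsub>M\<^esub>"]
    by (simp add: Q_def rel_def a_minus_def)
  then show ?thesis by (rule that[OF left_module_mapI[OF left_module_axioms Q q] surj])
qed

text \<open>The induction removes a maximal proper submodule of \<open>Y\<close>, whose rank is smaller.\<close>

lemma (in left_module) finite_height_imp_finite_length:
  assumes "finite_height A M"
  shows "finite_length A M"
proof -
  have "\<exists>k C. composition_series A (M\<lparr>carrier := Y\<rparr>) k C"
    if "submodule Y A M" "bounded_height {N. submodule N A M \<and> N \<subseteq> Y} n" for Y n
    using that
  proof (induction n arbitrary: Y rule: less_induct)
    case (less n)
    note Y = less.prems(1)
    show ?case
    proof (cases "Y = {\<zero>\<^bsub>M\<^esub>}")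
      case True
      then have "composition_series A (M\<lparr>carrier := Y\<rparr>) 0 (\<lambda>_. {\<zero>\<^bsub>M\<^esub>})"
        using submodule_submodule_iff[OF Y] submodule_trivial
        by (simp add: composition_series_def)
      then show ?thesis by blast
    next
      case False
      let ?F = "{N. submodule N A M \<and> N \<subset> Y}"
      have "bounded_height ?F n" by (rule bounded_height_mono[OF less.prems(2)]) auto
      moreover have "{\<zero>\<^bsub>M\<^esub>} \<in> ?F" using False submodule_trivial submodule_zero[OF Y] by auto
      ultimately obtain Z where Z: "Z \<in> ?F" and max: "\<And>K. K \<in> ?F \<Longrightarrow> Z \<subseteq> K \<Longrightarrow> K = Z"
        by (rule bounded_height_maximal) blast
      have Zs: "submodule Z A M" "Z \<subset> Y" using Z by auto
      obtain \<rho> where \<rho>: "\<forall>N \<in> {N. submodule N A M \<and> N \<subseteq> Y}. \<rho> N \<le> n"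
        "\<forall>N \<in> {N. submodule N A M \<and> N \<subseteq> Y}. \<forall>K \<in> {N. submodule N A M \<and> N \<subseteq> Y}. N \<subset> K \<longrightarrow> \<rho> N < \<rho> K"
        using less.prems(2) unfolding bounded_height_def by blast
      have lt: "\<rho> Z < \<rho> Y" using \<rho>(2) Zs Y by simp
      have "\<rho> Y \<le> n" using \<rho>(1) Y by simp
      have "\<rho> N \<le> \<rho> Z" if "submodule N A M" "N \<subseteq> Z" for N
      proof (cases "N = Z")
        case False
        moreover have "N \<subseteq> Y" using that Zs by blast
        ultimately show ?thesis
          using \<rho>(2)[rule_format, of N Z] that Zs by (simp add: psubset_eq)
      qed simp
      then have "bounded_height {N. submodule N A M \<and> N \<subseteq> Z} (\<rho> Z)"
        unfolding bounded_height_def using \<rho>(2) Zs(2)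
        by (intro exI[of _ \<rho>]) (simp add: psubset_eq subset_trans[of _ Z Y])
      moreover have "\<rho> Z < n" using lt \<open>\<rho> Y \<le> n\<close> by simp
      ultimately obtain k C where C: "composition_series A (M\<lparr>carrier := Z\<rparr>) k C"
        using less.IH Zs(1) by blast
      let ?C = "\<lambda>i. if i \<le> k then C i else Y"
      have sC: "submodule (C i) A M \<and> C i \<subseteq> Z" if "i \<le> k" for i
        using C that submodule_submodule_iff[OF Zs(1)] by (simp add: composition_series_def)
      have Ck: "C k = Z" and C0: "C 0 = {\<zero>\<^bsub>M\<^esub>}" using C by (simp_all add: composition_series_def)
      have Cstep: "C i \<subset> C (Suc i)"
        and Ccover: "\<And>K. submodule K A M \<Longrightarrow> K \<subseteq> Z \<Longrightarrow> C i \<subset> K \<Longrightarrow> \<not> K \<subset> C (Suc i)"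
        if "i < k" for i
        using C that submodule_submodule_iff[OF Zs(1)] unfolding composition_series_def by simp_all
      have lt: "?C i \<subset> ?C (Suc i)" if "i < Suc k" for i
        using that Cstep[of i] Ck Zs(2) by (cases "i = k") simp_all
      have cover: "\<not> K \<subset> ?C (Suc i)"
        if "i < Suc k" "submodule K A M" "K \<subseteq> Y" "?C i \<subset> K" for i K
      proof (cases "i = k")
        case True
        then show ?thesis using that Ck max[of K] by auto
      next
        case False
        then have "i < k" using that by simp
        then show ?thesis using that Ccover[of i K] sC[of "Suc i"] by auto
      qed
      have "submodule (?C i) A M \<and> ?C i \<subseteq> Y" for i using sC[of i] Zs Y by auto
      then have "composition_series A (M\<lparr>carrier := Y\<rparr>) (Suc k) ?C"
        unfolding composition_series_def submodule_submodule_iff[OF Y]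
        using lt cover C0 by simp
      then show ?thesis by blast
    qed
  qed
  moreover obtain n where n: "bounded_height {N. submodule N A M} n"
    using assms unfolding finite_height_def by blast
  have "bounded_height {N. submodule N A M \<and> N \<subseteq> carrier M} n"
    by (rule bounded_height_mono[OF n]) auto
  ultimately show ?thesis
    unfolding finite_length_def using submodule_full by fastforce
qed

lemma (in left_module) finite_length_imp_fg:
  assumes "finite_length A M"
  shows "finitely_generated A M"
proof -
  obtain n C where C: "composition_series A M n C" using assms unfolding finite_length_def by blast
  have C0: "C 0 = {\<zero>\<^bsub>M\<^esub>}" and Cn: "C n = carrier M" and sub: "\<And>i. i \<le> n \<Longrightarrow> submodule (C i) A M"
    and lt: "\<And>i. i < n \<Longrightarrow> C i \<subset> C (Suc i)"
    and cover: "\<And>i K. i < n \<Longrightarrow> submodule K A M \<Longrightarrow> C i \<subset> K \<Longrightarrow> K \<subset> C (Suc i) \<Longrightarrow> False"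
    using C unfolding composition_series_def by blast+
  have "\<forall>i. \<exists>x. i < n \<longrightarrow> x \<in> C (Suc i) - C i" using lt by blast
  then obtain x where x: "\<And>i. i < n \<Longrightarrow> x i \<in> C (Suc i) - C i" by metis
  have gen: "C i \<subseteq> K" if K: "submodule K A M" "x ` {..<n} \<subseteq> K" and "i \<le> n" for K i
    using that(3)
  proof (induction i)
    case 0 then show ?case using C0 submodule_zero[OF K(1)] by simp
  next
    case (Suc i)
    then have i: "i < n" "C i \<subseteq> K" by auto
    have "x i \<in> K \<inter> C (Suc i)" using x[OF i(1)] K(2) i(1) by auto
    then have "C i \<subset> K \<inter> C (Suc i)" using x[OF i(1)] lt[OF i(1)] i(2) by auto
    then have "K \<inter> C (Suc i) = C (Suc i)"
      using cover[OF i(1) submodule_Int[OF K(1) sub[OF Suc.prems]]] by blast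
    then show ?case by blast
  qed
  have "x ` {..<n} \<subseteq> carrier M"
  proof
    fix y assume "y \<in> x ` {..<n}"
    then obtain i where "i < n" "y = x i" by auto
    then show "y \<in> carrier M" using x[of i] submodule_subset[OF sub[of "Suc i"]] by auto
  qed
  moreover have "K = carrier M" if "submodule K A M" "x ` {..<n} \<subseteq> K" for K
    using gen[OF that order_refl] Cn submodule_subset[OF that(1)] by blast
  ultimately show ?thesis
    unfolding finitely_generated_def by (intro exI[of _ "x ` {..<n}"]) auto
qed

section \<open>Restriction of scalars\<close>

text \<open>The ring \<open>R\<close> acts on a module over the \<open>R\<close>-algebra \<open>A\<close> through the multiples of the unit.\<close>

definition restrict_scalars ::
  "('r, 'a, 'd) module_scheme \<Rightarrow> ('a, 'm, 'x) module_scheme \<Rightarrow> ('r, 'm) module" where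
  "restrict_scalars A M = \<lparr>carrier = carrier M, monoid.mult = monoid.mult M, one = one M,
     ring.zero = \<zero>\<^bsub>M\<^esub>, ring.add = ring.add M, smult = (\<lambda>r x. (r \<odot>\<^bsub>A\<^esub> \<one>\<^bsub>A\<^esub>) \<odot>\<^bsub>M\<^esub> x)\<rparr>"

lemma restrict_scalars_simps [simp]:
  "carrier (restrict_scalars A M) = carrier M" "\<zero>\<^bsub>restrict_scalars A M\<^esub> = \<zero>\<^bsub>M\<^esub>"
  "x \<oplus>\<^bsub>restrict_scalars A M\<^esub> y = x \<oplus>\<^bsub>M\<^esub> y"
  "r \<odot>\<^bsub>restrict_scalars A M\<^esub> x = (r \<odot>\<^bsub>A\<^esub> \<one>\<^bsub>A\<^esub>) \<odot>\<^bsub>M\<^esub> x"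
  by (simp_all add: restrict_scalars_def)

lemma restrict_scalars_minus [simp]:
  "\<ominus>\<^bsub>restrict_scalars A M\<^esub> x = \<ominus>\<^bsub>M\<^esub> x" "x \<ominus>\<^bsub>restrict_scalars A M\<^esub> y = x \<ominus>\<^bsub>M\<^esub> y"
  by (simp_all add: a_inv_def m_inv_def a_minus_def)

context artin_algebra
begin

abbreviation scalar :: "'r \<Rightarrow> 'a" where
  "scalar r \<equiv> r \<odot>\<^bsub>A\<^esub> \<one>\<^bsub>A\<^esub>"

lemma scalar_mult: "r \<in> carrier R \<Longrightarrow> x \<in> carrier A \<Longrightarrow> scalar r \<otimes>\<^bsub>A\<^esub> x = r \<odot>\<^bsub>A\<^esub> x"
  by (simp add: smult_mult_left)

lemma scalar_commute:
  "r \<in> carrier R \<Longrightarrow> x \<in> carrier A \<Longrightarrow> scalar r \<otimes>\<^bsub>A\<^esub> x = x \<otimes>\<^bsub>A\<^esub> scalar r"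
  by (simp add: smult_mult_left smult_mult_right)

lemma left_module_scalars: "left_module R A"
  by (intro left_module.intro left_module_axioms.intro)
    (auto simp: smult_l_distr smult_r_distr smult_assoc1 R.ring_axioms A.is_abelian_group)

lemma left_module_restrict_scalars:
  assumes "left_module A M"
  shows "left_module R (restrict_scalars A M)"
proof -
  interpret M: left_module A M by fact
  have "abelian_group (restrict_scalars A M)"
    by (rule abelian_groupI) (auto simp: M.M.a_ac intro!: bexI[of _ "\<ominus>\<^bsub>M\<^esub> _"] M.M.l_neg)
  moreover have "scalar (r \<otimes>\<^bsub>R\<^esub> s) \<odot>\<^bsub>M\<^esub> x = scalar r \<odot>\<^bsub>M\<^esub> (scalar s \<odot>\<^bsub>M\<^esub> x)"
    if "r \<in> carrier R" "s \<in> carrier R" "x \<in> carrier M" for r s x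
    using that by (simp add: M.smult_assoc[symmetric] smult_assoc1 scalar_mult)
  ultimately show ?thesis
    by (intro left_module.intro left_module_axioms.intro R.ring_axioms)
      (auto simp: smult_l_distr M.smult_l_distr M.smult_r_distr)
qed

lemma submodule_restrict_scalars:
  assumes "left_module A M" "submodule N A M"
  shows "submodule N R (restrict_scalars A M)"
proof -
  interpret M: left_module A M by fact
  interpret S: left_module R "restrict_scalars A M" by (rule left_module_restrict_scalars[OF assms(1)])
  show ?thesis
    by (rule S.submoduleI) (use M.submoduleD[OF assms(2)] in auto)
qed

text \<open>If \<open>T\<close> generates \<open>A\<close> over \<open>R\<close> and \<open>U\<close> generates \<open>M\<close> over \<open>A\<close>, the products \<open>t u\<close> generate \<open>M\<close>
  over \<open>R\<close>.\<close>

lemma fg_restrict_scalars: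
  assumes "left_module A M" and fg: "finitely_generated A M"
  shows "finitely_generated R (restrict_scalars A M)"
proof -
  interpret M: left_module A M by fact
  interpret S: left_module R "restrict_scalars A M" by (rule left_module_restrict_scalars[OF assms(1)])
  interpret L: left_module R A by (rule left_module_scalars)
  obtain T where T: "finite T" "T \<subseteq> carrier A" "\<And>N. submodule N R A \<Longrightarrow> T \<subseteq> N \<Longrightarrow> N = carrier A"
    using finitely_generated_over_scalars unfolding finitely_generated_def by blast
  obtain U where U: "finite U" "U \<subseteq> carrier M" "\<And>N. submodule N A M \<Longrightarrow> U \<subseteq> N \<Longrightarrow> N = carrier M"
    using fg unfolding finitely_generated_def by blast
  let ?V = "(\<lambda>(t, u). t \<odot>\<^bsub>M\<^esub> u) ` (T \<times> U)"
  have "K = carrier M" if K: "submodule K R (restrict_scalars A M)" and V: "?V \<subseteq> K" for K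
  proof -
    note Kd = S.submoduleD[OF K, simplified]
    have aU: "a \<odot>\<^bsub>M\<^esub> u \<in> K" if u: "u \<in> U" and a: "a \<in> carrier A" for a u
    proof -
      have uc: "u \<in> carrier M" using u U(2) by auto
      let ?C = "{a \<in> carrier A. a \<odot>\<^bsub>M\<^esub> u \<in> K}"
      have "submodule ?C R A"
      proof (rule L.submoduleI)
        show "r \<odot>\<^bsub>A\<^esub> a \<in> ?C"
          if "r \<in> carrier R" "a \<in> ?C" for r a
        proof -
          have "(r \<odot>\<^bsub>A\<^esub> a) \<odot>\<^bsub>M\<^esub> u = scalar r \<odot>\<^bsub>M\<^esub> (a \<odot>\<^bsub>M\<^esub> u)"
            using that uc by (simp add: M.smult_assoc[symmetric] scalar_mult)
          then show ?thesis using that Kd by auto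
        qed
      qed (use uc Kd in \<open>auto simp: M.smult_l_distr\<close>)
      moreover have "T \<subseteq> ?C" using T(2) V u by auto
      ultimately show ?thesis using T(3) a by blast
    qed
    let ?K = "{x \<in> carrier M. \<forall>a \<in> carrier A. a \<odot>\<^bsub>M\<^esub> x \<in> K}"
    have "submodule ?K A M"
      by (rule M.submoduleI) (use Kd in \<open>auto simp: M.smult_r_distr M.smult_assoc[symmetric]\<close>)
    moreover have "U \<subseteq> ?K" using aU U(2) by auto
    ultimately have "?K = carrier M" using U(3) by blast
    then have "x \<in> K" if "x \<in> carrier M" for x
      using that A.one_closed M.smult_one[OF that] by (metis (no_types, lifting) mem_Collect_eq)
    then show ?thesis using Kd(1) by blast
  qed
  moreover have "finite ?V" "?V \<subseteq> carrier M" using T U by auto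
  ultimately show ?thesis unfolding finitely_generated_def by (intro exI[of _ ?V]) auto
qed

lemma fg_finite_scalar_height:
  assumes "left_module A M" "finitely_generated A M"
  shows "finite_height R (restrict_scalars A M)"
  by (rule left_module.fg_imp_finite_height[OF left_module_restrict_scalars[OF assms(1)]
        R.finite_height_regular fg_restrict_scalars[OF assms]])

lemma bounded_height_of_scalars:
  assumes "left_module A M" "bounded_height {N. submodule N R (restrict_scalars A M)} n"
  shows "bounded_height {N. submodule N A M} n"
  by (rule bounded_height_mono[OF assms(2)]) (use submodule_restrict_scalars[OF assms(1)] in auto)

lemma fg_finite_height:
  assumes "left_module A M" "finitely_generated A M"
  shows "finite_height A M"
  using fg_finite_scalar_height[OF assms] bounded_height_of_scalars[OF assms(1)]
  unfolding finite_height_def by blast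

lemma finite_height_regular_algebra: "finite_height A (regular_module A)"
proof (rule fg_finite_height[OF A.left_module_regular])
  interpret M: left_module A "regular_module A" by (rule A.left_module_regular)
  have "N = carrier A" if "submodule N A (regular_module A)" "{\<one>\<^bsub>A\<^esub>} \<subseteq> N" for N
    using that M.submodule_smult[OF that(1), of _ "\<one>\<^bsub>A\<^esub>"] M.submodule_subset[OF that(1)] by auto
  then show "finitely_generated A (regular_module A)"
    unfolding finitely_generated_def by (intro exI[of _ "{\<one>\<^bsub>A\<^esub>}"]) auto
qed

end

section \<open>The Jacobson radical\<close>

lemma (in ring) left_ideal_jacobson: "left_ideal (jacobson_radical R) R"
proof (rule left_idealI)
  note mD = maximal_left_ideal_def[THEN iffD1, THEN conjunct1]
  show "jacobson_radical R \<subseteq> carrier R" by (auto simp: jacobson_radical_def)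
  show "\<zero> \<in> jacobson_radical R"
    using left_ideal_zero mD by (auto simp: jacobson_radical_def)
  show "x \<oplus> y \<in> jacobson_radical R" if "x \<in> jacobson_radical R" "y \<in> jacobson_radical R" for x y
    using that left_ideal_add[OF mD] by (auto simp: jacobson_radical_def)
  show "a \<otimes> x \<in> jacobson_radical R" if "a \<in> carrier R" "x \<in> jacobson_radical R" for a x
    using that left_ideal_mult[OF mD] by (auto simp: jacobson_radical_def)
qed

lemmas (in ring) jacobson_carrier = left_ideal_carrier[OF left_ideal_jacobson]
lemmas (in ring) jacobson_zero = left_ideal_zero[OF left_ideal_jacobson]
lemmas (in ring) jacobson_mult = left_ideal_mult[OF left_ideal_jacobson]

lemma (in ring) left_ideal_one_full:
  assumes "left_ideal I R" "\<one> \<in> I"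
  shows "I = carrier R"
  using left_ideal_mult[OF assms(1) _ assms(2)] left_ideal_carrier[OF assms(1)] by auto

text \<open>For \<open>x \<in> K\<close> outside \<open>N\<close> the elements \<open>a\<close> with \<open>a x \<in> N\<close> form a maximal left ideal, as no
  submodule lies strictly between \<open>N\<close> and \<open>K\<close>.  In other words \<open>J\<close> annihilates the simple module
  \<open>K/N\<close>; everything about \<open>J\<close> and composition series rests on this.\<close>

lemma (in left_module) jacobson_cover:
  assumes N: "submodule N A M" and K: "submodule K A M" and le: "N \<subseteq> K"
    and cover: "\<And>L. submodule L A M \<Longrightarrow> N \<subset> L \<Longrightarrow> L \<subseteq> K \<Longrightarrow> L = K"
    and j: "j \<in> jacobson_radical A" and x: "x \<in> K"
  shows "j \<odot>\<^bsub>M\<^esub> x \<in> N"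
proof (cases "x \<in> N")
  case True
  then show ?thesis using submodule_smult[OF N A.jacobson_carrier[OF j]] by blast
next
  case False
  have xc: "x \<in> carrier M" using submodule_carrier[OF K x] .
  let ?I = "{a \<in> carrier A. a \<odot>\<^bsub>M\<^esub> x \<in> N}"
  have I: "left_ideal ?I A" by (rule left_ideal_conductor[OF N xc])
  have "maximal_left_ideal ?I A"
    unfolding maximal_left_ideal_def
  proof (intro conjI allI impI I)
    show "?I \<noteq> carrier A" using False xc A.one_closed smult_one[OF xc] by (metis (no_types, lifting) mem_Collect_eq)
    fix L assume "left_ideal L A \<and> ?I \<subseteq> L"
    then have L: "left_ideal L A" "?I \<subseteq> L" by auto
    show "L = ?I \<or> L = carrier A"
    proof (cases "L = ?I")
      case False
      then obtain b where b: "b \<in> L" "b \<odot>\<^bsub>M\<^esub> x \<notin> N" using L A.left_ideal_carrier[OF L(1)] by auto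
      let ?C = "(\<lambda>a. a \<odot>\<^bsub>M\<^esub> x) ` L"
      have C: "submodule ?C A M" by (rule submodule_orbit[OF L(1) xc])
      have "?C \<subseteq> K" using A.left_ideal_carrier[OF L(1)] submodule_smult[OF K _ x] by auto
      moreover have "N \<subset> ?C <+>\<^bsub>M\<^esub> N" using subset_set_add[OF C N] b by auto
      ultimately have "?C <+>\<^bsub>M\<^esub> N = K"
        using cover[OF submodule_set_add[OF C N]] set_add_least[OF K _ le] by simp
      then have "x \<in> ?C <+>\<^bsub>M\<^esub> N" using x by simp
      then obtain l n where ln: "l \<in> L" "n \<in> N" "x = l \<odot>\<^bsub>M\<^esub> x \<oplus>\<^bsub>M\<^esub> n"
        unfolding mem_set_add by blast
      have lc: "l \<in> carrier A" by (rule A.left_ideal_carrier[OF L(1) ln(1)])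
      have nc: "n \<in> carrier M" by (rule submodule_carrier[OF N ln(2)])
      have "(\<one>\<^bsub>A\<^esub> \<ominus>\<^bsub>A\<^esub> l) \<odot>\<^bsub>M\<^esub> x = x \<oplus>\<^bsub>M\<^esub> \<ominus>\<^bsub>M\<^esub> (l \<odot>\<^bsub>M\<^esub> x)"
        using lc xc by (simp add: a_minus_def smult_l_distr smult_l_minus)
      also have "\<dots> = n"
        by (subst ln(3)) (use lc xc nc in \<open>simp add: M.a_ac M.r_neg1 M.r_neg2 M.r_neg\<close>)
      finally have "\<one>\<^bsub>A\<^esub> \<ominus>\<^bsub>A\<^esub> l \<in> L" using L(2) ln(2) lc by auto
      moreover have "(\<one>\<^bsub>A\<^esub> \<ominus>\<^bsub>A\<^esub> l) \<oplus>\<^bsub>A\<^esub> l = \<one>\<^bsub>A\<^esub>"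
        using lc by (simp add: a_minus_def A.a_assoc A.l_neg)
      ultimately have "\<one>\<^bsub>A\<^esub> \<in> L" using A.left_ideal_add[OF L(1) _ ln(1)] by fastforce
      then show ?thesis using A.left_ideal_one_full[OF L(1)] by simp
    qed simp
  qed
  then show ?thesis using j by (auto simp: jacobson_radical_def)
qed

text \<open>Although \<open>J\<close> is defined by left ideals, it is an ideal: a maximal left ideal \<open>I\<close> is covered by
  the ring, so \<open>jacobson_cover\<close> gives \<open>j a \<in> I\<close>.\<close>

lemma (in ring) jacobson_mult_right:
  assumes j: "j \<in> jacobson_radical R" and a: "a \<in> carrier R"
  shows "j \<otimes> a \<in> jacobson_radical R"
proof -
  interpret M: left_module R "regular_module R" by (rule left_module_regular)
  have "j \<otimes> a \<in> I" if I: "maximal_left_ideal I R" for I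
  proof -
    have "j \<odot>\<^bsub>regular_module R\<^esub> a \<in> I"
    proof (rule M.jacobson_cover[OF _ M.submodule_full _ _ j])
      show sI: "submodule I R (regular_module R)"
        using I by (simp add: maximal_left_ideal_def left_ideal_iff_submodule)
      then show "I \<subseteq> carrier (regular_module R)" by (rule M.submodule_subset)
      show "L = carrier (regular_module R)"
        if "submodule L R (regular_module R)" "I \<subset> L" "L \<subseteq> carrier (regular_module R)" for L
        using that I by (auto simp: maximal_left_ideal_def left_ideal_iff_submodule)
    qed (use a in simp)
    then show ?thesis by simp
  qed
  then show ?thesis using jacobson_carrier[OF j] a by (simp add: jacobson_radical_def)
qed

lemma composition_seriesD:
  assumes "composition_series A M n C"
  shows "C 0 = {\<zero>\<^bsub>M\<^esub>}" "C n = carrier M" "\<And>i. i \<le> n \<Longrightarrow> submodule (C i) A M"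
    "\<And>i. i < n \<Longrightarrow> C i \<subset> C (Suc i)"
    "\<And>i K. i < n \<Longrightarrow> submodule K A M \<Longrightarrow> C i \<subset> K \<Longrightarrow> K \<subseteq> C (Suc i) \<Longrightarrow> K = C (Suc i)"
  using assms unfolding composition_series_def by (simp_all add: psubset_eq) metis

lemma (in left_module) composition_series_jacobson:
  assumes C: "composition_series A M n C" and i: "i \<le> n" and x: "x \<in> C i"
    and j: "j \<in> jacobson_radical A"
  shows "j \<odot>\<^bsub>M\<^esub> x \<in> C (i - 1)"
proof (cases i)
  case 0
  then show ?thesis using x A.jacobson_carrier[OF j] composition_seriesD(1)[OF C] by simp
next
  case (Suc k)
  then have k: "k < n" using i by simp
  have "j \<odot>\<^bsub>M\<^esub> x \<in> C k"
    by (rule jacobson_cover[OF composition_seriesD(3)[OF C] composition_seriesD(3)[OF C, of "Suc k"] _ _ j])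
      (use k x Suc composition_seriesD(4,5)[OF C k] in auto)
  then show ?thesis using Suc by simp
qed

lemma (in ring) ideal_power_carrier: "ideal_power R (jacobson_radical R) n \<subseteq> carrier R"
proof (induction n)
  case (Suc n)
  have "a \<in> carrier R" if "a \<in> jacobson_radical R \<cdot> ideal_power R (jacobson_radical R) n" for a
    using that Suc jacobson_carrier by (induction rule: ideal_prod.induct) auto
  then show ?case by auto
qed simp

lemma (in left_module) composition_series_radical_power:
  assumes C: "composition_series A M n C"
  shows "i \<le> n \<Longrightarrow> a \<in> ideal_power A (jacobson_radical A) k \<Longrightarrow> x \<in> C i \<Longrightarrow> a \<odot>\<^bsub>M\<^esub> x \<in> C (i - k)"
proof (induction k arbitrary: a)
  case 0
  then show ?case using submodule_smult[OF composition_seriesD(3)[OF C]] by simp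
next
  case (Suc k)
  have xc: "x \<in> carrier M"
    using submodule_carrier[OF composition_seriesD(3)[OF C Suc.prems(1)] Suc.prems(3)] .
  have S: "submodule (C (i - Suc k)) A M" using composition_seriesD(3)[OF C] Suc.prems(1) by simp
  have "a \<in> jacobson_radical A \<cdot>\<^bsub>A\<^esub> ideal_power A (jacobson_radical A) k" using Suc.prems(2) by simp
  then have "a \<in> carrier A \<and> a \<odot>\<^bsub>M\<^esub> x \<in> C (i - Suc k)"
  proof (induction rule: ideal_prod.induct)
    case (prod j b)
    have b: "b \<in> carrier A" using A.ideal_power_carrier prod(2) by blast
    have "b \<odot>\<^bsub>M\<^esub> x \<in> C (i - k)" using Suc prod(2) by blast
    then have "j \<odot>\<^bsub>M\<^esub> (b \<odot>\<^bsub>M\<^esub> x) \<in> C (i - k - 1)"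
      using composition_series_jacobson[OF C _ _ prod(1), of "i - k"] Suc.prems(1) by simp
    then show ?case using b xc A.jacobson_carrier[OF prod(1)] by (simp add: smult_assoc)
  next
    case (sum a b)
    then show ?case using submodule_add[OF S] xc by (simp add: smult_l_distr)
  qed
  then show ?case by simp
qed

text \<open>The products of as many radical elements as a composition series of the regular module has
  steps are zero.  Therefore \<open>loewy_length\<close> is the least element of a nonempty set of numbers, and
  its value says something about \<open>J\<close>.\<close>

lemma (in ring) jacobson_nilpotent:
  assumes "finite_length R (regular_module R)"
  obtains n where "ideal_power R (jacobson_radical R) n = {\<zero>}"
proof -
  interpret M: left_module R "regular_module R" by (rule left_module_regular)
  obtain n C where C: "composition_series R (regular_module R) n C"
    using assms unfolding finite_length_def by blast
  have "a = \<zero>" if a: "a \<in> ideal_power R (jacobson_radical R) n" for a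
  proof -
    have "a \<otimes> \<one> = \<zero>"
      using M.composition_series_radical_power[OF C order_refl a, of \<one>] composition_seriesD(1,2)[OF C] by simp
    then show ?thesis using a ideal_power_carrier by fastforce
  qed
  moreover have "\<zero> \<in> ideal_power R (jacobson_radical R) k" for k
  proof (induction k)
    case (Suc k)
    show ?case using ideal_prod.prod[OF jacobson_zero Suc, of R] by simp
  qed simp
  ultimately show ?thesis using that[of n] by blast
qed

lemma (in ring) loewy_length_eq_2_iff:
  assumes "finite_length R (regular_module R)"
  shows "loewy_length R = 2 \<longleftrightarrow>
    jacobson_radical R \<noteq> {\<zero>} \<and> (\<forall>i \<in> jacobson_radical R. \<forall>j \<in> jacobson_radical R. i \<otimes> j = \<zero>)"
    (is "_ \<longleftrightarrow> ?J \<noteq> _ \<and> ?z")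
proof
  let ?P = "\<lambda>n. ideal_power R ?J n = {\<zero>}"
  have ex: "\<exists>n. ?P n" using jacobson_nilpotent[OF assms] by metis
  have prod_zero: "I \<cdot> K = {\<zero>}"
    if "\<And>i k. i \<in> I \<Longrightarrow> k \<in> K \<Longrightarrow> i \<otimes> k = \<zero>" "\<zero> \<in> I" "\<zero> \<in> K" for I K
  proof -
    have "a = \<zero>" if "a \<in> I \<cdot> K" for a
      using that by (induction rule: ideal_prod.induct) (auto simp: \<open>\<And>i k. i \<in> I \<Longrightarrow> k \<in> K \<Longrightarrow> i \<otimes> k = \<zero>\<close>)
    moreover have "\<zero> \<in> I \<cdot> K" using ideal_prod.prod[OF that(2,3), of R] by simp
    ultimately show ?thesis by blast
  qed
  have one: "?P (Suc 0)" if "?J = {\<zero>}"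
    using prod_zero[of ?J "carrier R"] that by simp
  {
    assume "loewy_length R = 2"
    then have L: "(LEAST n. ?P n) = 2" by (simp add: loewy_length_def)
    have "?P 2" using LeastI_ex[OF ex] by (simp only: L)
    then have P2: "?J \<cdot> (?J \<cdot> carrier R) = {\<zero>}" by (simp add: numeral_2_eq_2)
    have ?z
    proof (intro ballI)
      fix i j assume ij: "i \<in> ?J" "j \<in> ?J"
      have "i \<otimes> (j \<otimes> \<one>) \<in> ?J \<cdot> (?J \<cdot> carrier R)" by (intro ideal_prod.prod ij one_closed)
      then show "i \<otimes> j = \<zero>" using P2 jacobson_carrier[OF ij(2)] by simp
    qed
    moreover have "?J \<noteq> {\<zero>}"
    proof
      assume "?J = {\<zero>}"
      then have "(LEAST n. ?P n) \<le> Suc 0" using one by (intro Least_le)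
      then show False using L by simp
    qed
    ultimately show "?J \<noteq> {\<zero>} \<and> ?z" by blast
  }
  assume J: "?J \<noteq> {\<zero>} \<and> ?z"
  then obtain j where j: "j \<in> ?J" "j \<noteq> \<zero>" using jacobson_zero by blast
  have P1: "j \<in> ?J \<cdot> carrier R"
    using ideal_prod.prod[OF j(1) one_closed, of R] jacobson_carrier[OF j(1)] by simp
  have "?J \<cdot> carrier R \<subseteq> ?J"
  proof
    fix a assume "a \<in> ?J \<cdot> carrier R"
    then show "a \<in> ?J"
      by (induction rule: ideal_prod.induct)
        (auto intro: jacobson_mult_right left_ideal_add[OF left_ideal_jacobson])
  qed
  moreover have "\<zero> \<in> ?J \<cdot> carrier R" using ideal_prod.prod[OF jacobson_zero zero_closed, of R] by simp
  ultimately have "?J \<cdot> (?J \<cdot> carrier R) = {\<zero>}"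
    using J by (intro prod_zero jacobson_zero) auto
  then have "?P 2" by (simp add: numeral_2_eq_2)
  moreover have "2 \<le> y" if "?P y" for y
  proof (rule ccontr)
    assume "\<not> 2 \<le> y"
    then have "y = 0 \<or> y = Suc 0" by auto
    then have "j \<in> ideal_power R ?J y" using P1 jacobson_carrier[OF j(1)] by (elim disjE) simp_all
    then have "j \<in> {\<zero>}" by (simp only: that)
    then show False using j(2) by simp
  qed
  ultimately show "loewy_length R = 2" unfolding loewy_length_def by (rule Least_equality)
qed

text \<open>This is the semisimplicity of the ring modulo its radical: \<open>K\<close> is a complement of \<open>I\<close> up to
  \<open>J\<close>.  Take \<open>K\<close> minimal with \<open>I + K = R\<close>.  If \<open>I \<inter> K\<close> were not contained in some maximal left ideal
  \<open>m\<close>, then \<open>(I \<inter> K) + m = R\<close>, and \<open>K \<inter> m\<close> would be a smaller choice by the modular law.\<close>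

lemma (in ring) left_ideal_supplement:
  assumes fh: "finite_height R (regular_module R)" and I: "left_ideal I R"
  obtains K \<alpha> \<beta> where "left_ideal K R" "\<alpha> \<in> I" "\<beta> \<in> K" "\<one> = \<alpha> \<oplus> \<beta>" "I \<inter> K \<subseteq> jacobson_radical R"
proof -
  interpret M: left_module R "regular_module R" by (rule left_module_regular)
  let ?F = "{K. left_ideal K R \<and> (\<exists>\<alpha> \<in> I. \<exists>\<beta> \<in> K. \<one> = \<alpha> \<oplus> \<beta>)}"
  obtain n where "bounded_height {K. left_ideal K R} n"
    using fh unfolding finite_height_def left_ideal_iff_submodule by blast
  then have "bounded_height ?F n" by (rule bounded_height_mono) auto
  moreover have "carrier R \<in> ?F"
  proof -
    have "\<one> = \<zero> \<oplus> \<one>" by simp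
    then show ?thesis using left_ideal_full left_ideal_zero[OF I] one_closed by blast
  qed
  ultimately obtain K where K: "K \<in> ?F" and min: "\<And>L. L \<in> ?F \<Longrightarrow> L \<subseteq> K \<Longrightarrow> L = K"
    by (rule bounded_height_minimal) blast
  then obtain \<alpha> \<beta> where K': "left_ideal K R" and ab: "\<alpha> \<in> I" "\<beta> \<in> K" "\<one> = \<alpha> \<oplus> \<beta>" by auto
  note Ic = left_ideal_carrier[OF I] and Kc = left_ideal_carrier[OF K']
  note sI = I[unfolded left_ideal_iff_submodule] and sK = K'[unfolded left_ideal_iff_submodule]
  have in_max: "u \<in> m" if u: "u \<in> I \<inter> K" and m: "maximal_left_ideal m R" for u m
  proof (rule ccontr)
    assume um: "u \<notin> m"
    have m': "left_ideal m R" using m by (simp add: maximal_left_ideal_def)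
    note sm = m'[unfolded left_ideal_iff_submodule]
    let ?IK = "I \<inter> K"
    note sIK = M.submodule_Int[OF sI sK]
    have li: "left_ideal (?IK <+>\<^bsub>regular_module R\<^esub> m) R"
      unfolding left_ideal_iff_submodule by (rule M.submodule_set_add[OF sIK sm])
    note le = M.subset_set_add[OF sIK sm]
    have "?IK <+>\<^bsub>regular_module R\<^esub> m \<noteq> m" using le u um by blast
    then have full: "?IK <+>\<^bsub>regular_module R\<^esub> m = carrier R"
      using m[unfolded maximal_left_ideal_def, THEN conjunct2, THEN conjunct2, rule_format,
          OF conjI[OF li le(2)]] by simp
    have "\<beta> \<in> ?IK <+>\<^bsub>regular_module R\<^esub> m" using full Kc[OF ab(2)] by simp
    then obtain v w where vw: "v \<in> I" "v \<in> K" "w \<in> m" "\<beta> = v \<oplus> w"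
      by (auto simp: M.mem_set_add)
    have wc: "w \<in> carrier R" by (rule left_ideal_carrier[OF m' vw(3)])
    have "w \<in> K" using M.submodule_add_cancel'[OF sK, of v w] vw ab(2) wc by simp
    moreover have "\<one> = (\<alpha> \<oplus> v) \<oplus> w" using ab vw Ic wc by (simp add: a_assoc)
    moreover have "\<alpha> \<oplus> v \<in> I" by (rule left_ideal_add[OF I ab(1) vw(1)])
    moreover have "left_ideal (K \<inter> m) R"
      unfolding left_ideal_iff_submodule by (rule M.submodule_Int[OF sK sm])
    ultimately have "K \<inter> m \<in> ?F" using vw(3) by blast
    then have "K \<inter> m = K" by (rule min) simp
    then show False using u um by blast
  qed
  have "u \<in> jacobson_radical R" if "u \<in> I \<inter> K" for u
    unfolding jacobson_radical_def using in_max[OF that] Ic that by simp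
  then have "I \<inter> K \<subseteq> jacobson_radical R" by (rule subsetI)
  then show ?thesis by (rule that[OF K' ab])
qed

text \<open>The preceding lemma transported to modules: apply it to the left ideal of all \<open>a\<close> with
  \<open>a x \<in> N\<close>, and let the resulting supplement act on \<open>x\<close>.\<close>

lemma (in left_module) supplement_mod_radical:
  assumes fh: "finite_height A (regular_module A)"
    and N: "submodule N A M" and x: "x \<in> carrier M" "x \<notin> N"
  obtains K where "submodule K A M" "\<not> K \<subseteq> N"
    "K \<inter> N \<subseteq> (\<lambda>a. a \<odot>\<^bsub>M\<^esub> x) ` jacobson_radical A"
proof -
  let ?I = "{a \<in> carrier A. a \<odot>\<^bsub>M\<^esub> x \<in> N}"
  obtain B \<alpha> \<beta> where B: "left_ideal B A" and ab: "\<alpha> \<in> ?I" "\<beta> \<in> B" "\<one>\<^bsub>A\<^esub> = \<alpha> \<oplus>\<^bsub>A\<^esub> \<beta>"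
    and J: "?I \<inter> B \<subseteq> jacobson_radical A"
    by (rule A.left_ideal_supplement[OF fh left_ideal_conductor[OF N x(1)]])
  note Bc = A.left_ideal_carrier[OF B]
  let ?K = "(\<lambda>a. a \<odot>\<^bsub>M\<^esub> x) ` B"
  have "x = (\<alpha> \<oplus>\<^bsub>A\<^esub> \<beta>) \<odot>\<^bsub>M\<^esub> x" using x ab(3)[symmetric] by simp
  also have "\<dots> = \<alpha> \<odot>\<^bsub>M\<^esub> x \<oplus>\<^bsub>M\<^esub> \<beta> \<odot>\<^bsub>M\<^esub> x" using x ab Bc by (simp add: smult_l_distr)
  finally have "\<beta> \<odot>\<^bsub>M\<^esub> x \<notin> N" using x(2) ab(1) submodule_add[OF N, of "\<alpha> \<odot>\<^bsub>M\<^esub> x" "\<beta> \<odot>\<^bsub>M\<^esub> x"] by auto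
  then have "\<not> ?K \<subseteq> N" using ab(2) by blast
  moreover have "?K \<inter> N \<subseteq> (\<lambda>a. a \<odot>\<^bsub>M\<^esub> x) ` jacobson_radical A" using J Bc by auto
  ultimately show ?thesis using that[OF submodule_orbit[OF B x(1)]] by blast
qed

text \<open>If \<open>J M = 0\<close>, the submodule that \<open>supplement_mod_radical\<close> yields for \<open>N + K\<close> and an element
  outside meets \<open>N + K\<close> trivially.  It could be added to \<open>K\<close>, so if \<open>K\<close> is maximal with
  \<open>N \<inter> K = 0\<close>, then \<open>N + K = M\<close>.\<close>

lemma (in left_module) complement_if_radical_annihilates:
  assumes fhA: "finite_height A (regular_module A)" and fhM: "finite_height A M"
    and ann: "\<And>j x. j \<in> jacobson_radical A \<Longrightarrow> x \<in> carrier M \<Longrightarrow> j \<odot>\<^bsub>M\<^esub> x = \<zero>\<^bsub>M\<^esub>"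
    and N: "submodule N A M"
  obtains K where "submodule K A M" "N <+>\<^bsub>M\<^esub> K = carrier M" "N \<inter> K = {\<zero>\<^bsub>M\<^esub>}"
proof -
  let ?F = "{K. submodule K A M \<and> N \<inter> K = {\<zero>\<^bsub>M\<^esub>}}"
  obtain n where "bounded_height {K. submodule K A M} n" using fhM unfolding finite_height_def by blast
  then have "bounded_height ?F n" by (rule bounded_height_mono) auto
  moreover have "{\<zero>\<^bsub>M\<^esub>} \<in> ?F" using submodule_trivial submodule_zero[OF N] by auto
  ultimately obtain K where KF: "K \<in> ?F" and max: "\<And>L. L \<in> ?F \<Longrightarrow> K \<subseteq> L \<Longrightarrow> L = K"
    by (rule bounded_height_maximal) blast
  then have K: "submodule K A M" and NK: "N \<inter> K = {\<zero>\<^bsub>M\<^esub>}" by auto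
  note s = submodule_set_add[OF N K]
  have "x \<in> N <+>\<^bsub>M\<^esub> K" if x: "x \<in> carrier M" for x
  proof (rule ccontr)
    assume nx: "x \<notin> N <+>\<^bsub>M\<^esub> K"
    obtain L where L: "submodule L A M" "\<not> L \<subseteq> N <+>\<^bsub>M\<^esub> K"
      "L \<inter> (N <+>\<^bsub>M\<^esub> K) \<subseteq> (\<lambda>a. a \<odot>\<^bsub>M\<^esub> x) ` jacobson_radical A"
      by (rule supplement_mod_radical[OF fhA s x nx])
    have L0: "y = \<zero>\<^bsub>M\<^esub>" if "y \<in> L" "y \<in> N <+>\<^bsub>M\<^esub> K" for y
      using L(3) that ann[OF _ x] by blast
    have "y = \<zero>\<^bsub>M\<^esub>" if y: "y \<in> N" "y \<in> K <+>\<^bsub>M\<^esub> L" for y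
    proof -
      obtain k l where kl: "k \<in> K" "l \<in> L" "y = k \<oplus>\<^bsub>M\<^esub> l" using y(2) unfolding mem_set_add by blast
      have lc: "l \<in> carrier M" by (rule submodule_carrier[OF L(1) kl(2)])
      have kc: "k \<in> carrier M" by (rule submodule_carrier[OF K kl(1)])
      have "l \<in> N <+>\<^bsub>M\<^esub> K"
        using submodule_add_cancel'[OF s, of k l] kl y(1) subset_set_add[OF N K] lc by auto
      then have "l = \<zero>\<^bsub>M\<^esub>" using L0 kl(2) by blast
      then have "y \<in> N \<inter> K" using y(1) kl kc by simp
      then show ?thesis using NK by blast
    qed
    then have "N \<inter> (K <+>\<^bsub>M\<^esub> L) \<subseteq> {\<zero>\<^bsub>M\<^esub>}" by blast
    then have "N \<inter> (K <+>\<^bsub>M\<^esub> L) = {\<zero>\<^bsub>M\<^esub>}"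
      using submodule_zero[OF submodule_Int[OF N submodule_set_add[OF K L(1)]]] by blast
    then have "K <+>\<^bsub>M\<^esub> L \<in> ?F" using submodule_set_add[OF K L(1)] by simp
    then have "K <+>\<^bsub>M\<^esub> L = K" by (rule max[OF _ subset_set_add(1)[OF K L(1)]])
    then have "L \<subseteq> K" using subset_set_add(2)[OF K L(1)] by simp
    then show False using L(2) subset_set_add(2)[OF N K] by blast
  qed
  then have "N <+>\<^bsub>M\<^esub> K = carrier M" using submodule_subset[OF s] by blast
  then show ?thesis using that[OF K _ NK] by blast
qed

lemma (in left_module) indecomposable_simple_if_radical_annihilates:
  assumes fhA: "finite_height A (regular_module A)" and fhM: "finite_height A M"
    and ann: "\<And>j x. j \<in> jacobson_radical A \<Longrightarrow> x \<in> carrier M \<Longrightarrow> j \<odot>\<^bsub>M\<^esub> x = \<zero>\<^bsub>M\<^esub>"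
    and ind: "indecomposable A M" and N: "submodule N A M"
  shows "N = {\<zero>\<^bsub>M\<^esub>} \<or> N = carrier M"
proof -
  obtain K where K: "submodule K A M" "N <+>\<^bsub>M\<^esub> K = carrier M" "N \<inter> K = {\<zero>\<^bsub>M\<^esub>}"
    by (rule complement_if_radical_annihilates[OF fhA fhM ann N])
  have "N = {\<zero>\<^bsub>M\<^esub>} \<or> K = {\<zero>\<^bsub>M\<^esub>}" by (rule indecomposableD[OF ind N K])
  moreover have "N = carrier M" if "K = {\<zero>\<^bsub>M\<^esub>}"
  proof -
    have "N <+>\<^bsub>M\<^esub> K \<subseteq> N" using set_add_least[OF N order_refl, of K] that submodule_zero[OF N] by simp
    then show ?thesis using K(2) submodule_subset[OF N] by simp
  qed
  ultimately show ?thesis by blast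
qed

text \<open>If \<open>L\<close> left out an element \<open>x\<close>, there would be a submodule \<open>K\<close> outside \<open>L\<close> with
  \<open>K \<inter> L \<subseteq> J x\<close>.  By uniseriality \<open>L \<subseteq> K\<close>, hence \<open>L \<subseteq> J x\<close> and \<open>J L \<subseteq> J\<^sup>2 x = 0\<close>.\<close>

lemma (in left_module) uniserial_submodule_full:
  assumes fhA: "finite_height A (regular_module A)" and uni: "uniserial A M"
    and ann: "\<And>i j x. i \<in> jacobson_radical A \<Longrightarrow> j \<in> jacobson_radical A \<Longrightarrow> x \<in> carrier M \<Longrightarrow>
      i \<odot>\<^bsub>M\<^esub> (j \<odot>\<^bsub>M\<^esub> x) = \<zero>\<^bsub>M\<^esub>"
    and L: "submodule L A M" and j: "j \<in> jacobson_radical A" "y \<in> L" "j \<odot>\<^bsub>M\<^esub> y \<noteq> \<zero>\<^bsub>M\<^esub>"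
  shows "L = carrier M"
proof (rule ccontr)
  assume "L \<noteq> carrier M"
  then obtain x where x: "x \<in> carrier M" "x \<notin> L" using submodule_subset[OF L] by blast
  obtain K where K: "submodule K A M" "\<not> K \<subseteq> L" "K \<inter> L \<subseteq> (\<lambda>a. a \<odot>\<^bsub>M\<^esub> x) ` jacobson_radical A"
    by (rule supplement_mod_radical[OF fhA L x])
  have "L \<subseteq> K" using uni K(1,2) L unfolding uniserial_def by blast
  then obtain i where "i \<in> jacobson_radical A" "y = i \<odot>\<^bsub>M\<^esub> x" using K(3) j(2) by blast
  then show False using ann[OF j(1) _ x(1)] j(3) by simp
qed

section \<open>Modules of length at most two\<close>

lemma composition_length_le: "composition_series A M n C \<Longrightarrow> composition_length A M \<le> n"
  unfolding composition_length_def by (rule Least_le) blast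

lemma composition_length_series:
  assumes "finite_length A M"
  obtains C where "composition_series A M (composition_length A M) C"
  using assms LeastI_ex[of "\<lambda>n. \<exists>C. composition_series A M n C"]
  unfolding finite_length_def composition_length_def by blast

lemma (in left_module) composition_length_simple:
  assumes "carrier M \<noteq> {\<zero>\<^bsub>M\<^esub>}" "\<And>N. submodule N A M \<Longrightarrow> N = {\<zero>\<^bsub>M\<^esub>} \<or> N = carrier M"
  shows "composition_length A M \<le> 1"
proof (rule composition_length_le)
  have "{\<zero>\<^bsub>M\<^esub>} \<subset> carrier M" using assms(1) by auto
  then show "composition_series A M 1 (\<lambda>i. if i = 0 then {\<zero>\<^bsub>M\<^esub>} else carrier M)"
    unfolding composition_series_def using submodule_full submodule_trivial assms(2) by auto
qed

lemma (in left_module) composition_length_two: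
  assumes S: "submodule S A M" "S \<noteq> {\<zero>\<^bsub>M\<^esub>}" "S \<noteq> carrier M"
    and N: "\<And>N. submodule N A M \<Longrightarrow> N = {\<zero>\<^bsub>M\<^esub>} \<or> N = S \<or> N = carrier M"
  shows "composition_length A M \<le> 2"
proof (rule composition_length_le)
  let ?C = "\<lambda>i::nat. if i = 0 then {\<zero>\<^bsub>M\<^esub>} else if i = 1 then S else carrier M"
  have lt: "{\<zero>\<^bsub>M\<^esub>} \<subset> S" "S \<subset> carrier M" using S submodule_zero[OF S(1)] submodule_subset[OF S(1)] by auto
  show "composition_series A M 2 ?C"
    unfolding composition_series_def
  proof (intro conjI allI impI)
    fix i :: nat assume "i < 2"
    then consider "i = 0" | "i = 1" by linarith
    then show "?C i \<subset> ?C (Suc i)" "\<not> (\<exists>K. submodule K A M \<and> ?C i \<subset> K \<and> K \<subset> ?C (Suc i))"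
      using lt N by (cases; fastforce)+
  qed (use S submodule_full submodule_trivial in auto)
qed

text \<open>Let \<open>S\<close> be the middle term of a composition series of length two.  A submodule other than \<open>S\<close>,
  zero and \<open>M\<close> would be a complement of \<open>S\<close>.\<close>

lemma (in left_module) uniserial_if_length_two:
  assumes ind: "indecomposable A M" and C: "composition_series A M n C" and n: "n \<le> 2"
  shows "uniserial A M"
proof -
  note c = composition_seriesD[OF C]
  have "\<exists>S. \<forall>K. submodule K A M \<longrightarrow> K = {\<zero>\<^bsub>M\<^esub>} \<or> K = S \<or> K = carrier M"
  proof -
    consider "n = 0" | "n = 1" | "n = 2" using n by linarith
    then show ?thesis
    proof cases
      case 1
      then show ?thesis using c(1,2) ind unfolding indecomposable_def by simp
    next
      case 2
      have "K = {\<zero>\<^bsub>M\<^esub>} \<or> K = carrier M" if "submodule K A M" for K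
        using c(5)[of 0 K] c(1,2) 2 that submodule_zero[OF that] submodule_subset[OF that] by auto
      then show ?thesis by blast
    next
      case 3
      have S: "submodule (C 1) A M" using c(3) 3 by simp
      have lt: "{\<zero>\<^bsub>M\<^esub>} \<subset> C 1" "C 1 \<subset> carrier M"
        using c(4)[of 0] c(4)[of 1] c(1,2) 3 by (simp_all add: numeral_2_eq_2)
      have low: "K = C 1" if "submodule K A M" "{\<zero>\<^bsub>M\<^esub>} \<subset> K" "K \<subseteq> C 1" for K
        using c(5)[of 0 K] c(1) 3 that by simp
      have up: "K = carrier M" if "submodule K A M" "C 1 \<subset> K" for K
        using c(5)[of 1 K] c(2) 3 that submodule_subset[OF that(1)] by (simp add: numeral_2_eq_2)
      have "K = {\<zero>\<^bsub>M\<^esub>} \<or> K = C 1 \<or> K = carrier M" if K: "submodule K A M" for K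
      proof (rule ccontr)
        assume *: "\<not> ?thesis"
        have K0: "{\<zero>\<^bsub>M\<^esub>} \<subset> K" using * submodule_zero[OF K] by auto
        have "\<not> C 1 \<subseteq> K" using up[OF K] * by auto
        then have int: "K \<inter> C 1 = {\<zero>\<^bsub>M\<^esub>}"
          using low[OF submodule_Int[OF K S]] submodule_zero[OF submodule_Int[OF K S]] by blast
        have "\<not> K \<subseteq> C 1" using low[OF K K0] * by auto
        then have "C 1 \<subset> K <+>\<^bsub>M\<^esub> C 1" using subset_set_add[OF K S] by blast
        then have "K <+>\<^bsub>M\<^esub> C 1 = carrier M" by (rule up[OF submodule_set_add[OF K S]])
        then show False using indecomposableD[OF ind K S _ int] K0 lt(1) by auto
      qed
      then show ?thesis by blast
    qed
  qed
  then obtain S where S: "\<And>K. submodule K A M \<Longrightarrow> K = {\<zero>\<^bsub>M\<^esub>} \<or> K = S \<or> K = carrier M" by blast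
  show ?thesis
    unfolding uniserial_def
  proof (intro allI impI)
    fix N K assume *: "submodule N A M \<and> submodule K A M"
    then show "N \<subseteq> K \<or> K \<subseteq> N"
      using S[of N] S[of K] submodule_zero[of N] submodule_zero[of K] submodule_subset[of N]
        submodule_subset[of K] by auto
  qed
qed

section \<open>The indecomposable modules detect the elements of the algebra\<close>

lemma (in left_module) list_module_copy:
  assumes "finitely_generated A M"
  obtains N :: "'a list_module" and h where "left_module_map A M N h" "bij_betw h (carrier M) (carrier N)"
  using fg_left_module_iso_list_module[OF assms] left_module_mapI[OF left_module_axioms] by blast

lemma (in left_module) finite_height_submodule:
  assumes "finite_height A M" "submodule N A M"
  shows "finite_height A (M\<lparr>carrier := N\<rparr>)"
  using assms(1) unfolding finite_height_def submodule_submodule_iff[OF assms(2)]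
  by (auto elim!: bounded_height_mono)

text \<open>If \<open>t \<noteq> 0\<close>, then \<open>t\<close> does not annihilate the regular module.  A submodule \<open>N\<close> that is minimal
  among those not annihilated by \<open>t\<close> is indecomposable, since \<open>t\<close> cannot annihilate both parts of a
  decomposition.\<close>

lemma (in artin_algebra) eq_zero_if_annihilates_indecomposables:
  assumes t: "t \<in> carrier A"
    and ann: "\<And>(M :: 'a list_module) x. left_module A M \<Longrightarrow> finite_length A M \<Longrightarrow>
      indecomposable A M \<Longrightarrow> x \<in> carrier M \<Longrightarrow> t \<odot>\<^bsub>M\<^esub> x = \<zero>\<^bsub>M\<^esub>"
  shows "t = \<zero>\<^bsub>A\<^esub>"
proof (rule ccontr)
  let ?A = "regular_module A"
  interpret M: left_module A ?A by (rule A.left_module_regular)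
  let ?F = "{N. submodule N A ?A \<and> (\<exists>x \<in> N. t \<otimes>\<^bsub>A\<^esub> x \<noteq> \<zero>\<^bsub>A\<^esub>)}"
  assume "t \<noteq> \<zero>\<^bsub>A\<^esub>"
  then have top: "carrier A \<in> ?F" using M.submodule_full t by (auto intro!: bexI[of _ "\<one>\<^bsub>A\<^esub>"])
  obtain n where "bounded_height {N. submodule N A ?A} n"
    using finite_height_regular_algebra unfolding finite_height_def by blast
  then have "bounded_height ?F n" by (rule bounded_height_mono) auto
  then obtain N where NF: "N \<in> ?F" and min: "\<And>K. K \<in> ?F \<Longrightarrow> K \<subseteq> N \<Longrightarrow> K = N"
    using top by (rule bounded_height_minimal) blast
  then have N: "submodule N A ?A" by simp
  obtain x where x: "x \<in> N" "t \<otimes>\<^bsub>A\<^esub> x \<noteq> \<zero>\<^bsub>A\<^esub>" using NF by blast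
  let ?N = "?A\<lparr>carrier := N\<rparr>"
  interpret N: left_module A ?N by (rule M.left_module_submodule[OF N])
  have fh: "finite_height A ?N" by (rule M.finite_height_submodule[OF finite_height_regular_algebra N])
  have ind: "indecomposable A ?N"
    unfolding indecomposable_def
  proof (intro conjI allI impI)
    show "carrier ?N \<noteq> {\<zero>\<^bsub>?N\<^esub>}" using x t by auto
    fix K L
    assume KL: "submodule K A ?N \<and> submodule L A ?N \<and> K <+>\<^bsub>?N\<^esub> L = carrier ?N \<and> K \<inter> L = {\<zero>\<^bsub>?N\<^esub>}"
    then have K: "submodule K A ?A" "K \<subseteq> N" and L: "submodule L A ?A" "L \<subseteq> N"
      using M.submodule_submodule_iff[OF N] by auto
    have "x \<in> K <+>\<^bsub>?N\<^esub> L" using KL x(1) by simp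
    then obtain k l where kl: "k \<in> K" "l \<in> L" "x = k \<oplus>\<^bsub>A\<^esub> l" by (auto simp: N.mem_set_add)
    have "k \<in> carrier A" "l \<in> carrier A" using kl M.submodule_carrier[OF K(1)] M.submodule_carrier[OF L(1)] by auto
    then have "t \<otimes>\<^bsub>A\<^esub> k \<noteq> \<zero>\<^bsub>A\<^esub> \<or> t \<otimes>\<^bsub>A\<^esub> l \<noteq> \<zero>\<^bsub>A\<^esub>" using x(2) kl(3) t by (auto simp: A.r_distr)
    then have "K \<in> ?F \<or> L \<in> ?F" using K(1) L(1) kl by blast
    then have "K = N \<or> L = N" using min K(2) L(2) by blast
    then show "K = {\<zero>\<^bsub>?N\<^esub>} \<or> L = {\<zero>\<^bsub>?N\<^esub>}" using KL K(2) L(2) by (auto simp: Int_absorb1 Int_absorb2)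
  qed
  have fg: "finitely_generated A ?N"
    by (rule N.finite_length_imp_fg[OF N.finite_height_imp_finite_length[OF fh]])
  obtain N' :: "'a list_module" and h where h: "left_module_map A ?N N' h"
    and bij: "bij_betw h (carrier ?N) (carrier N')"
    by (rule N.list_module_copy[OF fg])
  interpret h: left_module_map A ?N N' h by (rule h)
  interpret g: left_module_map A N' ?N "inv_into (carrier ?N) h" by (rule h.inverse_map[OF bij])
  have "finite_height A N'"
    by (rule g.finite_height_inj[OF _ fh]) (use bij_betw_inv_into[OF bij] in \<open>simp add: bij_betw_def\<close>)
  then have "t \<odot>\<^bsub>N'\<^esub> h x = \<zero>\<^bsub>N'\<^esub>"
    using ann[OF h.N.left_module_axioms h.N.finite_height_imp_finite_length h.indecomposable_iso[OF ind bij]]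
      h.hom_closed[of x] x(1) by simp
  then have "h (t \<odot>\<^bsub>?N\<^esub> x) = \<zero>\<^bsub>N'\<^esub>" using h.hom_smult[OF t, of x] x(1) by simp
  then have "t \<odot>\<^bsub>?N\<^esub> x = \<zero>\<^bsub>?N\<^esub>"
    using h.inj_zero[of "t \<odot>\<^bsub>?N\<^esub> x"] bij N.smult_closed[OF t, of x] x(1) by (simp add: bij_betw_def)
  then show False using x(2) by simp
qed

section \<open>Algebras of representation bound two\<close>

text \<open>A supremum of natural numbers that equals two is attained, which is expressed by negating the
  bound one.\<close>

lemma representation_bound_eq_2_iff:
  "representation_bound A = 2 \<longleftrightarrow>
    (\<forall>M :: 'a list_module. left_module A M \<and> finite_length A M \<and> indecomposable A M \<longrightarrow>
      composition_length A M \<le> 2) \<and>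
    \<not> (\<forall>M :: 'a list_module. left_module A M \<and> finite_length A M \<and> indecomposable A M \<longrightarrow>
      composition_length A M \<le> 1)"
  for A :: "('a, 'b) ring_scheme"
proof -
  have le: "representation_bound A \<le> enat n \<longleftrightarrow>
    (\<forall>M :: 'a list_module. left_module A M \<and> finite_length A M \<and> indecomposable A M \<longrightarrow>
      composition_length A M \<le> n)" for n
    by (auto simp: representation_bound_def SUP_le_iff)
  have "e = 2 \<longleftrightarrow> e \<le> enat 2 \<and> \<not> e \<le> enat 1" for e :: enat
    by (cases e) (auto simp: numeral_eq_enat)
  then show ?thesis by (simp only: le)
qed

lemma (in artin_algebra) nakayama_if_length_at_most_two:
  assumes two: "\<And>M :: 'a list_module. left_module A M \<Longrightarrow> finite_length A M \<Longrightarrow> indecomposable A M \<Longrightarrow>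
      composition_length A M \<le> 2"
  shows "nakayama_algebra A"
  unfolding nakayama_algebra_def
proof (intro allI impI)
  fix M :: "'a list_module"
  assume M: "indecomposable A M \<and> (projective_in_mod A M \<or> injective_in_mod A M)"
  then have "in_mod A M" by (auto simp: projective_in_mod_def injective_in_mod_def)
  then have lm: "left_module A M" and fg: "finitely_generated A M" by (auto simp: in_mod_def)
  interpret M: left_module A M by (rule lm)
  have fl: "finite_length A M"
    by (rule M.finite_height_imp_finite_length[OF fg_finite_height[OF lm fg]])
  then obtain C where "composition_series A M (composition_length A M) C"
    by (rule composition_length_series)
  then show "uniserial A M"
    using M.uniserial_if_length_two two[OF lm fl] M by blast
qed

lemma (in artin_algebra) radical_square_zero_if_length_at_most_two:
  assumes two: "\<And>M :: 'a list_module. left_module A M \<Longrightarrow> finite_length A M \<Longrightarrow> indecomposable A M \<Longrightarrow>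
      composition_length A M \<le> 2"
    and i: "i \<in> jacobson_radical A" and j: "j \<in> jacobson_radical A"
  shows "i \<otimes>\<^bsub>A\<^esub> j = \<zero>\<^bsub>A\<^esub>"
proof (rule eq_zero_if_annihilates_indecomposables)
  note c = A.jacobson_carrier[OF i] A.jacobson_carrier[OF j]
  show "i \<otimes>\<^bsub>A\<^esub> j \<in> carrier A" using c by simp
  fix M :: "'a list_module" and x
  assume M: "left_module A M" "finite_length A M" "indecomposable A M" and x: "x \<in> carrier M"
  interpret M: left_module A M by (rule M(1))
  let ?n = "composition_length A M"
  obtain C where C: "composition_series A M ?n C" using M(2) by (rule composition_length_series)
  have jx: "j \<odot>\<^bsub>M\<^esub> x \<in> C (?n - 1)"
    using M.composition_series_jacobson[OF C order_refl _ j] composition_seriesD(2)[OF C] x by simp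
  have "i \<odot>\<^bsub>M\<^esub> (j \<odot>\<^bsub>M\<^esub> x) \<in> C (?n - 1 - 1)"
    by (rule M.composition_series_jacobson[OF C _ jx i]) simp
  moreover have "?n - 1 - 1 = 0" using two[OF M] by simp
  ultimately have "i \<odot>\<^bsub>M\<^esub> (j \<odot>\<^bsub>M\<^esub> x) \<in> C 0" by (simp only:)
  then show "(i \<otimes>\<^bsub>A\<^esub> j) \<odot>\<^bsub>M\<^esub> x = \<zero>\<^bsub>M\<^esub>"
    using composition_seriesD(1)[OF C] c x by (simp add: M.smult_assoc)
qed

lemma (in artin_algebra) radical_zero_iff_all_simple:
  "jacobson_radical A = {\<zero>\<^bsub>A\<^esub>} \<longleftrightarrow>
    (\<forall>M :: 'a list_module. left_module A M \<and> finite_length A M \<and> indecomposable A M \<longrightarrow>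
      composition_length A M \<le> 1)"
proof (intro iffI allI impI)
  fix M :: "'a list_module"
  assume J: "jacobson_radical A = {\<zero>\<^bsub>A\<^esub>}"
    and M: "left_module A M \<and> finite_length A M \<and> indecomposable A M"
  then interpret M: left_module A M by blast
  have "finite_height A M"
    using fg_finite_height[OF M.left_module_axioms] M.finite_length_imp_fg M by blast
  then have "N = {\<zero>\<^bsub>M\<^esub>} \<or> N = carrier M" if "submodule N A M" for N
    using M.indecomposable_simple_if_radical_annihilates[OF finite_height_regular_algebra _ _ _ that] M J
    by simp
  moreover have "carrier M \<noteq> {\<zero>\<^bsub>M\<^esub>}" using M unfolding indecomposable_def by blast
  ultimately show "composition_length A M \<le> 1" by (rule M.composition_length_simple[rotated])
next
  assume one: "\<forall>M :: 'a list_module. left_module A M \<and> finite_length A M \<and> indecomposable A M \<longrightarrow>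
      composition_length A M \<le> 1"
  have "j = \<zero>\<^bsub>A\<^esub>" if j: "j \<in> jacobson_radical A" for j
  proof (rule eq_zero_if_annihilates_indecomposables[OF A.jacobson_carrier[OF j]])
    fix M :: "'a list_module" and x
    assume M: "left_module A M" "finite_length A M" "indecomposable A M" and x: "x \<in> carrier M"
    interpret M: left_module A M by (rule M(1))
    let ?n = "composition_length A M"
    obtain C where C: "composition_series A M ?n C" using M(2) by (rule composition_length_series)
    have "j \<odot>\<^bsub>M\<^esub> x \<in> C (?n - 1)"
      using M.composition_series_jacobson[OF C order_refl _ j] composition_seriesD(2)[OF C] x by simp
    moreover have "?n - 1 = 0" using one M by simp
    ultimately have "j \<odot>\<^bsub>M\<^esub> x \<in> C 0" by (simp only:)
    then show "j \<odot>\<^bsub>M\<^esub> x = \<zero>\<^bsub>M\<^esub>" using composition_seriesD(1)[OF C] by simp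
  qed
  then show "jacobson_radical A = {\<zero>\<^bsub>A\<^esub>}" using A.jacobson_zero by blast
qed

section \<open>Indecomposable summands of the regular module\<close>

text \<open>If \<open>1 = e + e'\<close> with \<open>e \<in> P\<close> and \<open>e' \<in> Q\<close>, then \<open>p e = p\<close> for \<open>p \<in> P\<close>.  So a homomorphism on \<open>P\<close>
  is determined by its value at \<open>e\<close>, and it is lifted by lifting this value.  The copy \<open>P'\<close> is there
  because the definition of a Nakayama algebra quantifies over list modules only.\<close>

lemma (in artin_algebra) projective_summand:
  assumes P: "submodule P A (regular_module A)" and Q: "submodule Q A (regular_module A)"
    and sum: "P <+>\<^bsub>regular_module A\<^esub> Q = carrier A" and int: "P \<inter> Q = {\<zero>\<^bsub>A\<^esub>}"
    and \<phi>: "left_module_map A (regular_module A\<lparr>carrier := P\<rparr>) P' \<phi>" "bij_betw \<phi> P (carrier P')"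
    and fg: "finitely_generated A P'"
  shows "projective_in_mod A P'"
  unfolding projective_in_mod_def
proof (intro conjI allI impI)
  let ?A = "regular_module A"
  let ?P = "?A\<lparr>carrier := P\<rparr>"
  interpret M: left_module A ?A by (rule A.left_module_regular)
  interpret \<phi>: left_module_map A ?P P' \<phi> by (rule \<phi>(1))
  have bij: "bij_betw \<phi> (carrier ?P) (carrier P')" using \<phi>(2) by simp
  let ?\<psi> = "inv_into (carrier ?P) \<phi>"
  interpret \<psi>: left_module_map A P' ?P ?\<psi> by (rule \<phi>.inverse_map[OF bij])
  show "in_mod A P'" unfolding in_mod_def using \<phi>.N.left_module_axioms fg by blast
  note Pc = M.submodule_carrier[OF P, simplified] and Qc = M.submodule_carrier[OF Q, simplified]
  have "\<one>\<^bsub>A\<^esub> \<in> P <+>\<^bsub>?A\<^esub> Q" using sum by simp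
  then obtain e e' where e: "e \<in> P" "e' \<in> Q" "\<one>\<^bsub>A\<^esub> = e \<oplus>\<^bsub>A\<^esub> e'" by (auto simp: M.mem_set_add)
  have pe: "p \<otimes>\<^bsub>A\<^esub> e = p" if p: "p \<in> P" for p
  proof -
    have "p = p \<otimes>\<^bsub>A\<^esub> (e \<oplus>\<^bsub>A\<^esub> e')" using Pc[OF p] e(3)[symmetric] by simp
    then have eq: "p = p \<otimes>\<^bsub>A\<^esub> e \<oplus>\<^bsub>A\<^esub> p \<otimes>\<^bsub>A\<^esub> e'"
      using Pc[OF p] Pc[OF e(1)] Qc[OF e(2)] by (simp add: A.r_distr)
    have "p \<otimes>\<^bsub>A\<^esub> e \<in> P" using M.submodule_smult[OF P Pc[OF p] e(1)] by simp
    moreover have "p \<otimes>\<^bsub>A\<^esub> e \<oplus>\<^bsub>A\<^esub> p \<otimes>\<^bsub>A\<^esub> e' \<in> P" using eq p by simp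
    ultimately have "p \<otimes>\<^bsub>A\<^esub> e' \<in> P"
      using M.submodule_add_cancel'[OF P, of "p \<otimes>\<^bsub>A\<^esub> e" "p \<otimes>\<^bsub>A\<^esub> e'"] Pc[OF p] Qc[OF e(2)] by simp
    moreover have "p \<otimes>\<^bsub>A\<^esub> e' \<in> Q" using M.submodule_smult[OF Q Pc[OF p] e(2)] by simp
    ultimately have "p \<otimes>\<^bsub>A\<^esub> e' = \<zero>\<^bsub>A\<^esub>" using int by blast
    then show ?thesis using eq Pc[OF p] Pc[OF e(1)] by simp
  qed
  fix U V :: "'a list_module" and g f
  assume *: "in_mod A U \<and> in_mod A V \<and> g \<in> left_module_hom A U V \<and> g ` carrier U = carrier V \<and>
    f \<in> left_module_hom A P' V"
  interpret g: left_module_map A U V g using * by (auto simp: in_mod_def intro!: left_module_mapI)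
  interpret f: left_module_map A P' V f
    using * \<phi>.N.left_module_axioms by (auto simp: in_mod_def intro!: left_module_mapI)
  have "f (\<phi> e) \<in> g ` carrier U" using * \<phi>.hom_closed[of e] e(1) by simp
  then obtain u where u: "u \<in> carrier U" "g u = f (\<phi> e)" by auto
  have \<psi>P: "?\<psi> y \<in> P" "\<phi> (?\<psi> y) = y" if "y \<in> carrier P'" for y
    using \<psi>.hom_closed[OF that] bij that by (simp_all add: bij_betw_inv_into_right)
  let ?h = "\<lambda>y. ?\<psi> y \<odot>\<^bsub>U\<^esub> u"
  have "?h \<in> left_module_hom A P' U"
    unfolding left_module_hom_def
    using \<psi>P(1) Pc u(1) \<psi>.hom_add \<psi>.hom_smult
    by (auto simp: g.M.smult_l_distr g.M.smult_assoc)
  moreover have "g (?h y) = f y" if y: "y \<in> carrier P'" for y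
  proof -
    have "g (?h y) = ?\<psi> y \<odot>\<^bsub>V\<^esub> f (\<phi> e)"
      using g.hom_smult[OF Pc[OF \<psi>P(1)[OF y]] u(1)] u(2) by simp
    also have "\<dots> = f (?\<psi> y \<odot>\<^bsub>P'\<^esub> \<phi> e)"
      using f.hom_smult[OF Pc[OF \<psi>P(1)[OF y]] \<phi>.hom_closed[of e]] e(1) by simp
    also have "?\<psi> y \<odot>\<^bsub>P'\<^esub> \<phi> e = \<phi> (?\<psi> y \<otimes>\<^bsub>A\<^esub> e)"
      using \<phi>.hom_smult[OF Pc[OF \<psi>P(1)[OF y]], of e] e(1) by simp
    also have "\<dots> = y" using pe[OF \<psi>P(1)[OF y]] \<psi>P(2)[OF y] by simp
    finally show ?thesis .
  qed
  ultimately show "\<exists>h \<in> left_module_hom A P' U. \<forall>p \<in> carrier P'. g (h p) = f p"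
    by (intro bexI[of _ ?h] ballI)
qed

text \<open>The regular module is a direct summand of itself that satisfies the condition on \<open>P\<close>, because
  \<open>x = 1 x\<close>.  A minimal summand \<open>P\<close> that satisfies it is indecomposable, and thus uniserial as a
  projective module over a Nakayama algebra.\<close>

lemma (in artin_algebra) uniserial_summand_not_annihilated:
  assumes nak: "nakayama_algebra A" and M: "left_module A M" and x: "x \<in> carrier M"
    and j: "j \<in> jacobson_radical A" "j \<odot>\<^bsub>M\<^esub> x \<noteq> \<zero>\<^bsub>M\<^esub>"
  obtains P i p where "submodule P A (regular_module A)" "uniserial A (regular_module A\<lparr>carrier := P\<rparr>)"
    "i \<in> jacobson_radical A" "p \<in> P" "i \<odot>\<^bsub>M\<^esub> (p \<odot>\<^bsub>M\<^esub> x) \<noteq> \<zero>\<^bsub>M\<^esub>"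
proof -
  interpret M: left_module A M by (rule M)
  let ?A = "regular_module A"
  interpret S: left_module A ?A by (rule A.left_module_regular)
  let ?live = "\<lambda>P. \<exists>i \<in> jacobson_radical A. \<exists>p \<in> P. i \<odot>\<^bsub>M\<^esub> (p \<odot>\<^bsub>M\<^esub> x) \<noteq> \<zero>\<^bsub>M\<^esub>"
  let ?F = "{P. submodule P A ?A \<and>
    (\<exists>Q. submodule Q A ?A \<and> P <+>\<^bsub>?A\<^esub> Q = carrier A \<and> P \<inter> Q = {\<zero>\<^bsub>A\<^esub>}) \<and> ?live P}"
  have "carrier A <+>\<^bsub>?A\<^esub> {\<zero>\<^bsub>A\<^esub>} = carrier A"
    using S.subset_set_add(1)[OF S.submodule_full S.submodule_trivial]
      S.submodule_subset[OF S.submodule_set_add[OF S.submodule_full S.submodule_trivial]] by simp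
  moreover have "carrier A \<inter> {\<zero>\<^bsub>A\<^esub>} = {\<zero>\<^bsub>A\<^esub>}" by auto
  moreover have "j \<odot>\<^bsub>M\<^esub> (\<one>\<^bsub>A\<^esub> \<odot>\<^bsub>M\<^esub> x) \<noteq> \<zero>\<^bsub>M\<^esub>" using x j(2) by simp
  then have "?live (carrier A)" using j(1) A.one_closed by blast
  ultimately have top: "carrier A \<in> ?F"
    using S.submodule_full S.submodule_trivial by (intro CollectI conjI exI[of _ "{\<zero>\<^bsub>A\<^esub>}"]) simp_all
  obtain n where "bounded_height {N. submodule N A ?A} n"
    using finite_height_regular_algebra unfolding finite_height_def by blast
  then have "bounded_height ?F n" by (rule bounded_height_mono) auto
  then obtain P where PF: "P \<in> ?F" and min: "\<And>K. K \<in> ?F \<Longrightarrow> K \<subseteq> P \<Longrightarrow> K = P"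
    using top by (rule bounded_height_minimal) blast
  from PF obtain Q where P: "submodule P A ?A" and Q: "submodule Q A ?A"
    and sum: "P <+>\<^bsub>?A\<^esub> Q = carrier A" and int: "P \<inter> Q = {\<zero>\<^bsub>A\<^esub>}" and live: "?live P"
    by auto
  let ?P = "?A\<lparr>carrier := P\<rparr>"
  interpret P: left_module A ?P by (rule S.left_module_submodule[OF P])
  (* a summand K of P is a summand of the regular module, with complement L + Q *)
  have part: "K \<in> ?F"
    if K: "submodule K A ?A" "K \<subseteq> P" and L: "submodule L A ?A" "L \<subseteq> P"
      and KL: "\<And>p. p \<in> P \<Longrightarrow> \<exists>k \<in> K. \<exists>l \<in> L. p = k \<oplus>\<^bsub>A\<^esub> l" and KL0: "K \<inter> L = {\<zero>\<^bsub>A\<^esub>}" and "?live K" for K L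
  proof -
    note LQ = S.submodule_set_add[OF L(1) Q]
    have "a \<in> K <+>\<^bsub>?A\<^esub> (L <+>\<^bsub>?A\<^esub> Q)" if "a \<in> carrier A" for a
    proof -
      have "a \<in> P <+>\<^bsub>?A\<^esub> Q" using sum that by simp
      then obtain p q where pq: "p \<in> P" "q \<in> Q" "a = p \<oplus>\<^bsub>A\<^esub> q" by (auto simp: S.mem_set_add)
      obtain k l where kl: "k \<in> K" "l \<in> L" "p = k \<oplus>\<^bsub>A\<^esub> l" using KL[OF pq(1)] by blast
      have "a = k \<oplus>\<^bsub>?A\<^esub> (l \<oplus>\<^bsub>?A\<^esub> q)"
        using kl pq S.submodule_carrier[OF K(1) kl(1)] S.submodule_carrier[OF L(1) kl(2)]
          S.submodule_carrier[OF Q pq(2)] S.M.a_assoc[of k l q] by simp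
      moreover have "l \<oplus>\<^bsub>?A\<^esub> q \<in> L <+>\<^bsub>?A\<^esub> Q"
        unfolding S.mem_set_add using kl(2) pq(2) by blast
      ultimately show ?thesis
        unfolding S.mem_set_add[of a K] using kl(1) by blast
    qed
    then have full: "K <+>\<^bsub>?A\<^esub> (L <+>\<^bsub>?A\<^esub> Q) = carrier A"
      using S.submodule_subset[OF S.submodule_set_add[OF K(1) LQ]] by auto
    have "k = \<zero>\<^bsub>A\<^esub>" if k: "k \<in> K" "k \<in> L <+>\<^bsub>?A\<^esub> Q" for k
    proof -
      obtain l q where lq: "l \<in> L" "q \<in> Q" "k = l \<oplus>\<^bsub>A\<^esub> q" using k(2) by (auto simp: S.mem_set_add)
      have lc: "l \<in> carrier A" "q \<in> carrier A"
        using S.submodule_carrier[OF L(1) lq(1)] S.submodule_carrier[OF Q lq(2)] by simp_all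
      have "q \<in> P" using S.submodule_add_cancel'[OF P, of l q] lq lc k(1) K(2) L(2) by auto
      then have "q = \<zero>\<^bsub>A\<^esub>" using int lq(2) by blast
      then have "k \<in> K \<inter> L" using k(1) lq lc by simp
      then show ?thesis using KL0 by blast
    qed
    then have "K \<inter> (L <+>\<^bsub>?A\<^esub> Q) \<subseteq> {\<zero>\<^bsub>A\<^esub>}" by blast
    then have "K \<inter> (L <+>\<^bsub>?A\<^esub> Q) = {\<zero>\<^bsub>A\<^esub>}"
      using S.submodule_zero[OF S.submodule_Int[OF K(1) LQ]] by auto
    then show ?thesis
      using K(1) LQ full \<open>?live K\<close> by (intro CollectI conjI exI[of _ "L <+>\<^bsub>?A\<^esub> Q"])
  qed
  have ind: "indecomposable A ?P"
    unfolding indecomposable_def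
  proof (intro conjI allI impI)
    obtain i p where ip: "i \<in> jacobson_radical A" "p \<in> P" "i \<odot>\<^bsub>M\<^esub> (p \<odot>\<^bsub>M\<^esub> x) \<noteq> \<zero>\<^bsub>M\<^esub>"
      using live by blast
    note ic = A.jacobson_carrier[OF ip(1)]
    then show "carrier ?P \<noteq> {\<zero>\<^bsub>?P\<^esub>}" using ip x by auto
    fix K L
    assume KL: "submodule K A ?P \<and> submodule L A ?P \<and> K <+>\<^bsub>?P\<^esub> L = carrier ?P \<and> K \<inter> L = {\<zero>\<^bsub>?P\<^esub>}"
    then have K: "submodule K A ?A" "K \<subseteq> P" and L: "submodule L A ?A" "L \<subseteq> P" and KL0: "K \<inter> L = {\<zero>\<^bsub>A\<^esub>}"
      using S.submodule_submodule_iff[OF P] by auto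
    have dec: "\<exists>k \<in> K. \<exists>l \<in> L. a = k \<oplus>\<^bsub>A\<^esub> l" if "a \<in> P" for a
    proof -
      have "a \<in> K <+>\<^bsub>?P\<^esub> L" using KL that by simp
      then show ?thesis by (auto simp: P.mem_set_add)
    qed
    have dec': "\<exists>l \<in> L. \<exists>k \<in> K. a = l \<oplus>\<^bsub>A\<^esub> k" if "a \<in> P" for a
    proof -
      obtain k l where "k \<in> K" "l \<in> L" "a = k \<oplus>\<^bsub>A\<^esub> l" using dec[OF \<open>a \<in> P\<close>] by blast
      moreover then have "a = l \<oplus>\<^bsub>A\<^esub> k"
        using S.submodule_carrier[OF K(1), of k] S.submodule_carrier[OF L(1), of l] S.M.a_comm[of k l]
        by simp
      ultimately show ?thesis by blast
    qed
    obtain k l where kl: "k \<in> K" "l \<in> L" "p = k \<oplus>\<^bsub>A\<^esub> l" using dec[OF ip(2)] by blast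
    have "k \<in> carrier A" "l \<in> carrier A"
      using kl S.submodule_carrier[OF K(1)] S.submodule_carrier[OF L(1)] by auto
    then have "i \<odot>\<^bsub>M\<^esub> (k \<odot>\<^bsub>M\<^esub> x) \<noteq> \<zero>\<^bsub>M\<^esub> \<or> i \<odot>\<^bsub>M\<^esub> (l \<odot>\<^bsub>M\<^esub> x) \<noteq> \<zero>\<^bsub>M\<^esub>"
      using ip(3) kl(3) ic x by (auto simp: M.smult_l_distr M.smult_r_distr)
    then have "?live K \<or> ?live L" using ip(1) kl(1,2) by blast
    moreover have "L \<inter> K = {\<zero>\<^bsub>A\<^esub>}" using KL0 by (simp add: Int_commute)
    ultimately have "K \<in> ?F \<or> L \<in> ?F" using part[OF K L dec KL0] part[OF L K dec'] by blast
    then have "K = P \<or> L = P" using min K(2) L(2) by blast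
    then show "K = {\<zero>\<^bsub>?P\<^esub>} \<or> L = {\<zero>\<^bsub>?P\<^esub>}" using KL0 K(2) L(2) by (auto simp: Int_absorb1 Int_absorb2)
  qed
  have "finite_height A ?P" by (rule S.finite_height_submodule[OF finite_height_regular_algebra P])
  then have fg: "finitely_generated A ?P"
    by (intro P.finite_length_imp_fg P.finite_height_imp_finite_length)
  obtain P' :: "'a list_module" and \<phi> where \<phi>: "left_module_map A ?P P' \<phi>"
    and bij: "bij_betw \<phi> (carrier ?P) (carrier P')"
    by (rule P.list_module_copy[OF fg])
  interpret \<phi>: left_module_map A ?P P' \<phi> by (rule \<phi>)
  interpret \<psi>: left_module_map A P' ?P "inv_into (carrier ?P) \<phi>" by (rule \<phi>.inverse_map[OF bij])
  have "finitely_generated A P'"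
    by (rule \<phi>.finitely_generated_image[OF fg]) (use bij in \<open>simp add: bij_betw_def\<close>)
  then have "projective_in_mod A P'"
    using projective_summand[OF P Q sum int \<phi>] bij by simp
  then have "uniserial A P'"
    using nak \<phi>.indecomposable_iso[OF ind bij] unfolding nakayama_algebra_def by blast
  then have "uniserial A ?P"
    by (rule \<psi>.uniserial_image) (use bij_betw_inv_into[OF bij] in \<open>simp add: bij_betw_def\<close>)
  then show ?thesis using that[OF P] live by blast
qed

section \<open>Essential extensions\<close>

text \<open>Extensions are given by embeddings instead of inclusions, so that an extension may live on
  another type, and extensions of extensions can be moved back to list modules.\<close>

definition essential_extension ::
  "('a, 'b) ring_scheme \<Rightarrow> ('a, 'm, 'x) module_scheme \<Rightarrow> ('a, 'n, 'y) module_scheme \<Rightarrow> ('m \<Rightarrow> 'n) \<Rightarrow> bool"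
  where
  "essential_extension A L I \<iota> \<longleftrightarrow> left_module_map A L I \<iota> \<and> inj_on \<iota> (carrier L) \<and>
    (\<forall>K. submodule K A I \<and> K \<inter> \<iota> ` carrier L \<subseteq> {\<zero>\<^bsub>I\<^esub>} \<longrightarrow> K = {\<zero>\<^bsub>I\<^esub>})"

lemma essential_extensionD:
  assumes "essential_extension A L I \<iota>"
  shows "left_module_map A L I \<iota>" "inj_on \<iota> (carrier L)"
    "\<And>K. submodule K A I \<Longrightarrow> K \<inter> \<iota> ` carrier L \<subseteq> {\<zero>\<^bsub>I\<^esub>} \<Longrightarrow> K = {\<zero>\<^bsub>I\<^esub>}"
  using assms unfolding essential_extension_def by simp_all

text \<open>The elements annihilated by \<open>J\<close> form a semisimple module, so one outside \<open>L\<close> would yield a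
  nonzero submodule that meets \<open>L\<close> trivially.\<close>

lemma (in artin_algebra) killed_by_radical_in_essential_submodule:
  assumes ess: "essential_extension A L I \<iota>" and x: "x \<in> carrier I"
    and ann: "\<And>j. j \<in> jacobson_radical A \<Longrightarrow> j \<odot>\<^bsub>I\<^esub> x = \<zero>\<^bsub>I\<^esub>"
  shows "x \<in> \<iota> ` carrier L"
proof (rule ccontr)
  interpret \<iota>: left_module_map A L I \<iota> by (rule essential_extensionD(1)[OF ess])
  have im: "submodule (\<iota> ` carrier L) A I" by (rule \<iota>.submodule_image[OF \<iota>.M.submodule_full])
  assume "x \<notin> \<iota> ` carrier L"
  then obtain K where K: "submodule K A I" "\<not> K \<subseteq> \<iota> ` carrier L"
    "K \<inter> \<iota> ` carrier L \<subseteq> (\<lambda>a. a \<odot>\<^bsub>I\<^esub> x) ` jacobson_radical A"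
    by (rule \<iota>.N.supplement_mod_radical[OF finite_height_regular_algebra im x])
  have "k = \<zero>\<^bsub>I\<^esub>" if "k \<in> K \<inter> \<iota> ` carrier L" for k
    using subsetD[OF K(3) that] ann by auto
  then have "K \<inter> \<iota> ` carrier L \<subseteq> {\<zero>\<^bsub>I\<^esub>}" by (intro subsetI) simp
  then have "K = {\<zero>\<^bsub>I\<^esub>}" by (rule essential_extensionD(3)[OF ess K(1)])
  then show False using K(2) \<iota>.N.submodule_zero[OF im] by simp
qed

text \<open>For \<open>d \<in> J\<close>, multiplication by \<open>d\<close> is an \<open>R\<close>-linear map from \<open>I\<close> into \<open>L\<close>, because \<open>J\<^sup>2 = 0\<close>.
  Each of the finitely many generators of \<open>J\<close> therefore adds at most the \<open>R\<close>-length \<open>s\<close> of \<open>L\<close>, and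
  what all of them annihilate lies in \<open>L\<close>.  The bound does not depend on \<open>I\<close>.  It concerns chains of
  \<open>R\<close>-submodules, since multiplication by \<open>d\<close> is not \<open>A\<close>-linear, but \<open>A\<close>-submodules are among them.\<close>

lemma (in artin_algebra) essential_extensions_bounded:
  fixes L :: "('a, 'm, 'y) module_scheme"
  assumes L: "left_module A L" "finitely_generated A L"
    and rad2: "\<And>i j. i \<in> jacobson_radical A \<Longrightarrow> j \<in> jacobson_radical A \<Longrightarrow> i \<otimes>\<^bsub>A\<^esub> j = \<zero>\<^bsub>A\<^esub>"
  shows "\<exists>B. \<forall>(I :: ('a, 'n) module) \<iota>. essential_extension A L I \<iota> \<longrightarrow>
    bounded_height {K. submodule K A I} B"
proof -
  let ?A = "regular_module A" and ?J = "jacobson_radical A"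
  interpret S: left_module A ?A by (rule A.left_module_regular)
  interpret L: left_module A L by (rule L(1))
  interpret RL: left_module R "restrict_scalars A L" by (rule left_module_restrict_scalars[OF L(1)])
  obtain s where s: "bounded_height {K. submodule K R (restrict_scalars A L)} s"
    using fg_finite_scalar_height[OF L] unfolding finite_height_def by blast
  have sJ: "submodule ?J A ?A" using A.left_ideal_jacobson by (simp add: A.left_ideal_iff_submodule)
  interpret J: left_module A "?A\<lparr>carrier := ?J\<rparr>" by (rule S.left_module_submodule[OF sJ])
  have "finitely_generated A (?A\<lparr>carrier := ?J\<rparr>)"
    by (intro J.finite_length_imp_fg J.finite_height_imp_finite_length
        S.finite_height_submodule[OF finite_height_regular_algebra sJ])
  then obtain G where G: "finite G" "G \<subseteq> ?J"
    and gen: "\<And>K. left_ideal K A \<Longrightarrow> K \<subseteq> ?J \<Longrightarrow> G \<subseteq> K \<Longrightarrow> K = ?J"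
    unfolding finitely_generated_def A.left_ideal_iff_submodule S.submodule_submodule_iff[OF sJ] by auto
  note Jc = A.jacobson_carrier
  have "bounded_height {K. submodule K A I} (s + card G * s)" if ess: "essential_extension A L I \<iota>"
    for I :: "('a, 'n) module" and \<iota>
  proof -
    interpret \<iota>: left_module_map A L I \<iota> by (rule essential_extensionD(1)[OF ess])
    note inj = essential_extensionD(2)[OF ess]
    let ?I = "restrict_scalars A I"
    interpret RI: left_module R ?I by (rule left_module_restrict_scalars[OF \<iota>.N.left_module_axioms])
    define T where "T H = {x \<in> carrier I. \<forall>h \<in> H. h \<odot>\<^bsub>I\<^esub> x = \<zero>\<^bsub>I\<^esub>}" for H
    have T: "submodule (T H) R ?I" if H: "H \<subseteq> G" for H
    proof (rule RI.submoduleI)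
      fix x assume x: "x \<in> T H"
      show "r \<odot>\<^bsub>?I\<^esub> x \<in> T H" if r: "r \<in> carrier R" for r
      proof -
        have "h \<odot>\<^bsub>I\<^esub> (scalar r \<odot>\<^bsub>I\<^esub> x) = \<zero>\<^bsub>I\<^esub>" if h: "h \<in> H" for h
        proof -
          have hc: "h \<in> carrier A" using h H G(2) Jc by blast
          have "h \<odot>\<^bsub>I\<^esub> (scalar r \<odot>\<^bsub>I\<^esub> x) = scalar r \<odot>\<^bsub>I\<^esub> (h \<odot>\<^bsub>I\<^esub> x)"
            using hc r x scalar_commute[OF r hc] by (simp add: T_def \<iota>.N.smult_assoc[symmetric])
          then show ?thesis using x h r by (simp add: T_def)
        qed
        then show ?thesis using x r by (simp add: T_def)
      qed
      have hc: "h \<in> carrier A" if "h \<in> H" for h using that H G(2) Jc by blast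
      show "x \<oplus>\<^bsub>?I\<^esub> y \<in> T H" if "y \<in> T H" for y
        using x that hc by (auto simp: T_def \<iota>.N.smult_r_distr)
    qed (use H G(2) Jc in \<open>auto simp: T_def subset_iff\<close>)
    have TG: "T G \<subseteq> \<iota> ` carrier L"
    proof
      fix x assume x: "x \<in> T G"
      then have xc: "x \<in> carrier I" by (simp add: T_def)
      have "left_ideal {j \<in> ?J. j \<odot>\<^bsub>I\<^esub> x = \<zero>\<^bsub>I\<^esub>} A"
        by (rule A.left_idealI)
          (use xc Jc A.jacobson_zero A.jacobson_mult A.left_ideal_add[OF A.left_ideal_jacobson] in
            \<open>auto simp: \<iota>.N.smult_l_distr \<iota>.N.smult_assoc\<close>)
      moreover have "G \<subseteq> {j \<in> ?J. j \<odot>\<^bsub>I\<^esub> x = \<zero>\<^bsub>I\<^esub>}" using x G(2) by (auto simp: T_def)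
      ultimately have "{j \<in> ?J. j \<odot>\<^bsub>I\<^esub> x = \<zero>\<^bsub>I\<^esub>} = ?J" by (intro gen) auto
      then show "x \<in> \<iota> ` carrier L"
        by (intro killed_by_radical_in_essential_submodule[OF ess xc]) blast
    qed
    have soc: "j \<odot>\<^bsub>I\<^esub> x \<in> \<iota> ` carrier L" if "j \<in> ?J" "x \<in> carrier I" for j x
      by (rule killed_by_radical_in_essential_submodule[OF ess])
        (use that Jc rad2 in \<open>auto simp: \<iota>.N.smult_assoc[symmetric]\<close>)
    (* the part of L that corresponds to d N; for d = 1 it is the preimage of N *)
    let ?pre = "\<lambda>d N. {y \<in> carrier L. \<exists>n \<in> N. \<iota> y = d \<odot>\<^bsub>I\<^esub> n}"
    have pre: "submodule (?pre d N) R (restrict_scalars A L)"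
      if N: "submodule N R ?I" and d: "d \<in> carrier A" for N d
    proof (rule RL.submoduleI)
      note Nc = RI.submodule_carrier[OF N, simplified]
      show "\<zero>\<^bsub>restrict_scalars A L\<^esub> \<in> ?pre d N"
        using RI.submodule_zero[OF N] d by (auto simp: \<iota>.hom_zero intro!: bexI[of _ "\<zero>\<^bsub>I\<^esub>"])
      fix y assume "y \<in> ?pre d N"
      then obtain n where y: "y \<in> carrier L" "n \<in> N" "\<iota> y = d \<odot>\<^bsub>I\<^esub> n" by blast
      show "r \<odot>\<^bsub>restrict_scalars A L\<^esub> y \<in> ?pre d N"
        if r: "r \<in> carrier R" for r
      proof -
        have "\<iota> (scalar r \<odot>\<^bsub>L\<^esub> y) = d \<odot>\<^bsub>I\<^esub> (scalar r \<odot>\<^bsub>I\<^esub> n)"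
          using y Nc[OF y(2)] r d scalar_commute[OF r d] by (simp add: \<iota>.hom_smult \<iota>.N.smult_assoc[symmetric])
        moreover have "scalar r \<odot>\<^bsub>I\<^esub> n \<in> N" using RI.submodule_smult[OF N r y(2)] by simp
        ultimately show ?thesis using y(1) r by auto
      qed
      show "y \<oplus>\<^bsub>restrict_scalars A L\<^esub> z \<in> ?pre d N"
        if "z \<in> ?pre d N" for z
      proof -
        from that obtain m where z: "z \<in> carrier L" "m \<in> N" "\<iota> z = d \<odot>\<^bsub>I\<^esub> m" by blast
        have "\<iota> (y \<oplus>\<^bsub>L\<^esub> z) = d \<odot>\<^bsub>I\<^esub> (n \<oplus>\<^bsub>I\<^esub> m)"
          using y z Nc d by (simp add: \<iota>.hom_add \<iota>.N.smult_r_distr)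
        moreover have "n \<oplus>\<^bsub>I\<^esub> m \<in> N" using RI.submodule_add[OF N y(2) z(2)] by simp
        ultimately show ?thesis using y(1) z(1) by auto
      qed
    qed auto
    (* generators are dropped one by one, from T G, which lies in L, to T {}, which is all of I *)
    have "bounded_height {N. submodule N R ?I \<and> N \<subseteq> T (G - D)} (s + card D * s)" if "finite D" "D \<subseteq> G" for D
      using that
    proof (induction D)
      case empty
      have "bounded_height {N. submodule N R ?I \<and> N \<subseteq> T G} s"
      proof (rule bounded_height_strict_map[OF s, where \<sigma> = "?pre \<one>\<^bsub>A\<^esub>"])
        fix N K assume "N \<in> {N. submodule N R ?I \<and> N \<subseteq> T G}" "K \<in> {N. submodule N R ?I \<and> N \<subseteq> T G}"
          and lt: "N \<subset> K"
        then have N: "submodule N R ?I" and K: "submodule K R ?I" "K \<subseteq> T G" by auto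
        note c = RI.submodule_carrier[OF N, simplified] RI.submodule_carrier[OF K(1), simplified]
        obtain k where k: "k \<in> K" "k \<notin> N" using lt by blast
        obtain y where y: "y \<in> carrier L" "k = \<iota> y" using k(1) K(2) TG by blast
        have "\<iota> y = \<one>\<^bsub>A\<^esub> \<odot>\<^bsub>I\<^esub> k" using c(2)[OF k(1)] y(2) by simp
        then have "y \<in> ?pre \<one>\<^bsub>A\<^esub> K" using k(1) y(1) by blast
        moreover have "y \<notin> ?pre \<one>\<^bsub>A\<^esub> N"
        proof
          assume "y \<in> ?pre \<one>\<^bsub>A\<^esub> N"
          then obtain n where n: "n \<in> N" "\<iota> y = \<one>\<^bsub>A\<^esub> \<odot>\<^bsub>I\<^esub> n" by blast
          then have "k = n" using c(1)[OF n(1)] y(2) by simp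
          then show False using n(1) k(2) by simp
        qed
        ultimately have ne: "?pre \<one>\<^bsub>A\<^esub> N \<noteq> ?pre \<one>\<^bsub>A\<^esub> K" by metis
        have "?pre \<one>\<^bsub>A\<^esub> N \<subseteq> ?pre \<one>\<^bsub>A\<^esub> K"
        proof
          fix z assume "z \<in> ?pre \<one>\<^bsub>A\<^esub> N"
          then obtain n where "z \<in> carrier L" "n \<in> N" "\<iota> z = \<one>\<^bsub>A\<^esub> \<odot>\<^bsub>I\<^esub> n" by blast
          then show "z \<in> ?pre \<one>\<^bsub>A\<^esub> K" using lt by blast
        qed
        then show "?pre \<one>\<^bsub>A\<^esub> N \<subset> ?pre \<one>\<^bsub>A\<^esub> K" using ne by (rule psubsetI)
      qed (use pre in auto)
      then show ?case by simp
    next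
      case (insert d D)
      then have d: "d \<in> ?J" "d \<in> carrier A" using G(2) Jc by auto
      have IH: "bounded_height {N. submodule N R ?I \<and> N \<subseteq> T (G - D)} (s + card D * s)" using insert by auto
      have TD: "submodule (T (G - D)) R ?I" by (rule T) auto
      have "bounded_height {N. submodule N R ?I \<and> N \<subseteq> T (G - insert d D)} (s + card D * s + s)"
      proof (rule bounded_height_combine[OF IH s, where \<sigma> = "\<lambda>N. N \<inter> T (G - D)" and \<tau> = "?pre d"])
        fix N K assume "N \<in> {N. submodule N R ?I \<and> N \<subseteq> T (G - insert d D)}"
          "K \<in> {N. submodule N R ?I \<and> N \<subseteq> T (G - insert d D)}"
          and le: "N \<subseteq> K" and eq: "N \<inter> T (G - D) = K \<inter> T (G - D)" "?pre d N = ?pre d K"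
        then have N: "submodule N R ?I" and K: "submodule K R ?I" "K \<subseteq> T (G - insert d D)" by auto
        have "k \<in> N" if k: "k \<in> K" for k
        proof -
          have kc: "k \<in> carrier I" using RI.submodule_carrier[OF K(1) k] by simp
          obtain y where y: "y \<in> carrier L" "d \<odot>\<^bsub>I\<^esub> k = \<iota> y" using soc[OF d(1) kc] by blast
          then have "y \<in> ?pre d K" using k y(2)[symmetric] by blast
          then obtain n where n: "n \<in> N" "\<iota> y = d \<odot>\<^bsub>I\<^esub> n" using eq(2) by blast
          have nc: "n \<in> carrier I" using RI.submodule_carrier[OF N n(1)] by simp
          have "d \<odot>\<^bsub>I\<^esub> (k \<ominus>\<^bsub>I\<^esub> n) = \<zero>\<^bsub>I\<^esub>"
            using d(2) kc nc y(2) n(2)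
            by (simp add: a_minus_def \<iota>.N.smult_r_distr \<iota>.N.smult_r_minus \<iota>.N.M.r_neg)
          moreover have kn: "k \<ominus>\<^bsub>I\<^esub> n \<in> K" using RI.submodule_diff[OF K(1) k, of n] n(1) le by auto
          ultimately have "k \<ominus>\<^bsub>I\<^esub> n \<in> K \<inter> T (G - D)" using K(2) by (auto simp: T_def)
          then have "k \<ominus>\<^bsub>I\<^esub> n \<in> N" using eq(1) by blast
          then have "(k \<ominus>\<^bsub>I\<^esub> n) \<oplus>\<^bsub>I\<^esub> n \<in> N" using RI.submodule_add[OF N _ n(1)] by simp
          then show ?thesis using kc nc by (simp add: a_minus_def \<iota>.N.M.a_assoc \<iota>.N.M.l_neg)
        qed
        then show "N = K" using le by blast
      next
        fix N assume "N \<in> {N. submodule N R ?I \<and> N \<subseteq> T (G - insert d D)}"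
        then show "?pre d N \<in> {K. submodule K R (restrict_scalars A L)}" using pre d(2) by simp
      qed (use TD RI.submodule_Int in auto)
      then show ?case using insert by (simp add: algebra_simps)
    qed
    from this[OF G(1) order_refl]
    have "bounded_height {N. submodule N R ?I \<and> N \<subseteq> carrier I} (s + card G * s)" by (simp add: T_def)
    then have "bounded_height {N. submodule N R ?I} (s + card G * s)"
      by (rule bounded_height_mono) (use RI.submodule_subset in auto)
    then show ?thesis by (rule bounded_height_of_scalars[OF \<iota>.N.left_module_axioms])
  qed
  then show ?thesis by blast
qed

section \<open>Largest essential extensions are injective\<close>

text \<open>Needed for the pushout of two homomorphisms, which is a quotient of a direct sum.\<close>

definition direct_sum ::
  "('a, 'm, 'x) module_scheme \<Rightarrow> ('a, 'n, 'y) module_scheme \<Rightarrow> ('a, 'm \<times> 'n) module" where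
  "direct_sum M N = \<lparr>carrier = carrier M \<times> carrier N,
     monoid.mult = (\<lambda>_ _. (\<zero>\<^bsub>M\<^esub>, \<zero>\<^bsub>N\<^esub>)), one = (\<zero>\<^bsub>M\<^esub>, \<zero>\<^bsub>N\<^esub>), ring.zero = (\<zero>\<^bsub>M\<^esub>, \<zero>\<^bsub>N\<^esub>),
     ring.add = (\<lambda>(x, y) (x', y'). (x \<oplus>\<^bsub>M\<^esub> x', y \<oplus>\<^bsub>N\<^esub> y')),
     smult = (\<lambda>a (x, y). (a \<odot>\<^bsub>M\<^esub> x, a \<odot>\<^bsub>N\<^esub> y))\<rparr>"

lemma direct_sum_simps [simp]:
  "carrier (direct_sum M N) = carrier M \<times> carrier N" "\<zero>\<^bsub>direct_sum M N\<^esub> = (\<zero>\<^bsub>M\<^esub>, \<zero>\<^bsub>N\<^esub>)"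
  "(x, y) \<oplus>\<^bsub>direct_sum M N\<^esub> (x', y') = (x \<oplus>\<^bsub>M\<^esub> x', y \<oplus>\<^bsub>N\<^esub> y')"
  "a \<odot>\<^bsub>direct_sum M N\<^esub> (x, y) = (a \<odot>\<^bsub>M\<^esub> x, a \<odot>\<^bsub>N\<^esub> y)"
  by (simp_all add: direct_sum_def)

lemma left_module_direct_sum:
  assumes "left_module A M" "left_module A N"
  shows "left_module A (direct_sum M N)"
proof -
  interpret M: left_module A M by fact
  interpret N: left_module A N by fact
  have "abelian_group (direct_sum M N)"
  proof (rule abelian_groupI)
    show "\<exists>y \<in> carrier (direct_sum M N). y \<oplus>\<^bsub>direct_sum M N\<^esub> x = \<zero>\<^bsub>direct_sum M N\<^esub>"
      if "x \<in> carrier (direct_sum M N)" for x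
      using that by (intro bexI[of _ "(\<ominus>\<^bsub>M\<^esub> fst x, \<ominus>\<^bsub>N\<^esub> snd x)"]) (auto simp: M.M.l_neg N.M.l_neg)
  qed (auto simp: M.M.a_ac N.M.a_ac)
  then show ?thesis
    by (intro left_module.intro left_module_axioms.intro M.A.ring_axioms)
      (auto simp: M.smult_l_distr N.smult_l_distr M.smult_r_distr N.smult_r_distr M.smult_assoc
        N.smult_assoc)
qed

lemma finitely_generated_direct_sum:
  assumes M: "left_module A M" "finitely_generated A M" and N: "left_module A N" "finitely_generated A N"
  shows "finitely_generated A (direct_sum M N)"
proof -
  interpret M: left_module A M by (rule M)
  interpret N: left_module A N by (rule N)
  interpret E: left_module A "direct_sum M N" by (rule left_module_direct_sum[OF M(1) N(1)])
  obtain S where S: "finite S" "S \<subseteq> carrier M" "\<And>K. submodule K A M \<Longrightarrow> S \<subseteq> K \<Longrightarrow> K = carrier M"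
    using M(2) unfolding finitely_generated_def by blast
  obtain T where T: "finite T" "T \<subseteq> carrier N" "\<And>K. submodule K A N \<Longrightarrow> T \<subseteq> K \<Longrightarrow> K = carrier N"
    using N(2) unfolding finitely_generated_def by blast
  let ?G = "(\<lambda>s. (s, \<zero>\<^bsub>N\<^esub>)) ` S \<union> (\<lambda>t. (\<zero>\<^bsub>M\<^esub>, t)) ` T"
  have "K = carrier (direct_sum M N)" if K: "submodule K A (direct_sum M N)" and G: "?G \<subseteq> K" for K
  proof -
    note Kd = E.submodule_add[OF K] E.submodule_smult[OF K] E.submodule_zero[OF K]
    let ?M = "{x \<in> carrier M. (x, \<zero>\<^bsub>N\<^esub>) \<in> K}" and ?N = "{x \<in> carrier N. (\<zero>\<^bsub>M\<^esub>, x) \<in> K}"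
    have "submodule ?M A M"
    proof (rule M.submoduleI)
      show "a \<odot>\<^bsub>M\<^esub> x \<in> ?M"
        if "a \<in> carrier A" "x \<in> ?M" for a x
        using that Kd(2)[of a "(x, \<zero>\<^bsub>N\<^esub>)"] by simp
      show "x \<oplus>\<^bsub>M\<^esub> y \<in> ?M"
        if "x \<in> ?M" "y \<in> ?M" for x y
        using that Kd(1)[of "(x, \<zero>\<^bsub>N\<^esub>)" "(y, \<zero>\<^bsub>N\<^esub>)"] by simp
    qed (use Kd(3) in auto)
    then have 1: "?M = carrier M" by (rule S(3)) (use G S(2) in auto)
    have "submodule ?N A N"
    proof (rule N.submoduleI)
      show "a \<odot>\<^bsub>N\<^esub> x \<in> ?N"
        if "a \<in> carrier A" "x \<in> ?N" for a x
        using that Kd(2)[of a "(\<zero>\<^bsub>M\<^esub>, x)"] by simp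
      show "x \<oplus>\<^bsub>N\<^esub> y \<in> ?N"
        if "x \<in> ?N" "y \<in> ?N" for x y
        using that Kd(1)[of "(\<zero>\<^bsub>M\<^esub>, x)" "(\<zero>\<^bsub>M\<^esub>, y)"] by simp
    qed (use Kd(3) in auto)
    then have 2: "?N = carrier N" by (rule T(3)) (use G T(2) in auto)
    have "(x, y) \<in> K" if "x \<in> carrier M" "y \<in> carrier N" for x y
    proof -
      have "(x, \<zero>\<^bsub>N\<^esub>) \<in> K" "(\<zero>\<^bsub>M\<^esub>, y) \<in> K" using 1 2 that by blast+
      then show ?thesis using Kd(1)[of "(x, \<zero>\<^bsub>N\<^esub>)" "(\<zero>\<^bsub>M\<^esub>, y)"] that by simp
    qed
    then show ?thesis using E.submodule_subset[OF K] by auto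
  qed
  moreover have "finite ?G" "?G \<subseteq> carrier (direct_sum M N)" using S(1,2) T(1,2) by auto
  ultimately show ?thesis unfolding finitely_generated_def by (intro exI[of _ ?G]) auto
qed

text \<open>Another description of the length; in this form it clearly grows under proper embeddings.\<close>

definition module_height :: "('a, 'b) ring_scheme \<Rightarrow> ('a, 'm, 'x) module_scheme \<Rightarrow> nat" where
  "module_height A M = (LEAST n. bounded_height {N. submodule N A M} n)"

lemma (in left_module_map) module_height_less:
  assumes inj: "inj_on h (carrier M)" and proper: "h ` carrier M \<noteq> carrier N" and fh: "finite_height A N"
  shows "module_height A M < module_height A N"
proof -
  obtain n where "bounded_height {K. submodule K A N} n" using fh unfolding finite_height_def by blast
  then have "bounded_height {K. submodule K A N} (module_height A N)"
    unfolding module_height_def by (rule LeastI)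
  then obtain \<rho> where \<rho>: "\<forall>K \<in> {K. submodule K A N}. \<rho> K \<le> module_height A N"
    "\<forall>K \<in> {K. submodule K A N}. \<forall>L \<in> {K. submodule K A N}. K \<subset> L \<longrightarrow> \<rho> K < \<rho> L"
    unfolding bounded_height_def by blast
  have "h ` carrier M \<subset> carrier N" using proper by auto
  then have "\<rho> (h ` carrier M) < \<rho> (carrier N)"
    using \<rho>(2) submodule_image[OF M.submodule_full] N.submodule_full by simp
  also have "\<dots> \<le> module_height A N" using \<rho>(1) N.submodule_full by simp
  finally have lt: "\<rho> (h ` carrier M) < module_height A N" .
  have mono: "\<rho> K \<le> \<rho> L" if "submodule K A N" "submodule L A N" "K \<subseteq> L" for K L
    using \<rho>(2)[rule_format, of K L] that by (cases "K = L") (simp_all add: psubset_eq)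
  have "bounded_height {K. submodule K A M} (\<rho> (h ` carrier M))"
    unfolding bounded_height_def
  proof (intro exI[of _ "\<lambda>K. \<rho> (h ` K)"] conjI ballI impI)
    fix K assume "K \<in> {K. submodule K A M}"
    then have K: "submodule K A M" by simp
    show "\<rho> (h ` K) \<le> \<rho> (h ` carrier M)"
      by (rule mono[OF submodule_image[OF K] submodule_image[OF M.submodule_full]
            image_mono[OF M.submodule_subset[OF K]]])
    fix L assume "L \<in> {K. submodule K A M}" and lt: "K \<subset> L"
    then have L: "submodule L A M" by simp
    have "h ` K \<noteq> h ` L"
      using inj_on_image_eq_iff[OF inj M.submodule_subset[OF K] M.submodule_subset[OF L]] lt by blast
    then have "h ` K \<subset> h ` L" using lt by blast
    then show "\<rho> (h ` K) < \<rho> (h ` L)" using \<rho>(2) submodule_image[OF K] submodule_image[OF L] by simp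
  qed
  then have "module_height A M \<le> \<rho> (h ` carrier M)" unfolding module_height_def by (rule Least_le)
  then show ?thesis using lt by simp
qed

text \<open>Let \<open>U\<close> be embedded in \<open>V\<close> by \<open>g\<close>, and let \<open>f\<close> map \<open>U\<close> to \<open>I\<close>.  Extending \<open>f\<close> to \<open>V\<close> means
  finding a complement of \<open>I\<close> in \<open>I \<oplus> V\<close> that contains \<open>D = {(f u, - g u) | u \<in> U}\<close>.  Let \<open>K\<close> be
  maximal among the submodules that contain \<open>D\<close> and meet \<open>I\<close> trivially.  By maximality
  \<open>(I \<oplus> V)/K\<close> is an essential extension of \<open>I\<close>, hence of \<open>L\<close>.  As \<open>I\<close> is a largest one,
  \<open>I \<rightarrow> (I \<oplus> V)/K\<close> is onto, that is, \<open>I + K = I \<oplus> V\<close>.\<close>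

lemma (in artin_algebra) largest_essential_extension_injective:
  fixes I :: "'a list_module"
  assumes ess: "essential_extension A L I \<iota>" and fg: "finitely_generated A I"
    and max: "\<And>(E :: 'a list_module) \<kappa>. essential_extension A L E \<kappa> \<Longrightarrow> finitely_generated A E \<Longrightarrow>
      module_height A E \<le> module_height A I"
  shows "injective_in_mod A I"
proof -
  interpret \<iota>: left_module_map A L I \<iota> by (rule essential_extensionD(1)[OF ess])
  have extend: "\<exists>h \<in> left_module_hom A V I. \<forall>x \<in> carrier U. h (g x) = f x"
    if U: "left_module A U" and V: "left_module A V" "finitely_generated A V"
      and g: "g \<in> left_module_hom A U V" "inj_on g (carrier U)" and f: "f \<in> left_module_hom A U I"
    for U V :: "'a list_module" and g f
  proof -
    interpret g: left_module_map A U V g by (rule left_module_mapI[OF U V(1) g(1)])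
    interpret f: left_module_map A U I f by (rule left_module_mapI[OF U \<iota>.N.left_module_axioms f])
    let ?E = "direct_sum I V"
    interpret E: left_module A ?E by (rule left_module_direct_sum[OF \<iota>.N.left_module_axioms V(1)])
    have fgE: "finitely_generated A ?E"
      by (rule finitely_generated_direct_sum[OF \<iota>.N.left_module_axioms fg V])
    let ?D = "(\<lambda>u. (f u, \<ominus>\<^bsub>V\<^esub> g u)) ` carrier U"
    let ?F = "{K. submodule K A ?E \<and> ?D \<subseteq> K \<and> (\<forall>x. (x, \<zero>\<^bsub>V\<^esub>) \<in> K \<longrightarrow> x = \<zero>\<^bsub>I\<^esub>)}"
    have "(\<lambda>u. (f u, \<ominus>\<^bsub>V\<^esub> g u)) \<in> left_module_hom A U ?E"
      by (auto simp: left_module_hom_def f.hom_add g.hom_add f.hom_smult g.hom_smult g.N.M.minus_add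
          g.N.smult_r_minus)
    then interpret D: left_module_map A U ?E "\<lambda>u. (f u, \<ominus>\<^bsub>V\<^esub> g u)"
      by (rule left_module_mapI[OF U E.left_module_axioms])
    have "x = \<zero>\<^bsub>I\<^esub>" if "(x, \<zero>\<^bsub>V\<^esub>) \<in> ?D" for x
    proof -
      from that obtain u where "u \<in> carrier U" "(x, \<zero>\<^bsub>V\<^esub>) = (f u, \<ominus>\<^bsub>V\<^esub> g u)" by (rule imageE)
      then have u: "u \<in> carrier U" "x = f u" "\<ominus>\<^bsub>V\<^esub> g u = \<zero>\<^bsub>V\<^esub>" by simp_all
      have "g u = \<ominus>\<^bsub>V\<^esub> (\<ominus>\<^bsub>V\<^esub> g u)" using u(1) by simp
      also have "\<dots> = \<zero>\<^bsub>V\<^esub>" using u(3) g.N.M.minus_equality[of "\<zero>\<^bsub>V\<^esub>" "\<zero>\<^bsub>V\<^esub>"] by simp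
      finally have "u = \<zero>\<^bsub>U\<^esub>" by (rule g.inj_zero[OF g(2) u(1)])
      then show ?thesis using u(2) f.hom_zero by simp
    qed
    then have DF: "?D \<in> ?F" using D.submodule_image[OF g.M.submodule_full] by blast
    obtain n where "bounded_height {K. submodule K A ?E} n"
      using fg_finite_height[OF E.left_module_axioms fgE] unfolding finite_height_def by blast
    then have "bounded_height ?F n" by (rule bounded_height_mono) auto
    then obtain K where KF: "K \<in> ?F" and Kmax: "\<And>L. L \<in> ?F \<Longrightarrow> K \<subseteq> L \<Longrightarrow> L = K"
      using DF by (rule bounded_height_maximal) blast
    then have K: "submodule K A ?E" and DK: "?D \<subseteq> K" and K0: "\<And>x. (x, \<zero>\<^bsub>V\<^esub>) \<in> K \<Longrightarrow> x = \<zero>\<^bsub>I\<^esub>" by auto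
    obtain Q :: "('a, 'a list \<times> 'a list) module" and q where q: "left_module_map A ?E Q q"
      "q ` carrier ?E = carrier Q" "\<And>x. x \<in> carrier ?E \<Longrightarrow> q x = \<zero>\<^bsub>Q\<^esub> \<longleftrightarrow> x \<in> K"
      using E.quotient_exists[OF K] by metis
    interpret q: left_module_map A ?E Q q by (rule q(1))
    have fgQ: "finitely_generated A Q" by (rule q.finitely_generated_image[OF fgE q(2)])
    obtain Q' :: "'a list_module" and \<kappa> where \<kappa>: "left_module_map A Q Q' \<kappa>"
      "bij_betw \<kappa> (carrier Q) (carrier Q')"
      by (rule q.N.list_module_copy[OF fgQ])
    interpret \<kappa>: left_module_map A Q Q' \<kappa> by (rule \<kappa>(1))
    have \<kappa>inj: "inj_on \<kappa> (carrier Q)" and \<kappa>surj: "\<kappa> ` carrier Q = carrier Q'"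
      using \<kappa>(2) by (simp_all add: bij_betw_def)
    have fgQ': "finitely_generated A Q'" by (rule \<kappa>.finitely_generated_image[OF fgQ \<kappa>surj])
    interpret p: left_module_map A ?E Q' "\<kappa> \<circ> q" by (rule left_module_map_comp[OF q(1) \<kappa>(1)])
    let ?p = "\<kappa> \<circ> q"
    have p0: "?p e = \<zero>\<^bsub>Q'\<^esub> \<longleftrightarrow> e \<in> K" if e: "e \<in> carrier ?E" for e
      using q(3)[OF e] \<kappa>.inj_zero[OF \<kappa>inj q.hom_closed[OF e]] \<kappa>.hom_zero by auto
    have "(\<lambda>x. (x, \<zero>\<^bsub>V\<^esub>)) \<in> left_module_hom A I ?E" by (auto simp: left_module_hom_def)
    then interpret inc: left_module_map A I ?E "\<lambda>x. (x, \<zero>\<^bsub>V\<^esub>)"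
      by (rule left_module_mapI[OF \<iota>.N.left_module_axioms E.left_module_axioms])
    let ?j = "?p \<circ> (\<lambda>x. (x, \<zero>\<^bsub>V\<^esub>))"
    interpret j: left_module_map A I Q' ?j
      by (rule left_module_map_comp[OF inc.left_module_map_axioms p.left_module_map_axioms])
    have jinj: "inj_on ?j (carrier I)"
    proof (rule j.inj_onI_kernel)
      fix x assume x: "x \<in> carrier I" "?j x = \<zero>\<^bsub>Q'\<^esub>"
      then have "(x, \<zero>\<^bsub>V\<^esub>) \<in> K" using p0[of "(x, \<zero>\<^bsub>V\<^esub>)"] by simp
      then show "x = \<zero>\<^bsub>I\<^esub>" by (rule K0)
    qed
    have essQ: "essential_extension A L Q' (?j \<circ> \<iota>)"
      unfolding essential_extension_def
    proof (intro conjI allI impI)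
      show "left_module_map A L Q' (?j \<circ> \<iota>)"
        by (rule left_module_map_comp[OF \<iota>.left_module_map_axioms j.left_module_map_axioms])
      have "\<iota> ` carrier L \<subseteq> carrier I" by auto
      then show "inj_on (?j \<circ> \<iota>) (carrier L)"
        by (intro comp_inj_on essential_extensionD(2)[OF ess] inj_on_subset[OF jinj])
      fix Y assume Y: "submodule Y A Q' \<and> Y \<inter> (?j \<circ> \<iota>) ` carrier L \<subseteq> {\<zero>\<^bsub>Q'\<^esub>}"
      let ?Y = "{e \<in> carrier ?E. ?p e \<in> Y}"
      have sY: "submodule ?Y A ?E" by (rule p.submodule_preimage) (use Y in blast)
      have Y0: "\<zero>\<^bsub>Q'\<^esub> \<in> Y" using Y \<kappa>.N.submodule_zero by blast
      have KY: "K \<subseteq> ?Y"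
      proof
        fix e assume e: "e \<in> K"
        have ec: "e \<in> carrier ?E" by (rule E.submodule_carrier[OF K e])
        have "?p e = \<zero>\<^bsub>Q'\<^esub>" using p0[OF ec] e by blast
        then show "e \<in> ?Y" using ec Y0 by simp
      qed
      have sI: "submodule {x \<in> carrier I. ?j x \<in> Y} A I" by (rule j.submodule_preimage) (use Y in blast)
      have "{x \<in> carrier I. ?j x \<in> Y} \<inter> \<iota> ` carrier L \<subseteq> {\<zero>\<^bsub>I\<^esub>}"
      proof
        fix x assume "x \<in> {x \<in> carrier I. ?j x \<in> Y} \<inter> \<iota> ` carrier L"
        then obtain l where l: "l \<in> carrier L" "x = \<iota> l" "?j x \<in> Y" "x \<in> carrier I" by blast
        then have "?j x \<in> Y \<inter> (?j \<circ> \<iota>) ` carrier L" by auto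
        then have "?j x = \<zero>\<^bsub>Q'\<^esub>" using Y by blast
        then have "x = \<zero>\<^bsub>I\<^esub>" by (rule j.inj_zero[OF jinj l(4)])
        then show "x \<in> {\<zero>\<^bsub>I\<^esub>}" by simp
      qed
      then have I0: "{x \<in> carrier I. ?j x \<in> Y} = {\<zero>\<^bsub>I\<^esub>}" by (rule essential_extensionD(3)[OF ess sI])
      have "x = \<zero>\<^bsub>I\<^esub>" if "(x, \<zero>\<^bsub>V\<^esub>) \<in> ?Y" for x
      proof -
        have "x \<in> {x \<in> carrier I. ?j x \<in> Y}" using that by simp
        then show ?thesis unfolding I0 by simp
      qed
      then have "?Y \<in> ?F" using sY KY DK by (intro CollectI conjI) blast+
      then have YK: "?Y = K" using KY by (rule Kmax)
      have "y = \<zero>\<^bsub>Q'\<^esub>" if y: "y \<in> Y" for y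
      proof -
        have "y \<in> carrier Q'" using Y \<kappa>.N.submodule_carrier y by blast
        then obtain e where e: "e \<in> carrier ?E" "y = ?p e"
          unfolding \<kappa>surj[symmetric] q(2)[symmetric] by auto
        then have "e \<in> ?Y" using y by simp
        then have "e \<in> K" by (simp only: YK)
        then show ?thesis using p0[OF e(1)] e(2) by simp
      qed
      then show "Y = {\<zero>\<^bsub>Q'\<^esub>}" using Y0 by blast
    qed
    have jsurj: "?j ` carrier I = carrier Q'"
    proof (rule ccontr)
      assume "?j ` carrier I \<noteq> carrier Q'"
      then have "module_height A I < module_height A Q'"
        by (rule j.module_height_less[OF jinj _ fg_finite_height[OF \<kappa>.N.left_module_axioms fgQ']])
      then show False using max[OF essQ fgQ'] by simp
    qed
    (* K will be the graph of the map that sends v to - h v *)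
    have ex: "\<exists>x \<in> carrier I. (\<ominus>\<^bsub>I\<^esub> x, v) \<in> K" if v: "v \<in> carrier V" for v
    proof -
      have vE: "(\<zero>\<^bsub>I\<^esub>, v) \<in> carrier ?E" using v by simp
      obtain x where x: "x \<in> carrier I" "?p (\<zero>\<^bsub>I\<^esub>, v) = ?j x"
        using p.hom_closed[OF vE] unfolding jsurj[symmetric] by auto
      have xE: "(x, \<zero>\<^bsub>V\<^esub>) \<in> carrier ?E" "(\<ominus>\<^bsub>I\<^esub> x, v) \<in> carrier ?E" using x v by simp_all
      have "?p (x, \<zero>\<^bsub>V\<^esub>) \<oplus>\<^bsub>Q'\<^esub> ?p (\<ominus>\<^bsub>I\<^esub> x, v) = ?p ((x, \<zero>\<^bsub>V\<^esub>) \<oplus>\<^bsub>?E\<^esub> (\<ominus>\<^bsub>I\<^esub> x, v))"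
        by (rule p.hom_add[OF xE, symmetric])
      also have "\<dots> = ?p (x, \<zero>\<^bsub>V\<^esub>)" using x v by (simp add: \<iota>.N.M.r_neg)
      finally have "?p (\<ominus>\<^bsub>I\<^esub> x, v) = \<zero>\<^bsub>Q'\<^esub>"
        using p.hom_closed[OF xE(1)] p.hom_closed[OF xE(2)] \<kappa>.N.M.add.l_cancel_one by metis
      then show ?thesis using p0[OF xE(2)] x(1) by blast
    qed
    have uniq: "x = y" if "(\<ominus>\<^bsub>I\<^esub> x, v) \<in> K" "(\<ominus>\<^bsub>I\<^esub> y, v) \<in> K" "x \<in> carrier I" "y \<in> carrier I" "v \<in> carrier V"
      for x y v
    proof -
      have "(\<ominus>\<^bsub>I\<^esub> y, v) \<oplus>\<^bsub>?E\<^esub> (\<ominus>\<^bsub>A\<^esub> \<one>\<^bsub>A\<^esub>) \<odot>\<^bsub>?E\<^esub> (\<ominus>\<^bsub>I\<^esub> x, v) \<in> K"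
        by (intro E.submodule_add[OF K] E.submodule_smult[OF K] that) simp
      moreover have "(\<ominus>\<^bsub>I\<^esub> y, v) \<oplus>\<^bsub>?E\<^esub> (\<ominus>\<^bsub>A\<^esub> \<one>\<^bsub>A\<^esub>) \<odot>\<^bsub>?E\<^esub> (\<ominus>\<^bsub>I\<^esub> x, v) = (x \<ominus>\<^bsub>I\<^esub> y, \<zero>\<^bsub>V\<^esub>)"
        using that by (simp add: \<iota>.N.smult_minus_one g.N.smult_minus_one g.N.M.r_neg a_minus_def \<iota>.N.M.a_comm)
      ultimately have "x \<ominus>\<^bsub>I\<^esub> y = \<zero>\<^bsub>I\<^esub>" using K0 by simp
      then show ?thesis using \<iota>.N.diff_eq_zero_iff that(3,4) by blast
    qed
    define h where "h v = (SOME x. x \<in> carrier I \<and> (\<ominus>\<^bsub>I\<^esub> x, v) \<in> K)" for v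
    have h: "h v \<in> carrier I" "(\<ominus>\<^bsub>I\<^esub> h v, v) \<in> K" if "v \<in> carrier V" for v
      using someI_ex[of "\<lambda>x. x \<in> carrier I \<and> (\<ominus>\<^bsub>I\<^esub> x, v) \<in> K"] ex[OF that] unfolding h_def by blast+
    have "h \<in> left_module_hom A V I"
      unfolding left_module_hom_def
    proof (intro CollectI conjI ballI funcsetI)
      fix v assume v: "v \<in> carrier V"
      show "h v \<in> carrier I" by (rule h(1)[OF v])
      show "h (v \<oplus>\<^bsub>V\<^esub> w) = h v \<oplus>\<^bsub>I\<^esub> h w" if w: "w \<in> carrier V" for w
      proof (rule uniq[OF h(2)])
        have "(\<ominus>\<^bsub>I\<^esub> h v, v) \<oplus>\<^bsub>?E\<^esub> (\<ominus>\<^bsub>I\<^esub> h w, w) \<in> K" by (rule E.submodule_add[OF K h(2)[OF v] h(2)[OF w]])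
        then show "(\<ominus>\<^bsub>I\<^esub> (h v \<oplus>\<^bsub>I\<^esub> h w), v \<oplus>\<^bsub>V\<^esub> w) \<in> K"
          using h(1)[OF v] h(1)[OF w] by (simp add: \<iota>.N.M.minus_add)
      qed (use v w h(1) in auto)
    next
      fix a v assume a: "a \<in> carrier A" and v: "v \<in> carrier V"
      show "h (a \<odot>\<^bsub>V\<^esub> v) = a \<odot>\<^bsub>I\<^esub> h v"
      proof (rule uniq[OF h(2)])
        have "a \<odot>\<^bsub>?E\<^esub> (\<ominus>\<^bsub>I\<^esub> h v, v) \<in> K" by (rule E.submodule_smult[OF K a h(2)[OF v]])
        then show "(\<ominus>\<^bsub>I\<^esub> (a \<odot>\<^bsub>I\<^esub> h v), a \<odot>\<^bsub>V\<^esub> v) \<in> K"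
          using a h(1)[OF v] by (simp add: \<iota>.N.smult_r_minus)
      qed (use a v h(1) in auto)
    qed
    moreover have "h (g u) = f u" if u: "u \<in> carrier U" for u
    proof (rule uniq[OF h(2)])
      have "(\<ominus>\<^bsub>A\<^esub> \<one>\<^bsub>A\<^esub>) \<odot>\<^bsub>?E\<^esub> (f u, \<ominus>\<^bsub>V\<^esub> g u) \<in> K"
        by (rule E.submodule_smult[OF K]) (use DK u in auto)
      then show "(\<ominus>\<^bsub>I\<^esub> f u, g u) \<in> K"
        using u by (simp add: \<iota>.N.smult_minus_one g.N.smult_minus_one)
    qed (use u h(1) in auto)
    ultimately show ?thesis by blast
  qed
  show ?thesis
    unfolding injective_in_mod_def in_mod_def
    using \<iota>.N.left_module_axioms fg extend by blast
qed

section \<open>Nakayama algebras of Loewy length two\<close>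

text \<open>A largest essential extension \<open>I\<close> of \<open>L\<close> is indecomposable: the traces on \<open>L\<close> of the parts of a
  decomposition are comparable, so one of them is zero, and then that part is zero because the
  extension is essential.  So \<open>I\<close> is uniserial, and \<open>L\<close> fills it by \<open>uniserial_submodule_full\<close>.\<close>

lemma (in artin_algebra) essential_extension_of_uniserial:
  fixes L :: "'a list_module"
  assumes nak: "nakayama_algebra A" and L: "left_module A L" "finitely_generated A L"
    and uni: "uniserial A L"
    and rad2: "\<And>i j. i \<in> jacobson_radical A \<Longrightarrow> j \<in> jacobson_radical A \<Longrightarrow> i \<otimes>\<^bsub>A\<^esub> j = \<zero>\<^bsub>A\<^esub>"
    and j: "j \<in> jacobson_radical A" "y \<in> carrier L" "j \<odot>\<^bsub>L\<^esub> y \<noteq> \<zero>\<^bsub>L\<^esub>"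
  obtains I :: "'a list_module" and \<iota> where "left_module_map A L I \<iota>"
    "bij_betw \<iota> (carrier L) (carrier I)" "injective_in_mod A I"
proof -
  interpret L: left_module A L by (rule L(1))
  let ?P = "\<lambda>I :: 'a list_module. finitely_generated A I \<and> (\<exists>\<iota>. essential_extension A L I \<iota>)"
  obtain B where B: "\<And>(I :: 'a list_module) \<iota>. essential_extension A L I \<iota> \<Longrightarrow>
      bounded_height {K. submodule K A I} B"
    using essential_extensions_bounded[OF L rad2] by blast
  have le: "module_height A I \<le> B" if "?P I" for I
    using that B unfolding module_height_def by (blast intro: Least_le)
  have "(\<lambda>x. x) \<in> left_module_hom A L L" by (auto simp: left_module_hom_def)
  then have "left_module_map A L L (\<lambda>x. x)" by (rule left_module_mapI[OF L(1) L(1)])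
  moreover have "K = {\<zero>\<^bsub>L\<^esub>}"
    if K: "submodule K A L" "K \<inter> (\<lambda>x. x) ` carrier L \<subseteq> {\<zero>\<^bsub>L\<^esub>}" for K
    using K(2) L.submodule_subset[OF K(1)] L.submodule_zero[OF K(1)] by auto
  ultimately have "essential_extension A L L (\<lambda>x. x)" by (simp add: essential_extension_def)
  then have "?P L" using L(2) by blast
  then obtain I where I: "?P I" and max: "\<And>E. ?P E \<Longrightarrow> module_height A E \<le> module_height A I"
    using ex_has_greatest_nat[of ?P L "module_height A" "Suc B"] le by (auto simp: less_Suc_eq_le)
  then obtain \<iota> where ess: "essential_extension A L I \<iota>" and fg: "finitely_generated A I" by blast
  interpret \<iota>: left_module_map A L I \<iota> by (rule essential_extensionD(1)[OF ess])
  note inj = essential_extensionD(2)[OF ess]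
  have injective: "injective_in_mod A I"
    by (rule largest_essential_extension_injective[OF ess fg max]) blast
  have jy: "j \<odot>\<^bsub>I\<^esub> \<iota> y \<noteq> \<zero>\<^bsub>I\<^esub>"
    using \<iota>.inj_zero[OF inj, of "j \<odot>\<^bsub>L\<^esub> y"] j A.jacobson_carrier[OF j(1)] by (auto simp: \<iota>.hom_smult)
  have "indecomposable A I"
    unfolding indecomposable_def
  proof (intro conjI allI impI)
    have "\<iota> y \<noteq> \<zero>\<^bsub>I\<^esub>" using jy \<iota>.N.smult_r_null[OF A.jacobson_carrier[OF j(1)]] by metis
    then show "carrier I \<noteq> {\<zero>\<^bsub>I\<^esub>}" using \<iota>.hom_closed[OF j(2)] by (metis singletonD)
    fix N K assume *: "submodule N A I \<and> submodule K A I \<and> N <+>\<^bsub>I\<^esub> K = carrier I \<and> N \<inter> K = {\<zero>\<^bsub>I\<^esub>}"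
    then have N: "submodule N A I" and K: "submodule K A I" and int: "N \<inter> K = {\<zero>\<^bsub>I\<^esub>}" by auto
    have "{x \<in> carrier L. \<iota> x \<in> N} \<subseteq> {x \<in> carrier L. \<iota> x \<in> K} \<or>
        {x \<in> carrier L. \<iota> x \<in> K} \<subseteq> {x \<in> carrier L. \<iota> x \<in> N}"
      using uni \<iota>.submodule_preimage[OF N] \<iota>.submodule_preimage[OF K] unfolding uniserial_def by blast
    then have "N \<inter> \<iota> ` carrier L \<subseteq> N \<inter> K \<or> K \<inter> \<iota> ` carrier L \<subseteq> N \<inter> K" by blast
    then show "N = {\<zero>\<^bsub>I\<^esub>} \<or> K = {\<zero>\<^bsub>I\<^esub>}"
      unfolding int
      by (elim disj_forward essential_extensionD(3)[OF ess N] essential_extensionD(3)[OF ess K])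
  qed
  then have "uniserial A I" using nak injective unfolding nakayama_algebra_def by blast
  then have "\<iota> ` carrier L = carrier I"
  proof (rule \<iota>.N.uniserial_submodule_full[OF finite_height_regular_algebra])
    show "submodule (\<iota> ` carrier L) A I" by (rule \<iota>.submodule_image[OF L.submodule_full])
    show "\<iota> y \<in> \<iota> ` carrier L" using j(2) by blast
    show "i \<odot>\<^bsub>I\<^esub> (k \<odot>\<^bsub>I\<^esub> x) = \<zero>\<^bsub>I\<^esub>"
      if "i \<in> jacobson_radical A" "k \<in> jacobson_radical A" "x \<in> carrier I" for i k x
      using that rad2[OF that(1,2)] A.jacobson_carrier by (simp add: \<iota>.N.smult_assoc[symmetric])
  qed (use j(1) jy in simp_all)
  then have "bij_betw \<iota> (carrier L) (carrier I)" using inj by (simp add: bij_betw_def)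
  then show ?thesis by (rule that[OF \<iota>.left_module_map_axioms _ injective])
qed

text \<open>Let \<open>S\<close> be the submodule annihilated by \<open>J\<close>.  A submodule not contained in \<open>S\<close> is everything by
  \<open>uniserial_submodule_full\<close>, and \<open>S\<close> is simple, being both semisimple and uniserial.\<close>

lemma (in artin_algebra) uniserial_length_at_most_two:
  assumes M: "left_module A M" and uni: "uniserial A M"
    and ann: "\<And>i j x. i \<in> jacobson_radical A \<Longrightarrow> j \<in> jacobson_radical A \<Longrightarrow> x \<in> carrier M \<Longrightarrow>
      i \<odot>\<^bsub>M\<^esub> (j \<odot>\<^bsub>M\<^esub> x) = \<zero>\<^bsub>M\<^esub>"
    and j: "j \<in> jacobson_radical A" "y \<in> carrier M" "j \<odot>\<^bsub>M\<^esub> y \<noteq> \<zero>\<^bsub>M\<^esub>"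
  shows "composition_length A M \<le> 2"
proof -
  interpret M: left_module A M by (rule M)
  let ?S = "{x \<in> carrier M. \<forall>i \<in> jacobson_radical A. i \<odot>\<^bsub>M\<^esub> x = \<zero>\<^bsub>M\<^esub>}"
  note Jc = A.jacobson_carrier
  have S: "submodule ?S A M"
  proof (rule M.submoduleI)
    show "a \<odot>\<^bsub>M\<^esub> x \<in> ?S" if "a \<in> carrier A" "x \<in> ?S" for a x
    proof -
      have "i \<odot>\<^bsub>M\<^esub> (a \<odot>\<^bsub>M\<^esub> x) = \<zero>\<^bsub>M\<^esub>" if i: "i \<in> jacobson_radical A" for i
      proof -
        have "i \<odot>\<^bsub>M\<^esub> (a \<odot>\<^bsub>M\<^esub> x) = (i \<otimes>\<^bsub>A\<^esub> a) \<odot>\<^bsub>M\<^esub> x"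
          using \<open>a \<in> carrier A\<close> \<open>x \<in> ?S\<close> Jc[OF i] by (simp add: M.smult_assoc)
        then show ?thesis using A.jacobson_mult_right[OF i \<open>a \<in> carrier A\<close>] \<open>x \<in> ?S\<close> by simp
      qed
      then show ?thesis using that by simp
    qed
  qed (use Jc in \<open>auto simp: M.smult_r_distr\<close>)
  show ?thesis
  proof (rule M.composition_length_two[OF S])
    have "j \<odot>\<^bsub>M\<^esub> y \<in> ?S" using ann[OF _ j(1,2)] j(2) Jc[OF j(1)] by simp
    then show "?S \<noteq> {\<zero>\<^bsub>M\<^esub>}" using j(3) by blast
    have "y \<notin> ?S" using j by blast
    then show "?S \<noteq> carrier M" using j(2) by blast
    fix N assume N: "submodule N A M"
    show "N = {\<zero>\<^bsub>M\<^esub>} \<or> N = ?S \<or> N = carrier M"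
    proof (cases "N \<subseteq> ?S")
      case False
      then obtain x i where "x \<in> N" "i \<in> jacobson_radical A" "i \<odot>\<^bsub>M\<^esub> x \<noteq> \<zero>\<^bsub>M\<^esub>"
        using M.submodule_carrier[OF N] by blast
      then have "N = carrier M"
        by (intro M.uniserial_submodule_full[OF finite_height_regular_algebra uni ann N])
      then show ?thesis by blast
    next
      case True
      have "N = {\<zero>\<^bsub>M\<^esub>}" if "N \<noteq> ?S"
      proof -
        obtain x where x: "x \<in> ?S" "x \<notin> N" using True \<open>N \<noteq> ?S\<close> by blast
        then have xc: "x \<in> carrier M" by simp
        obtain K where K: "submodule K A M" "\<not> K \<subseteq> N"
          "K \<inter> N \<subseteq> (\<lambda>a. a \<odot>\<^bsub>M\<^esub> x) ` jacobson_radical A"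
          by (rule M.supplement_mod_radical[OF finite_height_regular_algebra N xc x(2)])
        have "N \<subseteq> K" using uni N K(1,2) unfolding uniserial_def by blast
        have "n = \<zero>\<^bsub>M\<^esub>" if "n \<in> N" for n
        proof -
          have "n \<in> (\<lambda>a. a \<odot>\<^bsub>M\<^esub> x) ` jacobson_radical A" using K(3) \<open>N \<subseteq> K\<close> that by blast
          then show ?thesis using x(1) by auto
        qed
        then show ?thesis using M.submodule_zero[OF N] by blast
      qed
      then show ?thesis by blast
    qed
  qed
qed

lemma (in artin_algebra) length_at_most_two_if_nakayama:
  fixes M :: "'a list_module"
  assumes nak: "nakayama_algebra A"
    and rad2: "\<And>i j. i \<in> jacobson_radical A \<Longrightarrow> j \<in> jacobson_radical A \<Longrightarrow> i \<otimes>\<^bsub>A\<^esub> j = \<zero>\<^bsub>A\<^esub>"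
    and M: "left_module A M" "finite_length A M" "indecomposable A M"
  shows "composition_length A M \<le> 2"
proof -
  interpret M: left_module A M by (rule M(1))
  have fg: "finitely_generated A M" by (rule M.finite_length_imp_fg[OF M(2)])
  have fh: "finite_height A M" by (rule fg_finite_height[OF M(1) fg])
  note Jc = A.jacobson_carrier
  show ?thesis
  proof (cases "\<forall>j \<in> jacobson_radical A. \<forall>x \<in> carrier M. j \<odot>\<^bsub>M\<^esub> x = \<zero>\<^bsub>M\<^esub>")
    case True
    have "carrier M \<noteq> {\<zero>\<^bsub>M\<^esub>}" using M(3) unfolding indecomposable_def by (rule conjunct1)
    then have "composition_length A M \<le> 1"
      by (rule M.composition_length_simple)
        (rule M.indecomposable_simple_if_radical_annihilates[OF finite_height_regular_algebra fh _ M(3)],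
          use True in blast)
    then show ?thesis by simp
  next
    case False
    then obtain j x where x: "x \<in> carrier M" and j: "j \<in> jacobson_radical A" "j \<odot>\<^bsub>M\<^esub> x \<noteq> \<zero>\<^bsub>M\<^esub>" by blast
    obtain P i p where P: "submodule P A (regular_module A)"
      and uniP: "uniserial A (regular_module A\<lparr>carrier := P\<rparr>)"
      and ip: "i \<in> jacobson_radical A" "p \<in> P" "i \<odot>\<^bsub>M\<^esub> (p \<odot>\<^bsub>M\<^esub> x) \<noteq> \<zero>\<^bsub>M\<^esub>"
      by (rule uniserial_summand_not_annihilated[OF nak M(1) x j])
    let ?L = "(\<lambda>a. a \<odot>\<^bsub>M\<^esub> x) ` P"
    let ?LM = "M\<lparr>carrier := ?L\<rparr>"
    interpret S: left_module A "regular_module A" by (rule A.left_module_regular)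
    interpret P: left_module A "regular_module A\<lparr>carrier := P\<rparr>" by (rule S.left_module_submodule[OF P])
    note Pc = S.submodule_carrier[OF P, simplified]
    have L: "submodule ?L A M" by (rule M.submodule_orbit[OF _ x]) (use P in \<open>simp add: A.left_ideal_iff_submodule\<close>)
    interpret L: left_module A ?LM by (rule M.left_module_submodule[OF L])
    have "(\<lambda>a. a \<odot>\<^bsub>M\<^esub> x) \<in> left_module_hom A (regular_module A\<lparr>carrier := P\<rparr>) ?LM"
      using x Pc by (auto simp: left_module_hom_def M.smult_l_distr M.smult_assoc)
    then interpret e: left_module_map A "regular_module A\<lparr>carrier := P\<rparr>" ?LM "\<lambda>a. a \<odot>\<^bsub>M\<^esub> x"
      by (rule left_module_mapI[OF P.left_module_axioms L.left_module_axioms])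
    have uniL: "uniserial A ?LM" by (rule e.uniserial_image[OF uniP]) simp
    have fgL: "finitely_generated A ?LM"
      by (intro L.finite_length_imp_fg L.finite_height_imp_finite_length M.finite_height_submodule[OF fh L])
    have y: "p \<odot>\<^bsub>M\<^esub> x \<in> carrier ?LM" "i \<odot>\<^bsub>?LM\<^esub> (p \<odot>\<^bsub>M\<^esub> x) \<noteq> \<zero>\<^bsub>?LM\<^esub>" using ip(2,3) by simp_all
    obtain I :: "'a list_module" and \<iota> where \<iota>: "left_module_map A ?LM I \<iota>"
      and bij: "bij_betw \<iota> (carrier ?LM) (carrier I)" and injective: "injective_in_mod A I"
      by (rule essential_extension_of_uniserial[OF nak L.left_module_axioms fgL uniL rad2 ip(1) y])
    interpret \<iota>: left_module_map A ?LM I \<iota> by (rule \<iota>)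
    have "in_mod A ?LM" "in_mod A M"
      using L.left_module_axioms fgL M(1) fg by (simp_all add: in_mod_def)
    moreover have "(\<lambda>u. u) \<in> left_module_hom A ?LM M"
      using M.submodule_carrier[OF L] by (auto simp: left_module_hom_def)
    moreover have "inj_on (\<lambda>u. u) (carrier ?LM)" by simp
    (* extending the isomorphism from L to I to all of M splits off L *)
    ultimately obtain h where h: "h \<in> left_module_hom A M I" "\<And>u. u \<in> carrier ?LM \<Longrightarrow> h u = \<iota> u"
      using injective \<iota>.hom unfolding injective_in_mod_def by blast
    interpret h: left_module_map A M I h by (rule left_module_mapI[OF M(1) \<iota>.N.left_module_axioms h(1)])
    have \<iota>inj: "inj_on \<iota> (carrier ?LM)" and \<iota>surj: "\<iota> ` carrier ?LM = carrier I"
      using bij unfolding bij_betw_def by blast+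
    let ?K = "{u \<in> carrier M. h u = \<zero>\<^bsub>I\<^esub>}"
    have "u \<in> ?L <+>\<^bsub>M\<^esub> ?K" if u: "u \<in> carrier M" for u
    proof -
      have "h u \<in> \<iota> ` carrier ?LM" unfolding \<iota>surj by (rule h.hom_closed[OF u])
      then obtain l where "l \<in> carrier ?LM" "h u = \<iota> l" by blast
      then have l: "l \<in> ?L" "h u = \<iota> l" by simp_all
      have lc: "l \<in> carrier M" by (rule M.submodule_carrier[OF L l(1)])
      have "h (u \<ominus>\<^bsub>M\<^esub> l) = \<zero>\<^bsub>I\<^esub>"
        using h.hom_diff[OF u lc] l h(2)[of l] h.hom_closed[OF u] by (simp add: \<iota>.N.diff_eq_zero_iff)
      then have "u \<ominus>\<^bsub>M\<^esub> l \<in> ?K" using u lc by simp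
      moreover have "u = l \<oplus>\<^bsub>M\<^esub> (u \<ominus>\<^bsub>M\<^esub> l)"
        using u lc M.M.a_lcomm[of l u "\<ominus>\<^bsub>M\<^esub> l"] by (simp add: a_minus_def M.M.r_neg)
      ultimately show ?thesis unfolding M.mem_set_add using l(1) by blast
    qed
    then have sum: "?L <+>\<^bsub>M\<^esub> ?K = carrier M"
      using M.submodule_subset[OF M.submodule_set_add[OF L h.submodule_kernel]] by blast
    have "u = \<zero>\<^bsub>M\<^esub>" if "u \<in> ?L" "u \<in> ?K" for u
      using \<iota>.inj_zero[OF \<iota>inj, of u] h(2)[of u] that by simp
    then have "?L \<inter> ?K \<subseteq> {\<zero>\<^bsub>M\<^esub>}" by blast
    then have int: "?L \<inter> ?K = {\<zero>\<^bsub>M\<^esub>}"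
      using M.submodule_zero[OF M.submodule_Int[OF L h.submodule_kernel]] by blast
    have "?L \<noteq> {\<zero>\<^bsub>M\<^esub>}"
      using ip M.smult_r_null[OF Jc[OF ip(1)]] by (metis (no_types, lifting) imageI singletonD)
    then have "?K = {\<zero>\<^bsub>M\<^esub>}"
      using indecomposableD[OF M(3) L h.submodule_kernel sum int] by blast
    then have "?L <+>\<^bsub>M\<^esub> ?K \<subseteq> ?L"
      using M.set_add_least[OF L order_refl, of ?K] M.submodule_zero[OF L] by simp
    then have full: "?L = carrier M" using sum M.submodule_subset[OF L] by simp
    have "?LM = M" by (simp add: full)
    then have "uniserial A M" using uniL by simp
    moreover have "a \<odot>\<^bsub>M\<^esub> (b \<odot>\<^bsub>M\<^esub> u) = \<zero>\<^bsub>M\<^esub>"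
      if "a \<in> jacobson_radical A" "b \<in> jacobson_radical A" "u \<in> carrier M" for a b u
      using that rad2[OF that(1,2)] Jc by (simp add: M.smult_assoc[symmetric])
    ultimately show ?thesis by (rule uniserial_length_at_most_two[OF M(1) _ _ j(1) x j(2)])
  qed
qed

theorem proposition5p2p1:
  fixes R :: "('r, 'c) ring_scheme" and A :: "('r, 'a, 'd) module_scheme"
  assumes "artin_algebra R A"
  shows "representation_bound A = 2 \<longleftrightarrow> nakayama_algebra A \<and> loewy_length A = 2"
proof -
  interpret artin_algebra R A by fact
  interpret S: left_module A "regular_module A" by (rule A.left_module_regular)
  let ?ind = "\<lambda>M :: 'a list_module. left_module A M \<and> finite_length A M \<and> indecomposable A M"
  have loewy: "loewy_length A = 2 \<longleftrightarrow> jacobson_radical A \<noteq> {\<zero>\<^bsub>A\<^esub>} \<and>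
      (\<forall>i \<in> jacobson_radical A. \<forall>j \<in> jacobson_radical A. i \<otimes>\<^bsub>A\<^esub> j = \<zero>\<^bsub>A\<^esub>)"
    by (rule A.loewy_length_eq_2_iff[OF S.finite_height_imp_finite_length[OF finite_height_regular_algebra]])
  have "(\<forall>M. ?ind M \<longrightarrow> composition_length A M \<le> 2) \<longleftrightarrow>
      nakayama_algebra A \<and> (\<forall>i \<in> jacobson_radical A. \<forall>j \<in> jacobson_radical A. i \<otimes>\<^bsub>A\<^esub> j = \<zero>\<^bsub>A\<^esub>)"
    using nakayama_if_length_at_most_two radical_square_zero_if_length_at_most_two
      length_at_most_two_if_nakayama by blast
  then show ?thesis
    unfolding representation_bound_eq_2_iff loewy using radical_zero_iff_all_simple by blast
qed

end
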